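(* Let $P=P_{\Omega,z}$ be a differential operator of order $N$ as described in the context and let $Q=Q_{\Omega,(z,[\gamma])}\in\mathcal{D}^P_K$. Let $\lambda_1,\dots,\lambda_N$ be the distinct solutions of $\lambda^N=X$, and let $F_\Omega(X,Y)=\prod_{j=1}^N(Y-A(\Omega,\lambda_j))$, where $A(\Omega,\lambda)$ is the series with $Q\Psi=A\Psi$; this is a polynomial in $X$ and $Y$, which one writes as $$F_\Omega(X,Y)=\sum_{j,k}f_{j,k}(\Omega)X^jY^k .$$ Then the coefficient $f_{j,k}(\Omega)$ is an automorphic form of weight $NK-Nj-Kk$ for $\Gamma$.
   Context: **Groups and automorphic forms.** $F$ is a totally real number field with $[F:\mathbb{Q}]=g$ and distinct embeddings $\varphi_1,\dots,\varphi_g:F\hookrightarrow\mathbb{R}$. $Sp(n,A)=\{\alpha\in GL(2n,A)\mid {}^t\alpha J\alpha=J\}$, $J=\begin{pmatrix}0&-I_n\\ I_n&0\end{pmatrix}$. $\mathbb{H}_n=\{\Omega\in M_n(\mathbb{C})\mid {}^t\Omega=\Omega,\ \mathrm{Im}(\Omega)>0\}$. $Sp(n,F)$ is embedded in $Sp(n,\mathbb{R})^g$ by $\alpha\mapsto(\alpha^{\varphi_1},\dots,\alpha^{\varphi_g})$ and acts on $\mathbb{H}_n^g$ by $\alpha(\Omega)=(\alpha^{\varphi_1}(\Omega_1),\dots,\alpha^{\varphi_g}(\Omega_g))$, where $\begin{pmatrix}A&B\\C&D\end{pmatrix}(\Omega)=(A\Omega+B)(C\Omega+D)^{-1}$. Put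 $j_\alpha(\Omega)=\prod_{\nu=1}^g\det(C^{\varphi_\nu}\Omega_\nu+D^{\varphi_\nu})$. A congruence subgroup $\Gamma$ of $Sp(n,F)$ is a subgroup containing, with finite index, some $\Gamma(\mathfrak{c})=\{\alpha\in Sp(n,\mathfrak{O}_F)\mid\alpha-I_{2n}\in\mathfrak{c}M(2n,\mathfrak{O}_F)\}$, $\mathfrak{c}$ an ideal of the ring of integers $\mathfrak{O}_F$. An automorphic form of weight $K$ for $\Gamma$ is a holomorphic function $f$ on $\mathbb{H}_n^g$ with $f(\alpha(\Omega))=j_\alpha(\Omega)^Kf(\Omega)$ for all $\alpha\in\Gamma$ and, when $F=\mathbb{Q}$ and $n=1$, such that for every $\alpha\in SL(2,\mathbb{Z})$ one has $j_\alpha(\Omega)^{-K}f(\alpha(\Omega))=\sum_{k\ge0}\tilde f_{\alpha,k}\exp(2\pi\sqrt{-1}k\Omega/N_\alpha)$ with $\tilde f_{\alpha,k}\in\mathbb{C}$, $N_\alpha\in\mathbb{Z}_{>0}$. **The operator $P$.** $P_{\Omega,z}=\frac{\partial^N}{\partial z^N}+a_2(\Omega,z)\frac{\partial^{N-2}}{\partial z^{N-2}}+\cdots+a_N(\Omega,z)$, where $\Omega\in\mathbb{H}_n^g$, $z\in\mathbb{C}$; $\Omega\mapsto a_l(\Omega,z)$ is holomorphic for generic $z$; for fixed $\Omega$, $z\mapsto a_l(\Omega,z)$ is analytic with at most poles; and $a_l(\alpha(\Omega),z/j_\alpha(\Omega))=j_\alpha(\Omega)^la_l(\Omega,z)$ for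 $\alpha\in\Gamma$, where $\Gamma\subset Sp(n,F)$ is a fixed congruence subgroup. $\mathcal{N}_\Omega\subset\mathbb{C}$ is the union of the pole sets of $z\mapsto a_l(\Omega,z)$. If $F=\mathbb{Q}$ and $n=1$ one assumes in addition that for every $\alpha\in SL(2,\mathbb{Z})$, $j_\alpha(\Omega)^{-l}a_l(\alpha(\Omega),z/j_\alpha(\Omega))=\sum_{k\ge0}\tilde a_{l,\alpha,k}(z)\exp(2\pi\sqrt{-1}k\Omega/N_{l,\alpha})$ with $\tilde a_{l,\alpha,k}$ holomorphic on $j_\alpha(\Omega)\cdot(\mathbb{C}-\mathcal{N}_{\alpha(\Omega)})$ and $N_{l,\alpha}\in\mathbb{Z}_{>0}$. **Universal covering and Baker–Akhiezer function.** $\mathfrak{X}_\Omega$ is the universal covering of $\mathbb{C}-\mathcal{N}_\Omega$; with base point $w$, its points are $(z,[\gamma])$, $\gamma$ an arc in $\mathbb{C}-\mathcal{N}_\Omega$ from $w$ to $z$. $\Psi(\Omega,(z,[\gamma]),w,\lambda)=\big(\sum_{s\ge0}\xi_s(\Omega,(z,[\gamma]),w)\lambda^{-s}\big)e^{\lambda(z-w)}$ is the unique formal solution of $P_{\Omega,z}u=\lambda^Nu$ of this form with $\xi_0\equiv1$ and $\xi_s(\Omega,(w,[id]),w)=0$ for $s\ge1$. **The space $\mathcal{D}^P_K$.** It is the space of operators $Q=\sum_{j=0}^Mb_j(\Omega,(z,[\gamma]))\frac{\partial^{M-j}}{\partial z^{M-j}}$ (any order $M$, $b_j$ locally analytic in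 $(z,[\gamma])\in\mathfrak{X}_\Omega$) which commute with $P$; are of weight $K$, i.e. $Q_{\alpha(\Omega),(z/j_\alpha(\Omega),[\gamma/j_\alpha(\Omega)])}=j_\alpha(\Omega)^KQ_{\Omega,(z,[\gamma])}$ for all $\alpha\in\Gamma$; have $\Omega\mapsto b_j(\Omega,(z,[\gamma]))$ holomorphic for generic $(z,[\gamma])$; and, if $F=\mathbb{Q}$ and $n=1$, have for every $\alpha\in SL(2,\mathbb{Z})$ Fourier expansions $j_\alpha(\Omega)^{-K-j+M}b_j\big(\alpha(\Omega),(\tfrac{z}{j_\alpha(\Omega)},[\tfrac{\gamma}{j_\alpha(\Omega)}])\big)=\sum_{k\ge0}\tilde b_{j,\alpha,k}(z,[\gamma])\exp(2\pi\sqrt{-1}k\Omega/N_{j,\alpha})$ with $\tilde b_{j,\alpha,k}$ multivalued analytic on $j_\alpha(\Omega)\cdot(\mathbb{C}-\mathcal{N}_{\alpha(\Omega)})$. For $Q\in\mathcal{D}^P_K$ there is a series $A(\Omega,\lambda)=\sum_{s=-M}^\infty A_s(\Omega)\lambda^{-s}$, independent of $(z,[\gamma])$ and $w$, with $Q\Psi=A\Psi$ for generic $\lambda$. The polynomial $F_\Omega(X,Y)$ is the characteristic polynomial of the linear operator induced by $Q$ on the solution space of $P_{\Omega,z}u=Xu$. *)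

theory Defs
  imports "HOL-Complex_Analysis.Complex_Analysis"
    "HOL-Computational_Algebra.Formal_Laurent_Series"
begin

section \<open>Totally real number fields and congruence subgroups\<close>

text \<open>
  The field \<open>F\<close> is the type \<open>'f\<close>, and \<open>'g\<close> indexes its embeddings. As \<open>vector_space.dim\<close> is
  \<open>0\<close> in infinite dimension, the last conjunct says that \<open>F\<close> is a number field of degree
  \<open>g = CARD('g)\<close>. Then \<open>\<phi>\<close> lists all embeddings of \<open>F\<close> into the complex numbers, so
  \<open>F\<close> is totally real.
\<close>

definition totally_real_embeddings :: "('g::finite \<Rightarrow> 'f::field_char_0 \<Rightarrow> real) \<Rightarrow> bool" where
  "totally_real_embeddings \<phi> \<longleftrightarrow>
     (\<forall>\<nu>. \<phi> \<nu> 1 = 1 \<and> (\<forall>x y. \<phi> \<nu> (x + y) = \<phi> \<nu> x + \<phi> \<nu> y \<and> \<phi> \<nu> (x * y) = \<phi> \<nu> x * \<phi> \<nu> y)) \<and>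
     inj \<phi> \<and>
     vector_space.dim (\<lambda>(q::rat) (x::'f). of_rat q * x) UNIV = CARD('g)"

definition integer_ring :: "'f::field_char_0 set" where
  "integer_ring = {x. algebraic_int x}"

definition nonzero_integral_ideal :: "'f::field_char_0 set \<Rightarrow> bool" where
  "nonzero_integral_ideal \<cc> \<longleftrightarrow>
     \<cc> \<subseteq> integer_ring \<and> 0 \<in> \<cc> \<and> \<cc> \<noteq> {0} \<and>
     (\<forall>x\<in>\<cc>. \<forall>y\<in>\<cc>. x + y \<in> \<cc>) \<and> (\<forall>x\<in>integer_ring. \<forall>y\<in>\<cc>. x * y \<in> \<cc>)"

text \<open>Matrices of size \<open>2n\<close> are indexed by \<open>'n + 'n\<close>, with \<open>n = CARD('n)\<close>.\<close>

definition J_mat :: "'f::comm_ring_1^('n::finite + 'n)^('n + 'n)" where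
  "J_mat = (\<chi> p q. case (p, q) of
      (Inl i, Inr k) \<Rightarrow> if i = k then - 1 else 0
    | (Inr i, Inl k) \<Rightarrow> if i = k then 1 else 0
    | _ \<Rightarrow> 0)"

definition entries_in :: "'f set \<Rightarrow> 'f^'m^'m \<Rightarrow> bool" where
  "entries_in R \<alpha> \<longleftrightarrow> (\<forall>p q. \<alpha> $ p $ q \<in> R)"

definition Sp :: "'f::field_char_0 set \<Rightarrow> ('f^('n::finite + 'n)^('n + 'n)) set" where
  "Sp R = {\<alpha>. entries_in R \<alpha> \<and>
             (\<exists>\<beta>. entries_in R \<beta> \<and> \<alpha> ** \<beta> = mat 1 \<and> \<beta> ** \<alpha> = mat 1) \<and>
             transpose \<alpha> ** J_mat ** \<alpha> = J_mat}"

definition principal_congruence :: "'f::field_char_0 set \<Rightarrow> ('f^('n::finite + 'n)^('n + 'n)) set" where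
  "principal_congruence \<cc> = {\<alpha> \<in> Sp integer_ring. entries_in \<cc> (\<alpha> - mat 1)}"

definition congruence_subgroup :: "('f::field_char_0^('n::finite + 'n)^('n + 'n)) set \<Rightarrow> bool" where
  "congruence_subgroup \<Gamma> \<longleftrightarrow>
     \<Gamma> \<subseteq> Sp UNIV \<and> mat 1 \<in> \<Gamma> \<and>
     (\<forall>\<alpha>\<in>\<Gamma>. \<forall>\<beta>\<in>\<Gamma>. \<alpha> ** \<beta> \<in> \<Gamma>) \<and> (\<forall>\<alpha>\<in>\<Gamma>. matrix_inv \<alpha> \<in> \<Gamma>) \<and>
     (\<exists>\<cc>. nonzero_integral_ideal \<cc> \<and> principal_congruence \<cc> \<subseteq> \<Gamma> \<and>
          finite ((\<lambda>\<alpha>. (\<lambda>\<beta>. \<alpha> ** \<beta>) ` principal_congruence \<cc>) ` \<Gamma>))"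

section \<open>Action on the product of Siegel upper half spaces\<close>

definition siegel :: "(complex^'n^'n) set" where
  "siegel = {\<Omega>. transpose \<Omega> = \<Omega> \<and>
     (\<forall>x::real^'n. x \<noteq> 0 \<longrightarrow> 0 < x \<bullet> ((\<chi> i k. Im (\<Omega> $ i $ k)) *v x))}"

definition siegel_prod :: "(complex^'n^'n^'g) set" where
  "siegel_prod = {\<Omega>. \<forall>\<nu>. \<Omega> $ \<nu> \<in> siegel}"

text \<open>
  The blocks \<open>A, B, C, D\<close> of \<open>\<alpha>\<close> under the \<open>\<nu>\<close>-th embedding are obtained with
  \<open>(s, t) = (Inl, Inl), (Inl, Inr), (Inr, Inl), (Inr, Inr)\<close>.
\<close>

definition block :: "('g \<Rightarrow> 'f \<Rightarrow> real) \<Rightarrow> 'g \<Rightarrow> ('n \<Rightarrow> 'n + 'n) \<Rightarrow> ('n \<Rightarrow> 'n + 'n) \<Rightarrow>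
    'f^('n::finite + 'n)^('n + 'n) \<Rightarrow> complex^'n^'n" where
  "block \<phi> \<nu> s t \<alpha> = (\<chi> i k. complex_of_real (\<phi> \<nu> (\<alpha> $ s i $ t k)))"

definition denom :: "('g \<Rightarrow> 'f \<Rightarrow> real) \<Rightarrow> 'f^('n::finite + 'n)^('n + 'n) \<Rightarrow>
    complex^'n^'n^'g \<Rightarrow> 'g::finite \<Rightarrow> complex^'n^'n" where
  "denom \<phi> \<alpha> \<Omega> \<nu> = block \<phi> \<nu> Inr Inl \<alpha> ** \<Omega> $ \<nu> + block \<phi> \<nu> Inr Inr \<alpha>"

definition act :: "('g \<Rightarrow> 'f \<Rightarrow> real) \<Rightarrow> 'f^('n::finite + 'n)^('n + 'n) \<Rightarrow>
    complex^'n^'n^'g \<Rightarrow> complex^'n^'n^'g::finite" where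
  "act \<phi> \<alpha> \<Omega> = (\<chi> \<nu>. (block \<phi> \<nu> Inl Inl \<alpha> ** \<Omega> $ \<nu> + block \<phi> \<nu> Inl Inr \<alpha>)
                       ** matrix_inv (denom \<phi> \<alpha> \<Omega> \<nu>))"

definition jfac :: "('g \<Rightarrow> 'f \<Rightarrow> real) \<Rightarrow> 'f^('n::finite + 'n)^('n + 'n) \<Rightarrow>
    complex^'n^'n^'g::finite \<Rightarrow> complex" where
  "jfac \<phi> \<alpha> \<Omega> = (\<Prod>\<nu>\<in>UNIV. det (denom \<phi> \<alpha> \<Omega> \<nu>))"

section \<open>Automorphic forms\<close>

text \<open>
  Complex differentiability in several variables. It is applied to relatively open subsets \<open>S\<close> of
  the product of half spaces. As \<open>S\<close> consists of tuples of symmetric matrices, the derivative is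
  determined only on such tuples, and its values on other tuples are irrelevant.
\<close>

definition holomorphic_mv :: "(complex^'n^'n^'g \<Rightarrow> complex) \<Rightarrow> (complex^'n^'n^'g) set \<Rightarrow> bool" where
  "holomorphic_mv f S \<longleftrightarrow>
     (\<forall>\<Omega>\<in>S. \<exists>D. (f has_derivative D) (at \<Omega> within S) \<and>
        (\<forall>c X. D (\<chi> \<nu> i k. c * X $ \<nu> $ i $ k) = c * D X))"

definition elliptic_case :: "('f::field_char_0^('n::finite + 'n)^('n + 'n)) itself \<Rightarrow> bool" where
  "elliptic_case _ \<longleftrightarrow> (UNIV :: 'f set) = \<rat> \<and> CARD('n) = 1"

definition SL_Z :: "('f::field_char_0^('n::finite + 'n)^('n + 'n)) set" where
  "SL_Z = {\<alpha>. entries_in \<int> \<alpha> \<and> det \<alpha> = 1}"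

text \<open>The only entry of \<open>\<Omega>\<close> if \<open>g = n = 1\<close>; it is used only in that case.\<close>

definition tau :: "complex^'n^'n^'g \<Rightarrow> complex" where
  "tau \<Omega> = (THE t. \<forall>\<nu> i k. \<Omega> $ \<nu> $ i $ k = t)"

definition qpow :: "nat \<Rightarrow> nat \<Rightarrow> complex^'n^'n^'g \<Rightarrow> complex" where
  "qpow m k \<Omega> = exp (2 * of_real pi * \<i> * of_nat k * tau \<Omega> / of_nat m)"

definition automorphic_form :: "('g::finite \<Rightarrow> 'f::field_char_0 \<Rightarrow> real) \<Rightarrow>
    ('f^('n::finite + 'n)^('n + 'n)) set \<Rightarrow> int \<Rightarrow> (complex^'n^'n^'g \<Rightarrow> complex) \<Rightarrow> bool" where
  "automorphic_form \<phi> \<Gamma> K f \<longleftrightarrow>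
     holomorphic_mv f siegel_prod \<and>
     (\<forall>\<alpha>\<in>\<Gamma>. \<forall>\<Omega>\<in>siegel_prod. f (act \<phi> \<alpha> \<Omega>) = jfac \<phi> \<alpha> \<Omega> powi K * f \<Omega>) \<and>
     (elliptic_case TYPE('f^('n + 'n)^('n + 'n)) \<longrightarrow>
       (\<forall>\<alpha>\<in>(SL_Z :: ('f^('n + 'n)^('n + 'n)) set). \<exists>m>0. \<exists>c :: nat \<Rightarrow> complex. \<forall>\<Omega>\<in>siegel_prod.
          (\<lambda>k. c k * qpow m k \<Omega>) sums (jfac \<phi> \<alpha> \<Omega> powi (- K) * f (act \<phi> \<alpha> \<Omega>))))"

section \<open>The operator \<open>P\<close>\<close>

definition pole_set :: "nat \<Rightarrow> (nat \<Rightarrow> complex^'n^'n^'g \<Rightarrow> complex \<Rightarrow> complex) \<Rightarrow>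
    complex^'n^'n^'g \<Rightarrow> complex set" where
  "pole_set N a \<Omega> = (\<Union>l\<in>{2..N}. {z. is_pole (a l \<Omega>) z})"

text \<open>
  The poles in \<open>z\<close> move with \<open>\<Omega>\<close>, so that in general (for instance for the Weierstrass function)
  there are no \<open>z\<close> off a small set for which \<open>a\<^sub>l(\<Omega>,z)\<close> is holomorphic in \<open>\<Omega>\<close> on the whole
  domain. ``Holomorphic for generic \<open>z\<close>'' is therefore understood locally in \<open>\<Omega>\<close>: at each
  \<open>\<Omega>\<^sub>0\<close>, for all \<open>z\<close> off a closed discrete set depending on \<open>\<Omega>\<^sub>0\<close>. The Fourier expansion, being one
  at the cusp, is likewise only required for \<open>Im \<Omega>\<close> large in terms of \<open>z\<close>.
\<close>

definition operator_P :: "('g::finite \<Rightarrow> 'f::field_char_0 \<Rightarrow> real) \<Rightarrow>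
    ('f^('n::finite + 'n)^('n + 'n)) set \<Rightarrow> nat \<Rightarrow>
    (nat \<Rightarrow> complex^'n^'n^'g \<Rightarrow> complex \<Rightarrow> complex) \<Rightarrow> bool" where
  "operator_P \<phi> \<Gamma> N a \<longleftrightarrow>
     (\<forall>l\<in>{2..N}. \<forall>\<Omega>\<^sub>0\<in>siegel_prod. \<exists>E. E sparse_in UNIV \<and>
        (\<forall>z. z \<notin> E \<longrightarrow> (\<exists>U. open U \<and> \<Omega>\<^sub>0 \<in> U \<and> (\<forall>\<Omega>\<in>U \<inter> siegel_prod. z \<notin> pole_set N a \<Omega>) \<and>
           holomorphic_mv (\<lambda>\<Omega>. a l \<Omega> z) (U \<inter> siegel_prod)))) \<and>
     (\<forall>l\<in>{2..N}. \<forall>\<Omega>\<in>siegel_prod.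
        a l \<Omega> meromorphic_on UNIV \<and> a l \<Omega> analytic_on {z. \<not> is_pole (a l \<Omega>) z}) \<and>
     (\<forall>l\<in>{2..N}. \<forall>\<alpha>\<in>\<Gamma>. \<forall>\<Omega>\<in>siegel_prod. \<forall>z. z \<notin> pole_set N a \<Omega> \<longrightarrow>
        a l (act \<phi> \<alpha> \<Omega>) (z / jfac \<phi> \<alpha> \<Omega>) = jfac \<phi> \<alpha> \<Omega> ^ l * a l \<Omega> z) \<and>
     (elliptic_case TYPE('f^('n + 'n)^('n + 'n)) \<longrightarrow>
       (\<forall>l\<in>{2..N}. \<forall>\<alpha>\<in>(SL_Z :: ('f^('n + 'n)^('n + 'n)) set). \<exists>m>0. \<exists>c :: nat \<Rightarrow> complex \<Rightarrow> complex.
          (\<forall>k. \<forall>\<Omega>\<in>siegel_prod.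
             c k holomorphic_on (*) (jfac \<phi> \<alpha> \<Omega>) ` (- pole_set N a (act \<phi> \<alpha> \<Omega>))) \<and>
          (\<forall>z. \<exists>r. \<forall>\<Omega>\<in>siegel_prod. Im (tau \<Omega>) > r \<longrightarrow>
             z \<in> (*) (jfac \<phi> \<alpha> \<Omega>) ` (- pole_set N a (act \<phi> \<alpha> \<Omega>)) \<longrightarrow>
             (\<lambda>k. c k z * qpow m k \<Omega>) sums
               (jfac \<phi> \<alpha> \<Omega> powi (- int l) * a l (act \<phi> \<alpha> \<Omega>) (z / jfac \<phi> \<alpha> \<Omega>)))))"

text \<open>
  \<open>diff_op M c\<close> is the operator with coefficient \<open>c j\<close> at the derivative of order \<open>M - j\<close>.
\<close>

definition diff_op :: "nat \<Rightarrow> (nat \<Rightarrow> complex \<Rightarrow> complex) \<Rightarrow> (complex \<Rightarrow> complex) \<Rightarrow> complex \<Rightarrow> complex" where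
  "diff_op M c u z = (\<Sum>j\<le>M. c j z * (deriv ^^ (M - j)) u z)"

definition P_coeff :: "(nat \<Rightarrow> complex^'n^'n^'g \<Rightarrow> complex \<Rightarrow> complex) \<Rightarrow>
    complex^'n^'n^'g \<Rightarrow> nat \<Rightarrow> complex \<Rightarrow> complex" where
  "P_coeff a \<Omega> l z = (if l = 0 then 1 else if l = 1 then 0 else a l \<Omega> z)"

section \<open>Functions on the universal covering\<close>

text \<open>
  A point \<open>(z,[\<gamma>])\<close> of the universal covering of \<open>S\<close> with base point \<open>w\<close> is represented by the
  path \<open>\<gamma>\<close> from \<open>w\<close> to \<open>z\<close>, and functions on the covering are functions of \<open>\<gamma>\<close> that are invariant
  under homotopy with fixed end points. All base points are treated at once: the base point is
  \<open>pathstart \<gamma>\<close>, and it cannot be fixed since \<open>\<gamma>\<close> is replaced by \<open>\<gamma> / j\<^sub>\<alpha>(\<Omega>)\<close> below.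
  \<open>germ f \<gamma>\<close> is \<open>f\<close> near the point given by \<open>\<gamma>\<close>, in terms of the coordinate \<open>z\<close>.
\<close>

definition germ :: "((real \<Rightarrow> complex) \<Rightarrow> 'a) \<Rightarrow> (real \<Rightarrow> complex) \<Rightarrow> complex \<Rightarrow> 'a" where
  "germ f \<gamma> = (\<lambda>\<zeta>. f (\<gamma> +++ linepath (pathfinish \<gamma>) \<zeta>))"

definition multivalued_analytic :: "complex set \<Rightarrow> ((real \<Rightarrow> complex) \<Rightarrow> complex) \<Rightarrow> bool" where
  "multivalued_analytic S f \<longleftrightarrow>
     (\<forall>\<gamma> \<delta>. homotopic_paths S \<gamma> \<delta> \<longrightarrow> f \<gamma> = f \<delta>) \<and>
     (\<forall>\<gamma>. path \<gamma> \<and> path_image \<gamma> \<subseteq> S \<longrightarrow> germ f \<gamma> analytic_on {pathfinish \<gamma>})"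

section \<open>The Baker--Akhiezer function\<close>

text \<open>
  A formal expression \<open>(\<Sum>s. f\<^sub>s(z) \<lambda>\<^sup>-\<^sup>s) exp(\<lambda>(z - w))\<close> is represented by its first factor, as a
  formal Laurent series in the variable \<open>\<lambda>\<^sup>-\<^sup>1\<close>; thus \<open>fls_X_inv\<close> is \<open>\<lambda>\<close>. The derivative in \<open>z\<close>
  then becomes the coefficientwise derivative plus multiplication by \<open>\<lambda>\<close>.
\<close>

definition formal_deriv :: "(complex \<Rightarrow> complex fls) \<Rightarrow> complex \<Rightarrow> complex fls" where
  "formal_deriv f z = Abs_fls (\<lambda>s. deriv (\<lambda>\<zeta>. fls_nth (f \<zeta>) s) z) + fls_X_inv * f z"

definition formal_op :: "nat \<Rightarrow> (nat \<Rightarrow> complex \<Rightarrow> complex) \<Rightarrow>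
    (complex \<Rightarrow> complex fls) \<Rightarrow> complex \<Rightarrow> complex fls" where
  "formal_op M c f z = (\<Sum>j\<le>M. fls_const (c j z) * (formal_deriv ^^ (M - j)) f z)"

text \<open>\<open>fps_nth (\<xi> \<Omega> \<gamma>) s\<close> is \<open>\<xi>\<^sub>s(\<Omega>,(z,[\<gamma>]),w)\<close> with \<open>w = pathstart \<gamma>\<close> and \<open>z = pathfinish \<gamma>\<close>.\<close>

definition BA_series :: "(complex^'n^'n^'g \<Rightarrow> (real \<Rightarrow> complex) \<Rightarrow> complex fps) \<Rightarrow>
    complex^'n^'n^'g \<Rightarrow> (real \<Rightarrow> complex) \<Rightarrow> complex \<Rightarrow> complex fls" where
  "BA_series \<xi> \<Omega> \<gamma> \<zeta> = fps_to_fls (germ (\<xi> \<Omega>) \<gamma> \<zeta>)"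

definition baker_akhiezer :: "nat \<Rightarrow> (nat \<Rightarrow> complex^'n^'n^'g \<Rightarrow> complex \<Rightarrow> complex) \<Rightarrow>
    (complex^'n^'n^'g \<Rightarrow> (real \<Rightarrow> complex) \<Rightarrow> complex fps) \<Rightarrow> bool" where
  "baker_akhiezer N a \<xi> \<longleftrightarrow>
     (\<forall>\<Omega>\<in>siegel_prod.
        (\<forall>s. multivalued_analytic (- pole_set N a \<Omega>) (\<lambda>\<gamma>. fps_nth (\<xi> \<Omega> \<gamma>) s)) \<and>
        (\<forall>\<gamma>. path \<gamma> \<and> path_image \<gamma> \<subseteq> - pole_set N a \<Omega> \<longrightarrow>
           fps_nth (\<xi> \<Omega> \<gamma>) 0 = 1 \<and>
           formal_op N (P_coeff a \<Omega>) (BA_series \<xi> \<Omega> \<gamma>) (pathfinish \<gamma>) =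
             fls_X_inv ^ N * BA_series \<xi> \<Omega> \<gamma> (pathfinish \<gamma>)) \<and>
        (\<forall>w. w \<notin> pole_set N a \<Omega> \<longrightarrow> (\<forall>s\<ge>1. fps_nth (\<xi> \<Omega> (\<lambda>_. w)) s = 0)))"

section \<open>The space of commuting operators of weight \<open>K\<close>\<close>

text \<open>
  \<open>b j \<Omega> \<gamma>\<close> is \<open>b\<^sub>j(\<Omega>,(z,[\<gamma>]))\<close>. The weight condition is the equality of coefficients in
  \<open>Q\<^bsub>\<alpha>(\<Omega>),(z/j,[\<gamma>/j])\<^esub> = j\<^sup>K Q\<^bsub>\<Omega>,(z,[\<gamma>])\<^esub>\<close>, where differentiation with respect to \<open>z/j\<close> is
  \<open>j\<close> times differentiation with respect to \<open>z\<close>. Genericity and the range of the Fourier expansions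
  are understood as for \<open>P\<close>; \<open>(z,[\<gamma>])\<close> is generic if \<open>\<gamma>\<close> avoids a closed discrete set depending on \<open>\<Omega>\<^sub>0\<close>;
  such a \<open>\<gamma>\<close> has to avoid the poles for all \<open>\<Omega>\<close> near \<open>\<Omega>\<^sub>0\<close>, so that it defines a point of
  each of these coverings.
\<close>

definition D_space :: "('g::finite \<Rightarrow> 'f::field_char_0 \<Rightarrow> real) \<Rightarrow>
    ('f^('n::finite + 'n)^('n + 'n)) set \<Rightarrow> nat \<Rightarrow>
    (nat \<Rightarrow> complex^'n^'n^'g \<Rightarrow> complex \<Rightarrow> complex) \<Rightarrow> int \<Rightarrow> nat \<Rightarrow>
    (nat \<Rightarrow> complex^'n^'n^'g \<Rightarrow> (real \<Rightarrow> complex) \<Rightarrow> complex) \<Rightarrow> bool" where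
  "D_space \<phi> \<Gamma> N a K M b \<longleftrightarrow>
     (\<forall>j\<le>M. \<forall>\<Omega>\<in>siegel_prod. multivalued_analytic (- pole_set N a \<Omega>) (b j \<Omega>)) \<and>
     (\<forall>\<Omega>\<in>siegel_prod. \<forall>\<gamma>. path \<gamma> \<and> path_image \<gamma> \<subseteq> - pole_set N a \<Omega> \<longrightarrow>
        (\<forall>u. u analytic_on {pathfinish \<gamma>} \<longrightarrow>
           diff_op M (\<lambda>j. germ (b j \<Omega>) \<gamma>) (diff_op N (P_coeff a \<Omega>) u) (pathfinish \<gamma>) =
           diff_op N (P_coeff a \<Omega>) (diff_op M (\<lambda>j. germ (b j \<Omega>) \<gamma>) u) (pathfinish \<gamma>))) \<and>
     (\<forall>j\<le>M. \<forall>\<alpha>\<in>\<Gamma>. \<forall>\<Omega>\<in>siegel_prod. \<forall>\<gamma>. path \<gamma> \<and> path_image \<gamma> \<subseteq> - pole_set N a \<Omega> \<longrightarrow>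
        b j (act \<phi> \<alpha> \<Omega>) (\<lambda>t. \<gamma> t / jfac \<phi> \<alpha> \<Omega>) * jfac \<phi> \<alpha> \<Omega> ^ (M - j) =
        jfac \<phi> \<alpha> \<Omega> powi K * b j \<Omega> \<gamma>) \<and>
     (\<forall>j\<le>M. \<forall>\<Omega>\<^sub>0\<in>siegel_prod. \<exists>E. E sparse_in UNIV \<and>
        (\<forall>\<gamma>. path \<gamma> \<and> path_image \<gamma> \<inter> E = {} \<longrightarrow>
           (\<exists>U. open U \<and> \<Omega>\<^sub>0 \<in> U \<and> (\<forall>\<Omega>\<in>U \<inter> siegel_prod. path_image \<gamma> \<subseteq> - pole_set N a \<Omega>) \<and>
              holomorphic_mv (\<lambda>\<Omega>. b j \<Omega> \<gamma>) (U \<inter> siegel_prod)))) \<and>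
     (elliptic_case TYPE('f^('n + 'n)^('n + 'n)) \<longrightarrow>
       (\<forall>j\<le>M. \<forall>\<alpha>\<in>(SL_Z :: ('f^('n + 'n)^('n + 'n)) set).
          \<exists>m>0. \<exists>c :: nat \<Rightarrow> (real \<Rightarrow> complex) \<Rightarrow> complex.
          (\<forall>k. \<forall>\<Omega>\<in>siegel_prod.
             multivalued_analytic ((*) (jfac \<phi> \<alpha> \<Omega>) ` (- pole_set N a (act \<phi> \<alpha> \<Omega>))) (c k)) \<and>
          (\<forall>\<gamma>. path \<gamma> \<longrightarrow> (\<exists>r. \<forall>\<Omega>\<in>siegel_prod. Im (tau \<Omega>) > r \<longrightarrow>
             path_image \<gamma> \<subseteq> (*) (jfac \<phi> \<alpha> \<Omega>) ` (- pole_set N a (act \<phi> \<alpha> \<Omega>)) \<longrightarrow>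
             (\<lambda>k. c k \<gamma> * qpow m k \<Omega>) sums
               (jfac \<phi> \<alpha> \<Omega> powi (- K - int j + int M) *
                b j (act \<phi> \<alpha> \<Omega>) (\<lambda>t. \<gamma> t / jfac \<phi> \<alpha> \<Omega>))))))"

text \<open>\<open>Q\<Psi> = A\<Psi>\<close>, with \<open>A\<close> independent of \<open>z\<close>, \<open>[\<gamma>]\<close> and \<open>w\<close>.\<close>

definition eigen_series :: "nat \<Rightarrow> (nat \<Rightarrow> complex^'n^'n^'g \<Rightarrow> complex \<Rightarrow> complex) \<Rightarrow>
    (complex^'n^'n^'g \<Rightarrow> (real \<Rightarrow> complex) \<Rightarrow> complex fps) \<Rightarrow> nat \<Rightarrow>
    (nat \<Rightarrow> complex^'n^'n^'g \<Rightarrow> (real \<Rightarrow> complex) \<Rightarrow> complex) \<Rightarrow>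
    (complex^'n^'n^'g \<Rightarrow> complex fls) \<Rightarrow> bool" where
  "eigen_series N a \<xi> M b A \<longleftrightarrow>
     (\<forall>\<Omega>\<in>siegel_prod.
        (\<forall>s < - int M. fls_nth (A \<Omega>) s = 0) \<and>
        (\<forall>\<gamma>. path \<gamma> \<and> path_image \<gamma> \<subseteq> - pole_set N a \<Omega> \<longrightarrow>
           formal_op M (\<lambda>j. germ (b j \<Omega>) \<gamma>) (BA_series \<xi> \<Omega> \<gamma>) (pathfinish \<gamma>) =
             A \<Omega> * BA_series \<xi> \<Omega> \<gamma> (pathfinish \<gamma>)))"

section \<open>The spectral polynomial\<close>

text \<open>
  With \<open>X = \<lambda>\<^sup>N\<close>, the solutions of \<open>\<lambda>\<^sub>j\<^sup>N = X\<close> are \<open>\<epsilon> \<lambda>\<close> with \<open>\<epsilon>\<close> an \<open>N\<close>-th root of unity.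
  \<open>fls_rotate \<epsilon> A\<close> is \<open>A(\<epsilon> \<lambda>)\<close>, and \<open>spectral_product\<close> is a polynomial in \<open>Y\<close> whose coefficients
  are Laurent series in \<open>\<lambda>\<^sup>-\<^sup>1\<close>. \<open>eval_X\<close> embeds the polynomials in \<open>X\<close> and \<open>Y\<close> (as polynomials in
  \<open>Y\<close> over the polynomials in \<open>X\<close>) by substituting \<open>\<lambda>\<^sup>N\<close> for \<open>X\<close>.
\<close>

definition fls_rotate :: "complex \<Rightarrow> complex fls \<Rightarrow> complex fls" where
  "fls_rotate \<epsilon> A = Abs_fls (\<lambda>s. fls_nth A s * \<epsilon> powi (- s))"

definition spectral_product :: "nat \<Rightarrow> complex fls \<Rightarrow> complex fls poly" where
  "spectral_product N A = (\<Prod>\<epsilon>\<in>{\<epsilon>::complex. \<epsilon> ^ N = 1}. [:- fls_rotate \<epsilon> A, 1:])"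

definition eval_X :: "nat \<Rightarrow> complex poly poly \<Rightarrow> complex fls poly" where
  "eval_X N F = map_poly (\<lambda>p. poly (map_poly fls_const p) (fls_X_inv ^ N)) F"

end

theory Submission
  imports Defs "Jordan_Normal_Form.Char_Poly"
begin

text \<open>
  At a point \<open>z\<close> without poles, reduce \<open>Q\<close> modulo \<open>P - X\<close> to a matrix over \<open>\<complex>[X]\<close> which describes its action
  on the jets \<open>(u, u', \<dots>, u\<^bsup>(N-1)\<^esup>)\<close> of solutions of \<open>P u = X u\<close>. Its entries are polynomials in finitely
  many Taylor coefficients of the \<open>a\<^sub>l\<close> and \<open>b\<^sub>j\<close> at \<open>z\<close>. The jets of \<open>\<Psi>\<close> at the \<open>N\<close> conjugates of \<open>\<lambda>\<close> are linearly
  independent eigenvectors with eigenvalues \<open>A(\<lambda>\<^sub>j)\<close>, so the characteristic polynomial of the matrix is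
  \<open>F\<^sub>\<Omega>(X,Y)\<close>; in particular it does not depend on \<open>z\<close> or on the path along which the \<open>b\<^sub>j\<close> are continued.

  Replacing \<open>\<Omega>\<close> by \<open>\<alpha>(\<Omega>)\<close> and \<open>z\<close> by \<open>z/j\<^sub>\<alpha>(\<Omega>)\<close> multiplies every Taylor coefficient by a power of \<open>j\<^sub>\<alpha>(\<Omega>)\<close>, which
  rescales the rows and columns of the matrix, the variable \<open>X\<close> and the variable \<open>Y\<close>: this gives the weight.

  Holomorphy and the expansions at the cusps are assumed separately for each \<open>z\<close>. By the Baire category
  theorem they hold uniformly for \<open>z\<close> in some disc (locally in \<open>\<Omega>\<close>, or for \<open>\<Omega>\<close> near the cusp), so by Cauchy's
  formula they pass to the Taylor coefficients at a point of that disc and hence to \<open>f\<^sub>j\<^sub>,\<^sub>k\<close>. At a cusp this yields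
  a bounded periodic function near the cusp, which has a \<open>q\<close>-expansion on the whole upper half plane.
\<close>

text \<open>The defining identity of \<open>F\<^sub>\<Omega>\<close> is formal in \<lambda>, and
  nothing is assumed about how the series \<open>\<xi>\<close> and \<open>A\<close> vary with
  \<Omega>. The matrix is computed from \<open>P\<close> and \<open>Q\<close> alone, which is what
  gives access to this dependence. It lives over polynomials in \<open>X\<close>, so polynomiality
  comes for free, and injectivity of the substitution of \<open>\<lambda>^N\<close> for
  \<open>X\<close> makes the result unique.

  The obstacle is that the matrix contains derivatives in \<open>z\<close>, while exceptional sets,
  neighbourhoods and radii of convergence depend on \<open>z\<close> or on the path, and no joint
  regularity in \<Omega> and \<open>z\<close> is given. Taylor coefficients are therefore obtained
  as uniform limits of values at points of a dense set. Regularity is treated as an abstract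
  predicate stable under sums, products and uniform limits, so that one argument serves both
  interior points and cusps. Absence of poles for all parameters at once has to be secured before
  the \<open>b\<^sub>j\<close> can be treated, because a path defines a point of the covering only
  if it avoids the poles.\<close>

no_notation fps_nth (infixl "$" 75)
no_notation vec_index (infixl "$" 100)
hide_fact (open) Matrix.vec_eq_iff
hide_const (open) Matrix.mat Determinant.det

section \<open>Laurent series in the inverse of the spectral parameter\<close>

text \<open>The convolution may run between any lower bounds of the supports. A family of series has
  a common lower bound but in general no common subdegree, and expanding a product in a parameter
  requires a range of summation that does not vary.\<close>

lemma fls_times_nth_bounds:
  fixes f g :: "'a::{comm_monoid_add,mult_zero} fls"
  assumes f: "\<And>s. s < a \<Longrightarrow> fls_nth f s = 0" and g: "\<And>s. s < b \<Longrightarrow> fls_nth g s = 0"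
  shows "fls_nth (f * g) n = (\<Sum>i=a..n-b. fls_nth f i * fls_nth g (n - i))"
proof -
  have "fls_nth (f * g) n = (\<Sum>i=fls_subdegree f..n - fls_subdegree g. fls_nth f i * fls_nth g (n - i))"
    by (rule fls_times_nth(2))
  also have "\<dots> = (\<Sum>i\<in>{fls_subdegree f..n - fls_subdegree g} \<inter> {a..n-b}. fls_nth f i * fls_nth g (n - i))"
    by (rule sum.mono_neutral_right) (use f g in \<open>auto simp: not_le\<close>)
  also have "\<dots> = (\<Sum>i=a..n-b. fls_nth f i * fls_nth g (n - i))"
    by (rule sum.mono_neutral_left) (use f g in \<open>auto simp: not_le\<close>)
  finally show ?thesis .
qed

lemma fls_times_nth_lowest:
  fixes f g :: "'a::{comm_monoid_add,mult_zero} fls"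
  assumes "\<And>s. s < a \<Longrightarrow> fls_nth f s = 0" and "\<And>s. s < b \<Longrightarrow> fls_nth g s = 0"
  shows "fls_nth (f * g) (a + b) = fls_nth f a * fls_nth g b"
  by (subst fls_times_nth_bounds[OF assms]) auto

lemma fls_rotate_nth [simp]: "fls_nth (fls_rotate \<epsilon> A) s = fls_nth A s * \<epsilon> powi (- s)"
  unfolding fls_rotate_def
  by (rule nth_Abs_fls_lower_bound[where N = "fls_subdegree A"]) auto

lemma fls_rotate_add: "fls_rotate \<epsilon> (A + B) = fls_rotate \<epsilon> A + fls_rotate \<epsilon> B"
  by (rule fls_eqI) (simp add: algebra_simps)

lemma fls_rotate_zero: "fls_rotate \<epsilon> 0 = 0"
  by (rule fls_eqI) simp

lemma fls_rotate_mult: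
  assumes "\<epsilon> \<noteq> 0"
  shows "fls_rotate \<epsilon> (A * B) = fls_rotate \<epsilon> A * fls_rotate \<epsilon> B"
proof (rule fls_eqI)
  fix n
  have "fls_nth (fls_rotate \<epsilon> A * fls_rotate \<epsilon> B) n =
      (\<Sum>i=fls_subdegree A..n - fls_subdegree B. fls_nth A i * \<epsilon> powi (- i) * (fls_nth B (n - i) * \<epsilon> powi (- (n - i))))"
    by (subst fls_times_nth_bounds[where a = "fls_subdegree A" and b = "fls_subdegree B"]) auto
  also have "\<dots> = (\<Sum>i=fls_subdegree A..n - fls_subdegree B. fls_nth A i * fls_nth B (n - i) * \<epsilon> powi (- n))"
  proof (rule sum.cong[OF refl])
    fix i
    have "\<epsilon> powi (- i) * \<epsilon> powi (- (n - i)) = \<epsilon> powi (- n)"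
      using assms by (subst power_int_add[symmetric]) auto
    then show "fls_nth A i * \<epsilon> powi (- i) * (fls_nth B (n - i) * \<epsilon> powi (- (n - i))) =
        fls_nth A i * fls_nth B (n - i) * \<epsilon> powi (- n)"
      by (metis (no_types, opaque_lifting) mult.assoc mult.left_commute)
  qed
  also have "\<dots> = fls_nth (fls_rotate \<epsilon> (A * B)) n"
    by (simp add: fls_times_nth(2) sum_distrib_right)
  finally show "fls_nth (fls_rotate \<epsilon> (A * B)) n = fls_nth (fls_rotate \<epsilon> A * fls_rotate \<epsilon> B) n" ..
qed

lemma fls_rotate_sum: "fls_rotate \<epsilon> (\<Sum>i\<in>I. f i) = (\<Sum>i\<in>I. fls_rotate \<epsilon> (f i))"
  by (induction I rule: infinite_finite_induct) (auto simp: fls_rotate_zero fls_rotate_add)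

interpretation fls_const: comm_ring_hom "fls_const :: 'a::comm_ring_1 \<Rightarrow> 'a fls"
  by standard (auto simp: fls_plus_const)

interpretation fls_const_poly: map_poly_comm_ring_hom "fls_const :: 'a::comm_ring_1 \<Rightarrow> 'a fls" ..

text \<open>One coefficient of \<open>eval_X\<close>. It is separated out so that it can be used as
  a ring homomorphism and moved through characteristic polynomials.\<close>

definition lam_subst :: "nat \<Rightarrow> complex poly \<Rightarrow> complex fls" where
  "lam_subst N p = poly (map_poly fls_const p) (fls_X_inv ^ N)"

interpretation lam_subst: comm_ring_hom "lam_subst N"
  by standard (auto simp: lam_subst_def hom_distribs)

interpretation lam_subst_poly: map_poly_comm_ring_hom "lam_subst N" ..

lemma eval_X_lam_subst: "eval_X N F = map_poly (lam_subst N) F"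
  by (simp add: eval_X_def lam_subst_def[abs_def])

lemma lam_subst_X [simp]: "lam_subst N [:0, 1:] = fls_X_inv ^ N"
  by (simp add: lam_subst_def map_poly_pCons)

lemma lam_subst_altdef: "lam_subst N p = (\<Sum>j\<le>degree p. fls_const (coeff p j) * fls_X_inv ^ (N * j))"
proof -
  have "degree (map_poly fls_const p) = degree p"
    by (rule degree_map_poly) auto
  then show ?thesis
    by (simp add: lam_subst_def poly_altdef coeff_map_poly power_mult)
qed

lemma lam_subst_const [simp]: "lam_subst N [:c:] = fls_const c"
  by (simp add: lam_subst_altdef)

text \<open>For \<open>N \<ge> 1\<close> different powers of \<open>X\<close> go to different powers
  of \<lambda>, so coefficients can be read off after the substitution.\<close>

lemma lam_subst_nth:
  assumes "N \<ge> 1"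
  shows "fls_nth (lam_subst N p) (- int (N * j)) = coeff p j"
proof -
  have eq: "(- int (N * j) = - int (N * i)) = (i = j)" for i
    using assms by auto
  have "fls_nth (lam_subst N p) (- int (N * j)) =
      (\<Sum>i\<le>degree p. coeff p i * (if i = j then 1 else 0))"
    unfolding lam_subst_altdef fls_nth_sum
    using assms by (intro sum.cong refl) (auto simp: fls_X_inv_power_nth)
  also have "\<dots> = coeff p j"
    using assms by (auto simp: coeff_eq_0 not_le sum.delta' if_distrib[of "\<lambda>x. _ * x"] cong: if_cong)
  finally show ?thesis .
qed

lemma lam_subst_inj:
  assumes "N \<ge> 1" "lam_subst N p = lam_subst N q"
  shows "p = q"
  using lam_subst_nth[OF assms(1)] assms(2) by (metis poly_eqI)

text \<open>This is the source of all independence statements: polynomials obtained at different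
  points and along different paths agree as soon as they have the same image.\<close>

lemma eval_X_inj:
  assumes "N \<ge> 1" "eval_X N F = eval_X N G"
  shows "F = G"
proof (rule poly_eqI)
  fix k
  have "lam_subst N (coeff F k) = lam_subst N (coeff G k)"
    using assms(2) unfolding eval_X_lam_subst
    by (metis coeff_map_poly lam_subst.hom_zero)
  then show "coeff F k = coeff G k"
    by (rule lam_subst_inj[OF assms(1)])
qed

text \<open>Only powers of \<open>\<lambda>^N\<close> occur, and rotation by an \<open>N\<close>-th
  root of unity fixes them. Hence an eigenvector equation with coefficients in \<open>X\<close>
  stays valid for all conjugates of the eigenvector.\<close>

lemma fls_rotate_lam_subst:
  assumes "\<epsilon> ^ N = 1"
  shows "fls_rotate \<epsilon> (lam_subst N p) = lam_subst N p"
proof (rule fls_eqI)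
  fix s
  show "fls_nth (fls_rotate \<epsilon> (lam_subst N p)) s = fls_nth (lam_subst N p) s"
  proof (cases "\<exists>j. s = - int (N * j)")
    case True
    then obtain j where "s = - int (N * j)" by blast
    then have "\<epsilon> powi (- s) = (\<epsilon> ^ N) ^ j"
      by (simp add: power_int_def nat_mult_distrib power_mult flip: of_nat_mult)
    with assms show ?thesis by simp
  next
    case False
    then have "fls_nth (lam_subst N p) s = 0"
      unfolding lam_subst_altdef fls_nth_sum by (intro sum.neutral) (auto simp: fls_X_inv_power_nth simp del: of_nat_mult)
    then show ?thesis by simp
  qed
qed

section \<open>Characteristic polynomials from conjugate eigenvectors\<close>

lemma card_eq_poly_degree_less_imp_0:
  fixes p :: "complex poly"
  assumes "\<And>x. x \<in> R \<Longrightarrow> poly p x = 0" "card R = N" "N \<ge> 1" "degree p < N"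
  shows "p = 0"
proof (rule ccontr)
  assume p: "p \<noteq> 0"
  have "R \<subseteq> {x. poly p x = 0}" using assms by blast
  then have "N \<le> card {x. poly p x = 0}"
    using card_mono[OF poly_roots_finite[OF p]] assms by blast
  also have "\<dots> \<le> degree p" by (rule card_poly_roots_bound[OF p])
  finally show False using assms by simp
qed

text \<open>
  If the columns were dependent, then the lowest terms of the relation would be the coefficients of a
  nonzero polynomial of degree less than \<open>N\<close> which vanishes at all \<open>N\<close>-th roots of unity.
\<close>

lemma conjugates_det_nonzero:
  fixes v :: "nat \<Rightarrow> complex fls" and e :: "nat \<Rightarrow> complex"
  assumes N: "N \<ge> 1" and e: "bij_betw e {..<N} {\<epsilon>. \<epsilon> ^ N = 1}"
    and v0: "\<And>i s. i < N \<Longrightarrow> s < - int i \<Longrightarrow> fls_nth (v i) s = 0"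
    and v1: "\<And>i. i < N \<Longrightarrow> fls_nth (v i) (- int i) = 1"
  shows "Determinant.det (Matrix.mat N N (\<lambda>(k,i). fls_rotate (e k) (v i))) \<noteq> 0" (is "Determinant.det ?V \<noteq> 0")
proof
  assume "Determinant.det ?V = 0"
  moreover have V: "?V \<in> carrier_mat N N" by simp
  ultimately obtain c where c: "c \<in> carrier_vec N" "c \<noteq> 0\<^sub>v N" "?V *\<^sub>v c = 0\<^sub>v N"
    using det_0_iff_vec_prod_zero by blast
  have sum0: "(\<Sum>i<N. fls_rotate (e k) (v i) * vec_index c i) = 0" if "k < N" for k
  proof -
    have "vec_index (?V *\<^sub>v c) k = 0" using c that by simp
    then show ?thesis using that c(1)
      by (simp add: scalar_prod_def lessThan_atLeast0)
  qed
  define I where "I = {i. i < N \<and> vec_index c i \<noteq> 0}"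
  have "I \<noteq> {}"
  proof
    assume "I = {}"
    then have "c = 0\<^sub>v N" using c(1) by (intro eq_vecI) (auto simp: I_def)
    with c show False by simp
  qed
  moreover have "finite I" by (simp add: I_def)
  ultimately have "finite ((\<lambda>i. fls_subdegree (vec_index c i) - int i) ` I)" "(\<lambda>i. fls_subdegree (vec_index c i) - int i) ` I \<noteq> {}"
    by auto
  note mn = Min_in[OF this] Min_le[OF this(1)]
  \<comment> \<open>Since \<open>v i\<close> starts with \<open>\<lambda>^i\<close>, that is, at
    exponent \<open>- i\<close>, the \<open>i\<close>-th term of the relation starts at the
    subdegree of the \<open>i\<close>-th entry of \<open>c\<close> minus \<open>i\<close>. The
    lowest of these exponents is the place where the relation is evaluated.\<close>
  define \<mu> where "\<mu> = Min ((\<lambda>i. fls_subdegree (vec_index c i) - int i) ` I)"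
  obtain i0 where i0: "i0 \<in> I" "\<mu> = fls_subdegree (vec_index c i0) - int i0"
    using mn(1) unfolding \<mu>_def by blast
  have le: "\<mu> \<le> fls_subdegree (vec_index c i) - int i" if "i \<in> I" for i
    unfolding \<mu>_def using mn(2) that by blast
  have low: "fls_nth (vec_index c i) s = 0" if "i < N" "s < \<mu> + int i" for i s
  proof (cases "i \<in> I")
    case True
    then show ?thesis using le[OF True] that by simp
  qed (use that in \<open>auto simp: I_def\<close>)
  define p where "p = (\<Sum>i<N. monom (fls_nth (vec_index c i) (\<mu> + int i)) i)"
  have "poly p x = 0" if "x \<in> {\<epsilon>. \<epsilon> ^ N = 1}" for x
  proof -
    from that e obtain k where k: "k < N" "x = e k"
      unfolding bij_betw_def by blast
    have x0: "x \<noteq> 0" using that N by (auto simp: power_0_left)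
    have "0 = fls_nth (\<Sum>i<N. fls_rotate (e k) (v i) * vec_index c i) \<mu>"
      using sum0[OF k(1)] by simp
    also have "\<dots> = (\<Sum>i<N. fls_nth (fls_rotate (e k) (v i) * vec_index c i) ((- int i) + (\<mu> + int i)))"
      by (simp add: fls_nth_sum)
    also have "\<dots> = (\<Sum>i<N. x ^ i * fls_nth (vec_index c i) (\<mu> + int i))"
    proof (rule sum.cong[OF refl])
      fix i assume "i \<in> {..<N}"
      then have i: "i < N" by simp
      have "fls_nth (fls_rotate (e k) (v i) * vec_index c i) ((- int i) + (\<mu> + int i)) =
          fls_nth (fls_rotate (e k) (v i)) (- int i) * fls_nth (vec_index c i) (\<mu> + int i)"
        by (rule fls_times_nth_lowest) (use v0 low i in auto)
      also have "fls_nth (fls_rotate (e k) (v i)) (- int i) = x ^ i"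
        using v1[OF i] k by simp
      finally show "fls_nth (fls_rotate (e k) (v i) * vec_index c i) ((- int i) + (\<mu> + int i)) =
          x ^ i * fls_nth (vec_index c i) (\<mu> + int i)" .
    qed
    also have "\<dots> = poly p x"
      by (simp add: p_def poly_sum poly_monom mult.commute)
    finally show ?thesis by simp
  qed
  moreover have "card {\<epsilon>::complex. \<epsilon> ^ N = 1} = N"
    using N by (intro card_roots_unity_eq) simp
  moreover have "degree p < N"
  proof -
    have "degree p \<le> N - 1" unfolding p_def
      by (rule degree_sum_le) (auto intro: order.trans[OF degree_monom_le])
    with N show ?thesis by simp
  qed
  ultimately have "p = 0"
    using N card_eq_poly_degree_less_imp_0 by blast
  moreover have "coeff p i0 = fls_nth (vec_index c i0) (\<mu> + int i0)"
    using i0(1) by (auto simp: p_def coeff_sum I_def sum.delta)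
  moreover have "fls_nth (vec_index c i0) (\<mu> + int i0) \<noteq> 0"
    using i0 by (simp add: I_def)
  ultimately show False by simp
qed

text \<open>Rotating the eigenvector equation by all roots of unity yields \<open>N\<close>
  eigenvectors with the conjugate eigenvalues. They form an invertible matrix over the field of
  Laurent series, so the given matrix is diagonalised there.\<close>

lemma char_poly_eq_spectral_product:
  fixes M :: "complex poly mat" and v :: "nat \<Rightarrow> complex fls"
  assumes N: "N \<ge> 1" and M: "M \<in> carrier_mat N N"
    and ev: "\<And>r. r < N \<Longrightarrow> (\<Sum>i<N. lam_subst N (M $$ (r,i)) * v i) = A * v r"
    and v0: "\<And>i s. i < N \<Longrightarrow> s < - int i \<Longrightarrow> fls_nth (v i) s = 0"
    and v1: "\<And>i. i < N \<Longrightarrow> fls_nth (v i) (- int i) = 1"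
  shows "eval_X N (char_poly M) = spectral_product N A"
proof -
  have "finite {\<epsilon>::complex. \<epsilon> ^ N = 1}" "card {\<epsilon>::complex. \<epsilon> ^ N = 1} = N"
    using N finite_roots_unity[of N] card_roots_unity_eq[of N] by auto
  then obtain e where e: "bij_betw e {..<N} {\<epsilon>::complex. \<epsilon> ^ N = 1}"
    using ex_bij_betw_nat_finite[of "{\<epsilon>::complex. \<epsilon> ^ N = 1}"] by (auto simp: lessThan_atLeast0)
  have en: "e k ^ N = 1" "e k \<noteq> 0" if "k < N" for k
  proof -
    have "e k \<in> {\<epsilon>. \<epsilon> ^ N = 1}"
      using bij_betw_apply[OF e] that by simp
    then show "e k ^ N = 1" "e k \<noteq> 0"
      using N by (auto simp: power_0_left)
  qed
  define V where "V = Matrix.mat N N (\<lambda>(k,i). fls_rotate (e k) (v i))"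
  \<comment> \<open>The conjugate eigenvectors are the rows of \<open>V\<close>, hence the
    transpose; it has the same characteristic polynomial.\<close>
  define HM where "HM = transpose_mat (map_mat (lam_subst N) M)"
  define D where "D = Matrix.mat N N (\<lambda>(k,i). if k = i then fls_rotate (e k) A else 0)"
  have carr: "V \<in> carrier_mat N N" "HM \<in> carrier_mat N N" "D \<in> carrier_mat N N"
    using M by (auto simp: V_def HM_def D_def)
  have VD: "V * HM = D * V"
  proof (rule eq_matI)
    fix k r assume "k < dim_row (D * V)" "r < dim_col (D * V)"
    then have kr: "k < N" "r < N" using carr by auto
    have "(V * HM) $$ (k, r) = (\<Sum>i<N. fls_rotate (e k) (v i) * lam_subst N (M $$ (r, i)))"
      using kr M carr by (simp add: scalar_prod_def V_def HM_def lessThan_atLeast0)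
    also have "\<dots> = (\<Sum>i<N. fls_rotate (e k) (lam_subst N (M $$ (r, i)) * v i))"
      using en kr by (intro sum.cong refl) (simp add: fls_rotate_mult fls_rotate_lam_subst mult.commute)
    also have "\<dots> = fls_rotate (e k) (A * v r)"
      using ev kr by (simp flip: fls_rotate_sum)
    also have "\<dots> = (\<Sum>i<N. (if k = i then fls_rotate (e k) A else 0) * fls_rotate (e i) (v r))"
      using kr en by (simp add: if_distrib[of "\<lambda>x. x * _"] fls_rotate_mult cong: if_cong)
    also have "\<dots> = (D * V) $$ (k, r)"
      using kr M carr by (simp add: scalar_prod_def V_def D_def lessThan_atLeast0)
    finally show "(V * HM) $$ (k, r) = (D * V) $$ (k, r)" .
  qed (use carr in auto)
  have "Determinant.det V \<noteq> 0"
    unfolding V_def by (rule conjugates_det_nonzero[OF N e v0 v1])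
  from det_non_zero_imp_unit[OF carr(1) this, of "()"]
  obtain W where W: "W \<in> carrier_mat N N" "W * V = 1\<^sub>m N" "V * W = 1\<^sub>m N"
    by (auto simp: Units_def ring_mat_def)
  have "HM = (W * V) * HM" using carr W by simp
  also have "\<dots> = W * (V * HM)" using carr W by (intro assoc_mult_mat) auto
  also have "\<dots> = W * (D * V)" by (simp add: VD)
  also have "\<dots> = W * D * V" using carr W by (intro assoc_mult_mat[symmetric]) auto
  finally have "similar_mat HM D"
    by (intro similar_matI[of _ _ W V]) (use carr W in auto)
  then have "char_poly HM = char_poly D" by (rule char_poly_similar)
  moreover have "char_poly HM = eval_X N (char_poly M)"
    using M by (simp add: HM_def eval_X_lam_subst lam_subst.char_poly_hom)
  moreover have "char_poly D = spectral_product N A"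
  proof -
    have "char_poly D = (\<Prod>a\<leftarrow>diag_mat D. [:- a, 1:])"
      by (rule char_poly_upper_triangular[OF carr(3)]) (auto simp: D_def)
    also have "\<dots> = (\<Prod>k<N. [:- fls_rotate (e k) A, 1:])"
    proof -
      have "map (\<lambda>a. [:- a, 1:]) (diag_mat D) = map (\<lambda>k. [:- fls_rotate (e k) A, 1:]) [0..<N]"
        by (auto simp: diag_mat_def D_def)
      then show ?thesis
        by (simp add: lessThan_atLeast0 prod.distinct_set_conv_list[of "[0..<N]", simplified])
    qed
    also have "\<dots> = spectral_product N A"
      unfolding spectral_product_def by (rule prod.reindex_bij_betw[OF e])
    finally show ?thesis .
  qed
  ultimately show ?thesis by simp
qed

section \<open>The matrix of an operator on the solutions of a differential equation\<close>

definition fps_poly :: "complex fps \<Rightarrow> complex poly fps" where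
  "fps_poly f = Abs_fps (\<lambda>n. [:fps_nth f n:])"

text \<open>
  A row \<open>r\<close> stands for the operator \<open>\<Sum>i<N. r i * \<partial>^i\<close>. On solutions of \<open>P u = X u\<close>, \<open>red_row\<close> is the row of
  \<open>\<partial>^N\<close> and \<open>next_row\<close> composes with \<open>\<partial>\<close> from the left; \<open>[:0, 1:]\<close> is \<open>X\<close>.
\<close>

definition red_row :: "nat \<Rightarrow> (nat \<Rightarrow> complex fps) \<Rightarrow> nat \<Rightarrow> complex poly fps" where
  "red_row N a i = (if i = 0 then fps_const [:0, 1:] else 0) - fps_poly (a (N - i))"

definition next_row :: "nat \<Rightarrow> (nat \<Rightarrow> complex fps) \<Rightarrow> (nat \<Rightarrow> complex poly fps) \<Rightarrow> nat \<Rightarrow> complex poly fps" where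
  "next_row N a r i = fps_deriv (r i) + (if i = 0 then 0 else r (i - 1)) + r (N - 1) * red_row N a i"

definition unit_row :: "nat \<Rightarrow> complex poly fps" where
  "unit_row i = (if i = 0 then 1 else 0)"

definition op_row :: "nat \<Rightarrow> nat \<Rightarrow> (nat \<Rightarrow> complex fps) \<Rightarrow> (nat \<Rightarrow> complex fps) \<Rightarrow> nat \<Rightarrow> complex poly fps" where
  "op_row N M a b i = (\<Sum>j\<le>M. fps_poly (b j) * (next_row N a ^^ (M - j)) unit_row i)"

text \<open>Row \<open>r\<close> expresses the \<open>r\<close>-th derivative of \<open>Q u\<close>
  at the expansion point through the jet of \<open>u\<close>. Although only constant terms are kept
  in the end, forming the rows differentiates the coefficients, which is why whole Taylor series are
  carried along.\<close>

definition op_mat :: "nat \<Rightarrow> nat \<Rightarrow> (nat \<Rightarrow> complex fps) \<Rightarrow> (nat \<Rightarrow> complex fps) \<Rightarrow> complex poly mat" where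
  "op_mat N M a b = Matrix.mat N N (\<lambda>(r,i). fps_nth ((next_row N a ^^ r) (op_row N M a b) i) 0)"

definition spec_poly :: "nat \<Rightarrow> nat \<Rightarrow> (nat \<Rightarrow> complex fps) \<Rightarrow> (nat \<Rightarrow> complex fps) \<Rightarrow> complex poly poly" where
  "spec_poly N M a b = char_poly (op_mat N M a b)"

lemma op_mat_carrier [simp]: "op_mat N M a b \<in> carrier_mat N N"
  by (simp add: op_mat_def)

lemma dim_op_mat [simp]: "dim_row (op_mat N M a b) = N" "dim_col (op_mat N M a b) = N"
  by (simp_all add: op_mat_def)

lemma char_poly_matrix_op_mat:
  "r < N \<Longrightarrow> i < N \<Longrightarrow> char_poly_matrix (op_mat N M a b) $$ (r, i) =
     (if r = i then [:0, 1:] else 0) + [:- (op_mat N M a b $$ (r, i)):]"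
  by (simp add: char_poly_matrix_def)

lemma spec_poly_cong:
  assumes a: "\<And>l. l \<le> N \<Longrightarrow> a l = a' l" and b: "\<And>j. j \<le> M \<Longrightarrow> b j = b' j"
  shows "spec_poly N M a b = spec_poly N M a' b'"
proof -
  have "red_row N a = red_row N a'"
    by (auto simp: fun_eq_iff red_row_def a)
  then have n: "next_row N a = next_row N a'"
    by (auto simp: fun_eq_iff next_row_def)
  have "op_row N M a b = op_row N M a' b'"
    by (rule ext) (simp add: op_row_def n b)
  with n show ?thesis by (simp add: spec_poly_def op_mat_def)
qed

text \<open>
  Formal solutions are written as \<open>u e\<^bsup>\<lambda>z\<^esup>\<close>, so that \<open>\<partial>\<close> acts on \<open>u\<close> as \<open>\<partial> + \<lambda>\<close>. Series in \<open>\<lambda>\<^bsup>-1\<^esup>\<close> are Laurent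
  series in the variable \<open>fls_X\<close>, hence \<open>\<lambda>\<close> is \<open>fls_X_inv\<close>.
\<close>

definition twist_deriv :: "complex fls fps \<Rightarrow> complex fls fps" where
  "twist_deriv u = fps_deriv u + fps_const fls_X_inv * u"

definition lam_fps :: "nat \<Rightarrow> complex poly fps \<Rightarrow> complex fls fps" where
  "lam_fps N f = Abs_fps (\<lambda>n. lam_subst N (fps_nth f n))"

definition fls_fps :: "complex fps \<Rightarrow> complex fls fps" where
  "fls_fps f = Abs_fps (\<lambda>n. fls_const (fps_nth f n))"

lemma lam_fps_add: "lam_fps N (f + g) = lam_fps N f + lam_fps N g"
  by (rule fps_ext) (simp add: lam_fps_def lam_subst.hom_add)

lemma lam_fps_diff: "lam_fps N (f - g) = lam_fps N f - lam_fps N g"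
  by (rule fps_ext) (simp add: lam_fps_def lam_subst.hom_minus)

lemma lam_fps_0 [simp]: "lam_fps N 0 = 0"
  by (rule fps_ext) (simp add: lam_fps_def)

lemma lam_fps_1 [simp]: "lam_fps N 1 = 1"
  by (rule fps_ext) (simp add: lam_fps_def)

lemma lam_fps_mult: "lam_fps N (f * g) = lam_fps N f * lam_fps N g"
  by (rule fps_ext) (simp add: lam_fps_def fps_mult_nth lam_subst.hom_sum lam_subst.hom_mult)

lemma lam_fps_sum: "lam_fps N (\<Sum>i\<in>I. f i) = (\<Sum>i\<in>I. lam_fps N (f i))"
  by (induction I rule: infinite_finite_induct) (auto simp: lam_fps_add)

lemma lam_fps_deriv: "lam_fps N (fps_deriv f) = fps_deriv (lam_fps N f)"
  by (rule fps_ext) (simp add: lam_fps_def lam_subst.hom_mult lam_subst.hom_add lam_subst.hom_of_nat)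

lemma lam_fps_poly: "lam_fps N (fps_poly f) = fls_fps f"
  by (rule fps_ext) (simp add: lam_fps_def fps_poly_def fls_fps_def)

lemma lam_fps_X: "lam_fps N (fps_const [:0, 1:]) = fps_const (fls_X_inv ^ N)"
  by (rule fps_ext) (simp add: lam_fps_def)

lemma twist_deriv_add: "twist_deriv (u + w) = twist_deriv u + twist_deriv w"
  by (simp add: twist_deriv_def algebra_simps)

lemma twist_deriv_mult: "twist_deriv (f * u) = fps_deriv f * u + f * twist_deriv u"
  by (simp add: twist_deriv_def algebra_simps)

lemma twist_deriv_sum: "twist_deriv (\<Sum>i\<in>I. f i) = (\<Sum>i\<in>I. twist_deriv (f i))"
  by (induction I rule: infinite_finite_induct) (auto simp: twist_deriv_add, auto simp: twist_deriv_def)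

lemma twist_deriv_funpow_const: "(twist_deriv ^^ r) (fps_const A * u) = fps_const A * (twist_deriv ^^ r) u"
  by (induction r) (simp_all add: twist_deriv_mult)

text \<open>Evaluation of rows on \<open>u\<close> intertwines \<open>next_row\<close> with
  \<open>twist_deriv\<close>. The eigenvalue equation for \<open>Q\<close>, differentiated
  \<open>r\<close> times with \<open>A\<close> constant in \<open>z\<close>, then says that the jet
  of \<open>u\<close> is an eigenvector of \<open>op_mat\<close>.\<close>

lemma spec_poly_eq_spectral_product:
  assumes N: "N \<ge> 1" and a0: "a 0 = 1"
    and P: "(\<Sum>j\<le>N. fls_fps (a j) * (twist_deriv ^^ (N - j)) u) = fps_const (fls_X_inv ^ N) * u"
    and Q: "(\<Sum>j\<le>M. fls_fps (b j) * (twist_deriv ^^ (M - j)) u) = fps_const A * u"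
    and u0: "\<And>n s. s < 0 \<Longrightarrow> fls_nth (fps_nth u n) s = 0"
    and u1: "\<And>n. fls_nth (fps_nth u n) 0 = (if n = 0 then 1 else 0)"
  shows "eval_X N (spec_poly N M a b) = spectral_product N A"
proof -
  \<comment> \<open>The value on \<open>u\<close> of the operator with row \<open>r\<close>, with
    \<open>\<lambda>^N\<close> in place of \<open>X\<close>.\<close>
  define pair where "pair r = (\<Sum>i<N. lam_fps N (r i) * (twist_deriv ^^ i) u)" for r
  have red: "lam_fps N (red_row N a i) = (if i = 0 then fps_const (fls_X_inv ^ N) else 0) - fls_fps (a (N - i))" for i
    by (auto simp: red_row_def lam_fps_diff lam_fps_poly lam_fps_X)
  \<comment> \<open>The equation for \<open>P\<close>, solved for the highest derivative;
    \<open>a 0 = 1\<close> makes this possible without division.\<close>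
  have top: "(twist_deriv ^^ N) u = (\<Sum>i<N. lam_fps N (red_row N a i) * (twist_deriv ^^ i) u)"
  proof -
    have "(\<Sum>j\<le>N. fls_fps (a j) * (twist_deriv ^^ (N - j)) u) =
        (\<Sum>i\<le>N. fls_fps (a (N - i)) * (twist_deriv ^^ i) u)"
      by (rule sum.reindex_bij_witness[where i = "\<lambda>i. N - i" and j = "\<lambda>i. N - i"]) auto
    also have "\<dots> = (\<Sum>i<N. fls_fps (a (N - i)) * (twist_deriv ^^ i) u) + fls_fps (a 0) * (twist_deriv ^^ N) u"
      by (simp flip: lessThan_Suc_atMost)
    also have "fls_fps (a 0) = 1"
      by (rule fps_ext) (simp add: a0 fls_fps_def)
    finally have "(twist_deriv ^^ N) u = fps_const (fls_X_inv ^ N) * u - (\<Sum>i<N. fls_fps (a (N - i)) * (twist_deriv ^^ i) u)"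
      unfolding P by (simp add: algebra_simps)
    also have "fps_const (fls_X_inv ^ N) * u = (\<Sum>i<N. (if i = 0 then fps_const (fls_X_inv ^ N) else 0) * (twist_deriv ^^ i) u)"
    proof -
      have "{..<N} = insert 0 {1..<N}" using N by auto
      then show ?thesis by simp
    qed
    finally show ?thesis
      by (simp only: red left_diff_distrib sum_subtractf)
  qed
  have step: "twist_deriv (pair r) = pair (next_row N a r)" for r
  proof -
    have "twist_deriv (pair r) = (\<Sum>i<N. lam_fps N (fps_deriv (r i)) * (twist_deriv ^^ i) u) +
        (\<Sum>i<N. lam_fps N (r i) * (twist_deriv ^^ Suc i) u)"
      by (simp add: pair_def twist_deriv_sum twist_deriv_mult lam_fps_deriv sum.distrib)
    also have "(\<Sum>i<N. lam_fps N (r i) * (twist_deriv ^^ Suc i) u) =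
        (\<Sum>i<N. lam_fps N (if i = 0 then 0 else r (i - 1)) * (twist_deriv ^^ i) u) + lam_fps N (r (N - 1)) * (twist_deriv ^^ N) u"
    proof -
      obtain n where n: "N = Suc n" using N by (cases N) auto
      show ?thesis unfolding n
        by (subst sum.lessThan_Suc, subst sum.lessThan_Suc_shift) simp
    qed
    finally show ?thesis
      unfolding top by (simp add: pair_def next_row_def lam_fps_add lam_fps_mult sum.distrib
          sum_distrib_left algebra_simps)
  qed
  have unit: "pair unit_row = u"
  proof -
    have "{..<N} = insert 0 {1..<N}" using N by auto
    then show ?thesis by (simp add: pair_def unit_row_def)
  qed
  have iter: "(twist_deriv ^^ m) (pair r) = pair ((next_row N a ^^ m) r)" for m r
    by (induction m) (simp_all add: step)
  have op: "pair (op_row N M a b) = fps_const A * u"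
  proof -
    have "pair (op_row N M a b) = (\<Sum>j\<le>M. fls_fps (b j) * pair ((next_row N a ^^ (M - j)) unit_row))"
      by (simp add: pair_def op_row_def lam_fps_sum lam_fps_mult lam_fps_poly sum_distrib_left
          sum_distrib_right mult.assoc sum.swap[of _ "{..M}"])
    also have "\<dots> = fps_const A * u"
      unfolding iter[symmetric] unit Q ..
    finally show ?thesis .
  qed
  \<comment> \<open>Differentiation keeps the power of \<lambda>, multiplication by \<lambda> raises
    it by one. The case \<open>n = 0\<close> against \<open>n > 0\<close> says that the leading
    coefficient is the constant function 1 of \<open>z\<close>, so differentiating it contributes
    nothing to the next leading term.\<close>
  have lead: "(\<forall>s. s < - int i \<longrightarrow> fls_nth (fps_nth ((twist_deriv ^^ i) u) n) s = 0) \<and>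
      fls_nth (fps_nth ((twist_deriv ^^ i) u) n) (- int i) = (if n = 0 then 1 else 0)" for i n
  proof (induction i arbitrary: n)
    case 0
    then show ?case using u0 u1 by simp
  next
    case (Suc i)
    have mul: "fls_nth (of_nat k * f) s = of_nat k * fls_nth f s" for k s and f :: "complex fls"
      by (induction k) (simp_all add: algebra_simps)
    have X: "fls_nth (fls_X_inv * f) s = fls_nth f (s + 1)" for s and f :: "complex fls"
      by (simp add: fls_X_inv_times_conv_shift)
    have T: "fls_nth (fps_nth (twist_deriv w) n) s =
        of_nat (Suc n) * fls_nth (fps_nth w (Suc n)) s + fls_nth (fps_nth w n) (s + 1)" for w s
      by (simp add: twist_deriv_def X mul del: of_nat_Suc)
    have e: "1 - int (Suc i) = - int i" by simp
    show ?case
      using Suc.IH[of n] Suc.IH[of "Suc n"] by (auto simp: T e simp del: of_nat_Suc)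
  qed
  show ?thesis unfolding spec_poly_def
  proof (rule char_poly_eq_spectral_product[OF N op_mat_carrier, where v = "\<lambda>i. fps_nth ((twist_deriv ^^ i) u) 0"])
    fix r assume r: "r < N"
    have "fps_nth (pair ((next_row N a ^^ r) (op_row N M a b))) 0 = fps_nth (fps_const A * (twist_deriv ^^ r) u) 0"
      unfolding iter[symmetric] op twist_deriv_funpow_const ..
    then show "(\<Sum>i<N. lam_subst N (op_mat N M a b $$ (r, i)) * fps_nth ((twist_deriv ^^ i) u) 0) =
        A * fps_nth ((twist_deriv ^^ r) u) 0"
      using r by (simp add: pair_def fps_sum_nth lam_fps_def op_mat_def)
  qed (use lead in auto)
qed

subsection \<open>Dependence on the Taylor coefficients\<close>

text \<open>The common abstraction of the two kinds of regularity used later: holomorphy in \<Omega>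
  and, near a cusp, boundedness together with periodicity.\<close>

definition fun_subring :: "(('x \<Rightarrow> 'r::comm_ring_1) \<Rightarrow> bool) \<Rightarrow> bool" where
  "fun_subring C \<longleftrightarrow> (\<forall>c. C (\<lambda>_. c)) \<and> (\<forall>f g. C f \<longrightarrow> C g \<longrightarrow> C (\<lambda>x. f x + g x) \<and> C (\<lambda>x. f x * g x))"

lemma fun_subringD:
  assumes "fun_subring C"
  shows "C (\<lambda>_. c)" "C f \<Longrightarrow> C g \<Longrightarrow> C (\<lambda>x. f x + g x)" "C f \<Longrightarrow> C g \<Longrightarrow> C (\<lambda>x. f x * g x)"
  using assms by (auto simp: fun_subring_def)

lemma fun_subring_uminus:
  assumes "fun_subring C" "C f"
  shows "C (\<lambda>x. - f x)"
  using fun_subringD(3)[OF assms(1), OF fun_subringD(1)[OF assms(1), of "- 1"] assms(2)] by simp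

lemma fun_subring_sum:
  assumes "fun_subring C" "\<And>i. i \<in> I \<Longrightarrow> C (f i)"
  shows "C (\<lambda>x. \<Sum>i\<in>I. f i x)"
  using assms(2) by (induction I rule: infinite_finite_induct) (auto intro: fun_subringD[OF assms(1)])

lemma fun_subring_prod:
  assumes "fun_subring C" "\<And>i. i \<in> I \<Longrightarrow> C (f i)"
  shows "C (\<lambda>x. \<Prod>i\<in>I. f i x)"
  using assms(2) by (induction I rule: infinite_finite_induct) (auto intro: fun_subringD[OF assms(1)])

text \<open>Coefficients of sums and products are finite polynomial expressions in coefficients.
  Iterating this lift, also for power series, reaches the nested types in which the rows and the
  characteristic polynomial live.\<close>

lemma fun_subring_poly:
  assumes "fun_subring C"
  shows "fun_subring (\<lambda>f. \<forall>n. C (\<lambda>x. coeff (f x) n))"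
  unfolding fun_subring_def
  by (auto simp: coeff_mult intro!: fun_subringD[OF assms] fun_subring_sum[OF assms])

lemma fun_subring_fps:
  assumes "fun_subring C"
  shows "fun_subring (\<lambda>f. \<forall>n. C (\<lambda>x. fps_nth (f x) n))"
  unfolding fun_subring_def
  by (auto simp: fps_mult_nth intro!: fun_subringD[OF assms] fun_subring_sum[OF assms])

lemma fun_subring_const_poly:
  assumes "fun_subring C" "C f"
  shows "C (\<lambda>x. coeff [:f x:] n)"
  using assms(2) fun_subringD(1)[OF assms(1), of 0] by (cases n) auto

text \<open>The rows arise from Taylor coefficients by ring operations and by differentiation, which
  multiplies coefficients by integers, so every coefficient of the result is a universal polynomial
  in finitely many Taylor coefficients.\<close>

lemma fun_subring_spec_poly:
  assumes C: "fun_subring C" and N: "N \<ge> 1"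
    and a: "\<And>l n. l \<le> N \<Longrightarrow> C (\<lambda>x. fps_nth (a x l) n)"
    and b: "\<And>j n. j \<le> M \<Longrightarrow> C (\<lambda>x. fps_nth (b x j) n)"
  shows "C (\<lambda>x. coeff (coeff (spec_poly N M (a x) (b x)) k) p)"
proof -
  note P = fun_subring_poly[OF C]
  note F = fun_subring_fps[OF P]
  note PP = fun_subring_poly[OF P]
  define CP where "CP = (\<lambda>f. \<forall>n. C (\<lambda>x. coeff (f x :: complex poly) n))"
  define CF where "CF = (\<lambda>f. \<forall>n. CP (\<lambda>x. fps_nth (f x) n))"
  define CPP where "CPP = (\<lambda>f. \<forall>n. CP (\<lambda>x. coeff (f x) n))"
  have sub: "fun_subring CP" "fun_subring CF" "fun_subring CPP"
    unfolding CP_def CF_def CPP_def by (rule P, rule F, rule PP)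
  have cf: "CF (\<lambda>x. fps_poly (f x))" if "\<And>n. C (\<lambda>x. fps_nth (f x) n)" for f
    using fun_subring_const_poly[OF C, OF that] by (simp add: CF_def CP_def fps_poly_def)
  have diff: "CF (\<lambda>x. f x - g x)" if "CF f" "CF g" for f g
    using fun_subringD(2)[OF sub(2), OF that(1) fun_subring_uminus[OF sub(2), OF that(2)]] by simp
  have red: "CF (\<lambda>x. red_row N (a x) i)" for i
    unfolding red_row_def by (intro diff fun_subringD(1)[OF sub(2)] cf a) simp
  have deriv: "CF (\<lambda>x. fps_deriv (f x))" if "CF f" for f
    using that unfolding CF_def fps_deriv_nth
    by (intro allI fun_subringD[OF sub(1)]) auto
  have nxt: "CF (\<lambda>x. next_row N (a x) (r x) i)" if "\<And>i. CF (\<lambda>x. r x i)" for r i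
  proof -
    have "CF (\<lambda>x. if i = 0 then 0 else r x (i - 1))"
      using that fun_subringD(1)[OF sub(2), of 0] by (cases "i = 0") simp_all
    then show ?thesis
      unfolding next_row_def by (intro fun_subringD(2,3)[OF sub(2)] deriv that red)
  qed
  have iter: "CF (\<lambda>x. (next_row N (a x) ^^ m) (r x) i)" if "\<And>i. CF (\<lambda>x. r x i)" for m r i
  proof (induction m arbitrary: i)
    case 0
    then show ?case using that by simp
  next
    case (Suc m)
    then show ?case by (simp add: nxt)
  qed
  have op: "CF (\<lambda>x. op_row N M (a x) (b x) i)" for i
    unfolding op_row_def
    by (intro fun_subring_sum[OF sub(2)] fun_subringD(3)[OF sub(2)] cf b iter fun_subringD(1)[OF sub(2)]) auto
  have entry: "CP (\<lambda>x. op_mat N M (a x) (b x) $$ (r, i))" if "r < N" "i < N" for r i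
    using iter[OF op, where m = r and i = i] that by (simp add: op_mat_def CF_def)
  have entry': "CPP (\<lambda>x. char_poly_matrix (op_mat N M (a x) (b x)) $$ (r, i))" if ri: "r < N" "i < N" for r i
  proof -
    have *: "CPP (\<lambda>x. [:- (op_mat N M (a x) (b x) $$ (r, i)):])"
      using fun_subring_const_poly[OF sub(1), OF fun_subring_uminus[OF sub(1), OF entry[OF ri]]]
      by (simp add: CPP_def)
    have eq: "char_poly_matrix (op_mat N M (a x) (b x)) $$ (r, i) =
        (if r = i then [:0, 1:] else 0) + [:- (op_mat N M (a x) (b x) $$ (r, i)):]" for x
      using ri by (simp add: char_poly_matrix_op_mat)
    show ?thesis unfolding eq by (intro fun_subringD[OF sub(3)] *)
  qed
  \<comment> \<open>The Leibniz formula turns the determinant into sums and products of entries, for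
    which closure is known.\<close>
  have eq: "spec_poly N M (a x) (b x) = (\<Sum>\<pi>\<in>{\<pi>. \<pi> permutes {0..<N}}. signof \<pi> *
      (\<Prod>i=0..<N. char_poly_matrix (op_mat N M (a x) (b x)) $$ (i, \<pi> i)))" for x
    unfolding spec_poly_def char_poly_def
    by (rule det_def') simp
  have "CPP (\<lambda>x. spec_poly N M (a x) (b x))"
    unfolding eq
    by (intro fun_subring_sum[OF sub(3)] fun_subringD[OF sub(3)] fun_subring_prod[OF sub(3)] entry')
       (auto simp: permutes_in_image)
  then show ?thesis by (simp add: CPP_def CP_def)
qed

subsection \<open>Behaviour under scaling\<close>

definition scale_const :: "complex \<Rightarrow> int \<Rightarrow> complex poly fps" where
  "scale_const J k = fps_const [:J powi k:]"

text \<open>The factor at coefficient \<open>n\<close> reflects the replacement of \<open>z\<close>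
  by \<open>z / J\<close>. Moreover \<open>X\<close> becomes \<open>J^N X\<close>, because the
  rescaled \<open>P\<close> is \<open>J\<close> to the power \<open>- N\<close> times the original
  operator.\<close>

definition scale_fps :: "nat \<Rightarrow> complex \<Rightarrow> complex poly fps \<Rightarrow> complex poly fps" where
  "scale_fps N J f = Abs_fps (\<lambda>n. Polynomial.smult (J powi (- int n)) (pcompose (fps_nth f n) [:0, J ^ N:]))"

lemma scale_const_add:
  "J \<noteq> 0 \<Longrightarrow> scale_const J (k + l) = scale_const J k * scale_const J l"
  by (simp add: scale_const_def power_int_add)

lemma scale_fps_add: "scale_fps N J (f + g) = scale_fps N J f + scale_fps N J g"
  by (rule fps_ext) (simp add: scale_fps_def pcompose_add smult_add_right)

lemma scale_fps_diff: "scale_fps N J (f - g) = scale_fps N J f - scale_fps N J g"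
  by (rule fps_ext) (simp add: scale_fps_def pcompose_diff smult_diff_right)

lemma scale_fps_0 [simp]: "scale_fps N J 0 = 0"
  by (rule fps_ext) (simp add: scale_fps_def)

lemma scale_fps_1 [simp]: "scale_fps N J 1 = 1"
  by (rule fps_ext) (simp add: scale_fps_def pcompose_1)

lemma scale_fps_mult:
  assumes "J \<noteq> 0"
  shows "scale_fps N J (f * g) = scale_fps N J f * scale_fps N J g"
proof (rule fps_ext)
  fix n
  have "fps_nth (scale_fps N J f * scale_fps N J g) n =
      (\<Sum>i=0..n. Polynomial.smult (J powi (- int i) * J powi (- int (n - i)))
         (pcompose (fps_nth f i) [:0, J ^ N:] * pcompose (fps_nth g (n - i)) [:0, J ^ N:]))"
    by (simp add: fps_mult_nth scale_fps_def mult.commute)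
  also have "\<dots> = (\<Sum>i=0..n. Polynomial.smult (J powi (- int n))
         (pcompose (fps_nth f i) [:0, J ^ N:] * pcompose (fps_nth g (n - i)) [:0, J ^ N:]))"
    by (intro sum.cong refl arg_cong2[of _ _ _ _ Polynomial.smult])
       (use assms in \<open>auto simp flip: power_int_add\<close>)
  also have "\<dots> = fps_nth (scale_fps N J (f * g)) n"
    by (simp add: scale_fps_def fps_mult_nth pcompose_sum pcompose_mult smult_sum2)
  finally show "fps_nth (scale_fps N J (f * g)) n = fps_nth (scale_fps N J f * scale_fps N J g) n" ..
qed

lemma scale_fps_sum: "scale_fps N J (\<Sum>i\<in>I. f i) = (\<Sum>i\<in>I. scale_fps N J (f i))"
  by (induction I rule: infinite_finite_induct) (auto simp: scale_fps_add)

lemma scale_fps_deriv: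
  assumes "J \<noteq> 0"
  shows "fps_deriv (scale_fps N J f) = scale_const J (- 1) * scale_fps N J (fps_deriv f)"
proof (rule fps_ext)
  fix n
  have e: "J powi (- int (n + 1)) = J powi (- 1) * J powi (- int n)"
    using assms by (subst power_int_add[symmetric]) auto
  have of_nat: "of_nat k * p = Polynomial.smult (of_nat k) p" for k and p :: "complex poly"
    by (simp add: of_nat_poly)
  show "fps_nth (fps_deriv (scale_fps N J f)) n = fps_nth (scale_const J (- 1) * scale_fps N J (fps_deriv f)) n"
    by (simp only: fps_deriv_nth scale_fps_def scale_const_def fps_nth_Abs_fps fps_mult_left_const_nth
          of_nat e pcompose_smult) (simp add: mult_ac)
qed

lemma scale_fps_poly:
  assumes "\<And>n. fps_nth f' n = J powi (k - int n) * fps_nth f n" "J \<noteq> 0"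
  shows "fps_poly f' = scale_const J k * scale_fps N J (fps_poly f)"
  using assms(2)
  by (intro fps_ext) (auto simp: fps_poly_def scale_const_def scale_fps_def assms(1) power_int_diff
      power_int_minus field_simps pcompose_const)

text \<open>Column \<open>i\<close> has weight \<open>k + i\<close>, and one derivative lowers
  \<open>k\<close> by one. All three summands agree with this: differentiating a coefficient costs
  one factor \<open>J\<close>, the shift takes column \<open>i - 1\<close>, and the last column of
  weight \<open>k + N - 1\<close> is multiplied by a reduced row of weight
  \<open>i - N\<close>.\<close>

lemma scale_next_row:
  assumes N: "N \<ge> 1" and J: "J \<noteq> 0"
    and a: "\<And>l n. l \<le> N \<Longrightarrow> fps_nth (a' l) n = J powi (- int l - int n) * fps_nth (a l) n"
    and r: "\<And>i. i < N \<Longrightarrow> r' i = scale_const J (k + int i) * scale_fps N J (r i)" and i: "i < N"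
  shows "next_row N a' r' i = scale_const J (k - 1 + int i) * scale_fps N J (next_row N a r i)"
proof -
  note c = scale_const_add[OF J]
  have "fps_poly (a' (N - i)) = scale_const J (int i - int N) * scale_fps N J (fps_poly (a (N - i)))"
    by (rule scale_fps_poly[OF _ J]) (use i a[of "N - i"] in \<open>simp add: of_nat_diff\<close>)
  moreover have "(if i = 0 then fps_const [:0, 1:] else 0) =
      scale_const J (int i - int N) * scale_fps N J (if i = 0 then fps_const [:0, 1:] else 0)"
  proof (cases "i = 0")
    case True
    have "J powi (- int N) * J ^ N = 1"
      using J by (simp add: power_int_minus)
    then show ?thesis using True
      by (intro fps_ext) (simp add: scale_const_def scale_fps_def pcompose_pCons)
  qed simp
  ultimately have red: "red_row N a' i = scale_const J (int i - int N) * scale_fps N J (red_row N a i)"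
    by (simp add: red_row_def scale_fps_diff right_diff_distrib)
  have 1: "fps_deriv (r' i) = scale_const J (k - 1 + int i) * scale_fps N J (fps_deriv (r i))"
  proof -
    have "fps_deriv (r' i) = scale_const J (k + int i) * fps_deriv (scale_fps N J (r i))"
      by (simp add: r[OF i] scale_const_def)
    also have "\<dots> = scale_const J ((k + int i) + (-1)) * scale_fps N J (fps_deriv (r i))"
      unfolding scale_fps_deriv[OF J] c by (simp only: mult.assoc)
    finally show ?thesis by (simp add: algebra_simps)
  qed
  have 2: "(if i = 0 then 0 else r' (i - 1)) =
      scale_const J (k - 1 + int i) * scale_fps N J (if i = 0 then 0 else r (i - 1))"
    using i r[of "i - 1"] by (cases "i = 0") (auto simp: of_nat_diff algebra_simps)
  have 3: "r' (N - 1) * red_row N a' i = scale_const J (k - 1 + int i) * scale_fps N J (r (N - 1) * red_row N a i)"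
  proof -
    have "k - 1 + int i = (k + int (N - 1)) + (int i - int N)"
      using N by (simp add: of_nat_diff)
    then show ?thesis
      using N by (simp only: c red r[of "N - 1"] scale_fps_mult[OF J]) (simp add: r mult_ac)
  qed
  show ?thesis
    unfolding next_row_def scale_fps_add 1 2 3 by (simp add: distrib_left)
qed

lemma scale_next_row_funpow:
  assumes N: "N \<ge> 1" and J: "J \<noteq> 0"
    and a: "\<And>l n. l \<le> N \<Longrightarrow> fps_nth (a' l) n = J powi (- int l - int n) * fps_nth (a l) n"
    and r: "\<And>i. i < N \<Longrightarrow> r' i = scale_const J (k + int i) * scale_fps N J (r i)" and i: "i < N"
  shows "(next_row N a' ^^ m) r' i = scale_const J (k - int m + int i) * scale_fps N J ((next_row N a ^^ m) r i)"
  using i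
proof (induction m arbitrary: i)
  case 0
  then show ?case by (simp add: r)
next
  case (Suc m)
  show ?case
    using scale_next_row[OF N J a Suc.IH Suc.prems] by (simp add: algebra_simps)
qed

definition scale_XY :: "complex \<Rightarrow> complex \<Rightarrow> complex poly poly \<Rightarrow> complex poly poly" where
  "scale_XY x y F = pcompose (map_poly (\<lambda>p. pcompose p [:0, x:]) F) [:0, [:y:]:]"

lemma coeff_scale_XY: "coeff (coeff (scale_XY x y F) k) p = y ^ k * x ^ p * coeff (coeff F k) p"
proof -
  have *: "coeff (pcompose q [:0, c:]) n = c ^ n * coeff q n" for q :: "'a::comm_ring_1 poly" and c n
    by (rule coeff_pcompose_linear)
  have "[:y:] ^ k = [:y ^ k:]"
    by (induction k) (auto simp: one_pCons)
  then show ?thesis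
    by (simp add: scale_XY_def * coeff_map_poly)
qed

text \<open>Entry \<open>(r, i)\<close> of the matrix acquires the power \<open>- K - r + i\<close>
  of \<open>J\<close>. After the substitutions \<open>J^N X\<close> for \<open>X\<close> and
  \<open>J^K Y\<close> for \<open>Y\<close> this holds for the whole characteristic matrix, diagonal
  included. In the determinant the contributions of \<open>r\<close> and \<open>i\<close> cancel,
  which leaves the power \<open>- N K\<close> and the powers from the two substitutions.\<close>

lemma spec_poly_scale:
  assumes N: "N \<ge> 1" and J: "J \<noteq> 0"
    and a: "\<And>l n. l \<le> N \<Longrightarrow> fps_nth (a' l) n = J powi (- int l - int n) * fps_nth (a l) n"
    and b: "\<And>j n. j \<le> M \<Longrightarrow> fps_nth (b' j) n = J powi (- K - int j + int M - int n) * fps_nth (b j) n"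
  shows "coeff (coeff (spec_poly N M a' b') k) p =
    J powi (- (int N * K - int N * int p - K * int k)) * coeff (coeff (spec_poly N M a b) k) p"
proof -
  note c = scale_const_add[OF J]
  interpret pc: comm_ring_hom "\<lambda>p. pcompose p [:0, J ^ N:]"
    by standard (auto simp: pcompose_add pcompose_mult pcompose_1)
  interpret pcp: map_poly_comm_ring_hom "\<lambda>p. pcompose p [:0, J ^ N:]" ..
  interpret XY: comm_ring_hom "scale_XY (J ^ N) (J powi K)"
    by standard (auto simp: scale_XY_def pcompose_add pcompose_mult pcompose_1 hom_distribs)
  have unit: "unit_row i = scale_const J (0 + int i) * scale_fps N J (unit_row i)" for i
    by (cases "i = 0") (auto simp: unit_row_def scale_const_def)
  have op: "op_row N M a' b' i = scale_const J (- K + int i) * scale_fps N J (op_row N M a b i)" if i: "i < N" for i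
  proof -
    have "fps_poly (b' j) * (next_row N a' ^^ (M - j)) unit_row i =
        scale_const J (- K + int i) * scale_fps N J (fps_poly (b j) * (next_row N a ^^ (M - j)) unit_row i)"
      if j: "j \<le> M" for j
    proof -
      have "fps_poly (b' j) = scale_const J (- K - int j + int M) * scale_fps N J (fps_poly (b j))"
        by (rule scale_fps_poly[OF _ J]) (use b j in simp)
      moreover have "(next_row N a' ^^ (M - j)) unit_row i =
          scale_const J (0 - int (M - j) + int i) * scale_fps N J ((next_row N a ^^ (M - j)) unit_row i)"
        by (rule scale_next_row_funpow[OF N J a unit i])
      moreover have "- K + int i = (- K - int j + int M) + (0 - int (M - j) + int i)"
        using j by (simp add: of_nat_diff)
      ultimately show ?thesis
        by (simp only: c scale_fps_mult[OF J]) (simp add: mult_ac)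
    qed
    then show ?thesis
      by (simp add: op_row_def scale_fps_sum sum_distrib_left)
  qed
  have mat: "op_mat N M a' b' $$ (r, i) = Polynomial.smult (J powi (- K - int r + int i)) (pcompose (op_mat N M a b $$ (r, i)) [:0, J ^ N:])"
    if "r < N" "i < N" for r i
    using scale_next_row_funpow[OF N J a op that(2), where m = r] that
    by (simp add: op_mat_def scale_const_def scale_fps_def)
  define C where "C F = char_poly_matrix (F :: complex poly mat)" for F
  have C: "C (op_mat N M a' b') $$ (r, i) =
      [:[:J powi (- K - int r + int i):]:] * scale_XY (J ^ N) (J powi K) (C (op_mat N M a b) $$ (r, i))"
    if ri: "r < N" "i < N" for r i
  proof -
    have X: "scale_XY (J ^ N) (J powi K) [:0, 1:] = [:0, [:J powi K:]:]"
      by (simp add: scale_XY_def map_poly_pCons pcompose_pCons pcompose_1)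
    have c: "scale_XY (J ^ N) (J powi K) [:q:] = [:pcompose q [:0, J ^ N:]:]" for q
      by (cases "q = 0") (simp_all add: scale_XY_def map_poly_pCons pcompose_const)
    have eq: "C (op_mat N M a b) $$ (r, i) =
        (if r = i then [:0, 1:] else 0) + [:- (op_mat N M a b $$ (r, i)):]" for a b
      using ri by (simp add: C_def char_poly_matrix_op_mat)
    have KK: "J powi (- K) * J powi K = 1"
      using J by (simp add: power_int_minus)
    show ?thesis
      unfolding eq mat[OF ri] XY.hom_add c
      by (cases "r = i") (simp_all add: X KK pcompose_uminus)
  qed
  \<comment> \<open>A permutation leaves the sum of the indices unchanged, so row and column weights
    cancel in each term of the Leibniz formula.\<close>
  have prod: "(\<Prod>i=0..<N. [:[:J powi (- K - int i + int (\<pi> i)):]:]) = [:[:J powi (- K * int N):]:]"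
    if "\<pi> permutes {0..<N}" for \<pi>
  proof -
    have 1: "(\<Prod>i\<in>I. [:[:g i:]:]) = [:[:\<Prod>i\<in>I. g i:]:]" for I and g :: "nat \<Rightarrow> complex"
      by (induction I rule: infinite_finite_induct) (auto simp: one_pCons)
    have 2: "(\<Prod>i\<in>I. J powi (g i)) = J powi (\<Sum>i\<in>I. g i)" for I and g :: "nat \<Rightarrow> int"
      by (induction I rule: infinite_finite_induct) (use J in \<open>auto simp: power_int_add\<close>)
    have "(\<Sum>i=0..<N. int (\<pi> i)) = (\<Sum>i=0..<N. int i)"
      using sum.permute[OF that, of int] by (simp add: comp_def)
    then show ?thesis
      unfolding 1 2 by (simp add: sum.distrib sum_subtractf mult.commute)
  qed
  have D: "spec_poly N M a b = (\<Sum>\<pi>\<in>{\<pi>. \<pi> permutes {0..<N}}. signof \<pi> *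
      (\<Prod>i=0..<N. C (op_mat N M a b) $$ (i, \<pi> i)))" for a b
    unfolding spec_poly_def char_poly_def C_def by (rule det_def') simp
  have "spec_poly N M a' b' = (\<Sum>\<pi>\<in>{\<pi>. \<pi> permutes {0..<N}}. signof \<pi> *
      (\<Prod>i=0..<N. [:[:J powi (- K - int i + int (\<pi> i)):]:] * scale_XY (J ^ N) (J powi K) (C (op_mat N M a b) $$ (i, \<pi> i))))"
    unfolding D by (intro sum.cong refl arg_cong2[of _ _ _ _ "(*)"] prod.cong C) (auto simp: permutes_in_image)
  also have "\<dots> = (\<Sum>\<pi>\<in>{\<pi>. \<pi> permutes {0..<N}}. [:[:J powi (- K * int N):]:] * scale_XY (J ^ N) (J powi K) (signof \<pi> *
      (\<Prod>i=0..<N. C (op_mat N M a b) $$ (i, \<pi> i))))"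
    by (intro sum.cong refl) (simp add: prod.distrib prod XY.hom_mult XY.hom_prod XY.hom_signof mult_ac del: mult_pCons_left mult_pCons_right)
  also have "\<dots> = [:[:J powi (- K * int N):]:] * scale_XY (J ^ N) (J powi K) (spec_poly N M a b)"
    unfolding D XY.hom_sum sum_distrib_left ..
  finally have "coeff (coeff (spec_poly N M a' b') k) p =
      J powi (- K * int N) * ((J powi K) ^ k * (J ^ N) ^ p) * coeff (coeff (spec_poly N M a b) k) p"
    by (simp add: coeff_scale_XY)
  also have "J powi (- K * int N) * ((J powi K) ^ k * (J ^ N) ^ p) =
      J powi (- K * int N) * J powi (K * int k) * J powi (int N * int p)"
    using J by (simp add: power_int_mult power_int_of_nat)
  also have "\<dots> = J powi (- K * int N + K * int k + int N * int p)"
    by (simp only: power_int_add[OF disjI1[OF J]])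
  also have "- K * int N + K * int k + int N * int p = - (int N * K - int N * int p - K * int k)"
    by (simp add: algebra_simps)
  finally show ?thesis .
qed

section \<open>Taylor expansion of formal solutions\<close>

lemma fps_expansion_mult:
  assumes "f analytic_on {z}" "g analytic_on {z}"
  shows "fps_expansion (\<lambda>x. f x * g x) z = fps_expansion f z * fps_expansion g z"
proof -
  have "(\<lambda>x. f (z + x) * g (z + x)) has_fps_expansion fps_expansion (\<lambda>x. f x * g x) z"
    by (rule analytic_at_imp_has_fps_expansion) (intro analytic_intros assms)
  moreover have "(\<lambda>x. f (z + x) * g (z + x)) has_fps_expansion fps_expansion f z * fps_expansion g z"
    by (intro fps_expansion_intros analytic_at_imp_has_fps_expansion assms)
  ultimately show ?thesis by (rule fps_expansion_unique_complex)
qed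

lemma fps_expansion_add:
  assumes "f analytic_on {z}" "g analytic_on {z}"
  shows "fps_expansion (\<lambda>x. f x + g x) z = fps_expansion f z + fps_expansion g z"
proof -
  have "(\<lambda>x. f (z + x) + g (z + x)) has_fps_expansion fps_expansion (\<lambda>x. f x + g x) z"
    by (rule analytic_at_imp_has_fps_expansion) (intro analytic_intros assms)
  moreover have "(\<lambda>x. f (z + x) + g (z + x)) has_fps_expansion fps_expansion f z + fps_expansion g z"
    by (intro fps_expansion_intros analytic_at_imp_has_fps_expansion assms)
  ultimately show ?thesis by (rule fps_expansion_unique_complex)
qed

lemma fps_expansion_const: "fps_expansion (\<lambda>_. c) z = fps_const c"
  by (rule fps_ext) (simp add: fps_expansion_def)

lemma fps_expansion_sum:
  assumes "finite I" "\<And>i. i \<in> I \<Longrightarrow> f i analytic_on {z}"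
  shows "fps_expansion (\<lambda>x. \<Sum>i\<in>I. f i x) z = (\<Sum>i\<in>I. fps_expansion (f i) z)"
  using assms
  by (induction I rule: finite_induct) (simp_all add: fps_expansion_const fps_expansion_add analytic_on_sum)

lemma fps_expansion_deriv: "fps_expansion (deriv f) z = fps_deriv (fps_expansion f z)"
proof (rule fps_ext)
  fix n
  have "(deriv ^^ n) (deriv f) z = (deriv ^^ Suc n) f z"
    by (simp only: funpow_Suc_right comp_def)
  then show "fps_nth (fps_expansion (deriv f) z) n = fps_nth (fps_deriv (fps_expansion f z)) n"
    by (simp add: fps_expansion_def del: funpow.simps of_nat_Suc)
qed

lemma fps_expansion_cong_on:
  assumes "open D" "z \<in> D" "\<And>x. x \<in> D \<Longrightarrow> f x = g x"
  shows "fps_expansion f z = fps_expansion g z"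
  by (rule fps_expansion_cong) (use assms eventually_nhds in blast)

text \<open>The lower bound is uniform on \<open>D\<close>. Families obtained coefficientwise, by
  derivatives or Taylor coefficients, then have supports bounded below, which is what
  \<open>Abs_fls\<close> needs in order to return the intended coefficients.\<close>

definition fls_hol :: "complex set \<Rightarrow> (complex \<Rightarrow> complex fls) \<Rightarrow> bool" where
  "fls_hol D f \<longleftrightarrow> (\<exists>L. \<forall>z\<in>D. \<forall>s<L. fls_nth (f z) s = 0) \<and> (\<forall>s. (\<lambda>z. fls_nth (f z) s) holomorphic_on D)"

text \<open>Interchanges the two expansions: a family of Laurent series depending on a point becomes
  a power series in the local coordinate with Laurent series as coefficients.\<close>

definition fls_taylor :: "complex \<Rightarrow> (complex \<Rightarrow> complex fls) \<Rightarrow> complex fls fps" where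
  "fls_taylor z f = Abs_fps (\<lambda>n. Abs_fls (\<lambda>s. fps_nth (fps_expansion (\<lambda>x. fls_nth (f x) s) z) n))"

locale fls_hol_domain =
  fixes D :: "complex set" and z0 :: complex
  assumes D: "open D" and z0: "z0 \<in> D"
begin

lemma fls_hol_analytic: "fls_hol D f \<Longrightarrow> z \<in> D \<Longrightarrow> (\<lambda>x. fls_nth (f x) s) analytic_on {z}"
  using D by (auto simp: fls_hol_def analytic_at)

lemma fls_taylor_nth:
  assumes "fls_hol D f"
  shows "fls_nth (fps_nth (fls_taylor z0 f) n) s = fps_nth (fps_expansion (\<lambda>x. fls_nth (f x) s) z0) n"
proof -
  obtain L where L: "\<And>z s. z \<in> D \<Longrightarrow> s < L \<Longrightarrow> fls_nth (f z) s = 0"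
    using assms unfolding fls_hol_def by blast
  have "fps_expansion (\<lambda>x. fls_nth (f x) s) z0 = 0" if "s < L" for s
    using fps_expansion_cong_on[OF D z0, of "\<lambda>x. fls_nth (f x) s" "\<lambda>_. 0"] L that
    by (simp add: fps_expansion_const)
  then show ?thesis
    unfolding fls_taylor_def by (simp add: nth_Abs_fls_lower_bound[where N = L])
qed

text \<open>Below the uniform bound the coefficients vanish identically near \<open>z\<close>, so
  their derivatives vanish as well and \<open>Abs_fls\<close> is applied to a function with support
  bounded below.\<close>

lemma formal_deriv_nth:
  assumes f: "fls_hol D f" and z: "z \<in> D"
  shows "fls_nth (formal_deriv f z) s = deriv (\<lambda>x. fls_nth (f x) s) z + fls_nth (f z) (s + 1)"
proof -
  obtain L where L: "\<And>z s. z \<in> D \<Longrightarrow> s < L \<Longrightarrow> fls_nth (f z) s = 0"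
    using f unfolding fls_hol_def by blast
  have "deriv (\<lambda>x. fls_nth (f x) s) z = 0" if "s < L" for s
  proof -
    have "deriv (\<lambda>x. fls_nth (f x) s) z = deriv (\<lambda>x. 0) z"
      by (rule deriv_cong_ev) (use L that z D in \<open>auto simp: eventually_nhds\<close>)
    then show ?thesis by simp
  qed
  then show ?thesis
    unfolding formal_deriv_def
    by (simp add: nth_Abs_fls_lower_bound[where N = L] fls_X_inv_times_conv_shift)
qed

lemma fls_hol_formal_deriv:
  assumes f: "fls_hol D f"
  shows "fls_hol D (formal_deriv f)"
proof -
  obtain L where L: "\<And>z s. z \<in> D \<Longrightarrow> s < L \<Longrightarrow> fls_nth (f z) s = 0"
    using f unfolding fls_hol_def by blast
  have hol: "(\<lambda>z. fls_nth (f z) s) holomorphic_on D" for s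
    using f by (simp add: fls_hol_def)
  have "fls_nth (formal_deriv f z) s = 0" if "z \<in> D" "s < L - 1" for z s
  proof -
    have "deriv (\<lambda>x. fls_nth (f x) s) z = deriv (\<lambda>x. 0) z"
      by (rule deriv_cong_ev) (use L that D in \<open>auto simp: eventually_nhds\<close>)
    then show ?thesis using L that by (simp add: formal_deriv_nth[OF f])
  qed
  moreover have "(\<lambda>z. fls_nth (formal_deriv f z) s) holomorphic_on D" for s
  proof -
    have "(\<lambda>z. deriv (\<lambda>x. fls_nth (f x) s) z + fls_nth (f z) (s + 1)) holomorphic_on D"
      by (intro holomorphic_intros holomorphic_deriv hol D)
    then show ?thesis
      by (rule holomorphic_transform) (simp add: formal_deriv_nth[OF f])
  qed
  ultimately show ?thesis unfolding fls_hol_def by blast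
qed

lemma fls_taylor_formal_deriv:
  assumes f: "fls_hol D f"
  shows "fls_taylor z0 (formal_deriv f) = twist_deriv (fls_taylor z0 f)"
proof (rule fps_ext, rule fls_eqI)
  fix n s
  have mul: "fls_nth (of_nat k * g) s = of_nat k * fls_nth g s" for k and g :: "complex fls"
    by (induction k) (simp_all add: algebra_simps)
  have "fps_expansion (\<lambda>x. fls_nth (formal_deriv f x) s) z0 =
      fps_expansion (\<lambda>x. deriv (\<lambda>x. fls_nth (f x) s) x + fls_nth (f x) (s + 1)) z0"
    by (rule fps_expansion_cong_on[OF D z0]) (simp add: formal_deriv_nth[OF f])
  also have "\<dots> = fps_expansion (deriv (\<lambda>x. fls_nth (f x) s)) z0 + fps_expansion (\<lambda>x. fls_nth (f x) (s + 1)) z0"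
    by (intro fps_expansion_add analytic_deriv fls_hol_analytic f z0)
  finally show "fls_nth (fps_nth (fls_taylor z0 (formal_deriv f)) n) s =
      fls_nth (fps_nth (twist_deriv (fls_taylor z0 f)) n) s"
    by (simp add: fls_taylor_nth f fls_hol_formal_deriv fps_expansion_deriv twist_deriv_def mul
        fls_X_inv_times_conv_shift del: of_nat_Suc)
qed

lemma
  assumes f: "fls_hol D f"
  shows fls_hol_formal_deriv_funpow: "fls_hol D ((formal_deriv ^^ m) f)"
    and fls_taylor_formal_deriv_funpow: "fls_taylor z0 ((formal_deriv ^^ m) f) = (twist_deriv ^^ m) (fls_taylor z0 f)"
  by (induction m) (simp_all add: f fls_hol_formal_deriv fls_taylor_formal_deriv)

lemma
  assumes f: "fls_hol D f" and c: "c holomorphic_on D"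
  shows fls_hol_scale: "fls_hol D (\<lambda>z. fls_const (c z) * f z)"
    and fls_taylor_scale: "fls_taylor z0 (\<lambda>z. fls_const (c z) * f z) = fls_fps (fps_expansion c z0) * fls_taylor z0 f"
proof -
  have ca: "c analytic_on {z0}" using c D z0 by (auto simp: analytic_at)
  show hol: "fls_hol D (\<lambda>z. fls_const (c z) * f z)"
    using f c unfolding fls_hol_def by (fastforce intro: holomorphic_intros)
  show "fls_taylor z0 (\<lambda>z. fls_const (c z) * f z) = fls_fps (fps_expansion c z0) * fls_taylor z0 f"
    by (intro fps_ext fls_eqI)
       (simp add: fls_taylor_nth[OF hol] fls_taylor_nth[OF f] fps_mult_nth fls_nth_sum fls_fps_def
         fps_expansion_mult[OF ca fls_hol_analytic[OF f z0]])
qed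

lemma
  assumes f: "\<And>i. i \<in> I \<Longrightarrow> fls_hol D (f i)" and I: "finite I"
  shows fls_hol_sum: "fls_hol D (\<lambda>z. \<Sum>i\<in>I. f i z)"
    and fls_taylor_sum: "fls_taylor z0 (\<lambda>z. \<Sum>i\<in>I. f i z) = (\<Sum>i\<in>I. fls_taylor z0 (f i))"
proof -
  obtain L where L: "\<And>i z s. i \<in> I \<Longrightarrow> z \<in> D \<Longrightarrow> s < L i \<Longrightarrow> fls_nth (f i z) s = 0"
    using f unfolding fls_hol_def by metis
  have "\<exists>m. \<forall>i\<in>I. m \<le> L i"
    using I by (induction I rule: finite_induct) (auto, metis le_cases order_trans)
  then obtain m where m: "\<And>i. i \<in> I \<Longrightarrow> m \<le> L i" by blast
  have "\<forall>z\<in>D. \<forall>s<m. fls_nth (\<Sum>i\<in>I. f i z) s = 0"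
    unfolding fls_nth_sum using L m by (auto intro!: sum.neutral) fastforce
  moreover have "(\<lambda>z. fls_nth (f i z) s) holomorphic_on D" if "i \<in> I" for i s
    using f[OF that] by (simp add: fls_hol_def)
  ultimately show hol: "fls_hol D (\<lambda>z. \<Sum>i\<in>I. f i z)"
    unfolding fls_hol_def fls_nth_sum by (auto intro!: holomorphic_on_sum)
  show "fls_taylor z0 (\<lambda>z. \<Sum>i\<in>I. f i z) = (\<Sum>i\<in>I. fls_taylor z0 (f i))"
    by (intro fps_ext fls_eqI)
       (simp add: fls_taylor_nth[OF hol] fls_taylor_nth[OF f] fps_sum_nth fls_nth_sum
         fps_expansion_sum[OF I] fls_hol_analytic[OF f z0])
qed

lemma fls_taylor_formal_op:
  assumes f: "fls_hol D f" and c: "\<And>j. j \<le> M \<Longrightarrow> c j holomorphic_on D"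
  shows "fls_taylor z0 (formal_op M c f) =
      (\<Sum>j\<le>M. fls_fps (fps_expansion (c j) z0) * (twist_deriv ^^ (M - j)) (fls_taylor z0 f))"
proof -
  have "fls_taylor z0 (formal_op M c f) =
      fls_taylor z0 (\<lambda>z. \<Sum>j\<le>M. fls_const (c j z) * (formal_deriv ^^ (M - j)) f z)"
    unfolding formal_op_def ..
  also have "\<dots> = (\<Sum>j\<le>M. fls_taylor z0 (\<lambda>z. fls_const (c j z) * (formal_deriv ^^ (M - j)) f z))"
    by (rule fls_taylor_sum) (auto intro: fls_hol_scale fls_hol_formal_deriv_funpow f c)
  also have "\<dots> = (\<Sum>j\<le>M. fls_fps (fps_expansion (c j) z0) * (twist_deriv ^^ (M - j)) (fls_taylor z0 f))"
    by (intro sum.cong refl)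
       (simp add: fls_taylor_scale[OF fls_hol_formal_deriv_funpow[OF f] c] fls_taylor_formal_deriv_funpow[OF f])
  finally show ?thesis .
qed

text \<open>Here the factor is constant in \<open>z\<close> but a full series in \<lambda>. With the
  uniform bound, each coefficient of the product is a finite sum over a range independent of
  \<open>z\<close>, which can be expanded termwise.\<close>

lemma fls_taylor_const_mult:
  assumes f: "fls_hol D f"
  shows "fls_taylor z0 (\<lambda>z. A * f z) = fps_const A * fls_taylor z0 f"
proof -
  obtain L where L: "\<And>z s. z \<in> D \<Longrightarrow> s < L \<Longrightarrow> fls_nth (f z) s = 0"
    using f unfolding fls_hol_def by blast
  have eq: "fls_nth (A * f z) s = (\<Sum>i=fls_subdegree A..s - L. fls_nth A i * fls_nth (f z) (s - i))"
    if "z \<in> D" for z s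
    by (rule fls_times_nth_bounds) (use L that in auto)
  have "fls_nth (A * f z) s = 0" if "z \<in> D" "s < fls_subdegree A + L" for z s
    unfolding eq[OF that(1)] using that by (intro sum.neutral) auto
  moreover have "(\<lambda>z. fls_nth (A * f z) s) holomorphic_on D" for s
  proof (rule holomorphic_transform)
    show "(\<lambda>z. \<Sum>i=fls_subdegree A..s - L. fls_nth A i * fls_nth (f z) (s - i)) holomorphic_on D"
      using f by (intro holomorphic_intros) (auto simp: fls_hol_def)
  qed (simp add: eq)
  ultimately have hol: "fls_hol D (\<lambda>z. A * f z)" unfolding fls_hol_def by blast
  have low: "fls_nth (fps_nth (fls_taylor z0 f) n) s = 0" if "s < L" for n s
  proof -
    have "fps_expansion (\<lambda>x. fls_nth (f x) s) z0 = fps_expansion (\<lambda>x. 0) z0"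
      by (rule fps_expansion_cong_on[OF D z0]) (use L that in auto)
    then show ?thesis by (simp add: fls_taylor_nth[OF f] fps_expansion_const)
  qed
  show ?thesis
  proof (rule fps_ext, rule fls_eqI)
    fix n s
    have "fps_expansion (\<lambda>x. fls_nth (A * f x) s) z0 =
        fps_expansion (\<lambda>x. \<Sum>i=fls_subdegree A..s - L. fls_nth A i * fls_nth (f x) (s - i)) z0"
      by (rule fps_expansion_cong_on[OF D z0]) (simp add: eq)
    also have "\<dots> = (\<Sum>i=fls_subdegree A..s - L. fps_expansion (\<lambda>x. fls_nth A i * fls_nth (f x) (s - i)) z0)"
      by (intro fps_expansion_sum analytic_intros fls_hol_analytic[OF f z0]) auto
    also have "\<dots> = (\<Sum>i=fls_subdegree A..s - L. fps_const (fls_nth A i) * fps_expansion (\<lambda>x. fls_nth (f x) (s - i)) z0)"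
      by (intro sum.cong refl, subst fps_expansion_mult)
         (auto simp: fps_expansion_const intro: fls_hol_analytic[OF f z0])
    finally have "fls_nth (fps_nth (fls_taylor z0 (\<lambda>z. A * f z)) n) s =
        (\<Sum>i=fls_subdegree A..s - L. fls_nth A i * fls_nth (fps_nth (fls_taylor z0 f) n) (s - i))"
      by (simp add: fls_taylor_nth[OF hol] fls_taylor_nth[OF f] fps_sum_nth)
    also have "\<dots> = fls_nth (A * fps_nth (fls_taylor z0 f) n) s"
      by (rule fls_times_nth_bounds[symmetric]) (use low in auto)
    finally show "fls_nth (fps_nth (fls_taylor z0 (\<lambda>z. A * f z)) n) s =
        fls_nth (fps_nth (fps_const A * fls_taylor z0 f) n) s" by simp
  qed
qed

lemma fls_taylor_cong:
  assumes "\<And>z. z \<in> D \<Longrightarrow> f z = g z"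
  shows "fls_taylor z0 f = fls_taylor z0 g"
proof -
  have "fps_expansion (\<lambda>x. fls_nth (f x) s) z0 = fps_expansion (\<lambda>x. fls_nth (g x) s) z0" for s
    by (rule fps_expansion_cong_on[OF D z0]) (simp add: assms)
  then show ?thesis by (simp add: fls_taylor_def)
qed

text \<open>Both equations are required on all of \<open>D\<close>, because they are compared in
  every Taylor coefficient at \<open>z0\<close> and not only in value.\<close>

lemma spec_poly_formal_solution:
  assumes N: "N \<ge> 1"
    and c: "\<And>j. j \<le> N \<Longrightarrow> c j holomorphic_on D" and c0: "\<And>z. c 0 z = 1"
    and d: "\<And>j. j \<le> M \<Longrightarrow> d j holomorphic_on D"
    and hol: "\<And>s. (\<lambda>z. fps_nth (\<psi> z) s) holomorphic_on D" and one: "\<And>z. z \<in> D \<Longrightarrow> fps_nth (\<psi> z) 0 = 1"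
    and P: "\<And>z. z \<in> D \<Longrightarrow> formal_op N c (\<lambda>z. fps_to_fls (\<psi> z)) z = fls_X_inv ^ N * fps_to_fls (\<psi> z)"
    and Q: "\<And>z. z \<in> D \<Longrightarrow> formal_op M d (\<lambda>z. fps_to_fls (\<psi> z)) z = A * fps_to_fls (\<psi> z)"
  shows "eval_X N (spec_poly N M (\<lambda>j. fps_expansion (c j) z0) (\<lambda>j. fps_expansion (d j) z0)) = spectral_product N A"
proof -
  have \<psi>: "fls_hol D (\<lambda>z. fps_to_fls (\<psi> z))"
  proof -
    have "(\<lambda>z. fls_nth (fps_to_fls (\<psi> z)) s) holomorphic_on D" for s
      using hol by (cases "s < 0") auto
    then show ?thesis unfolding fls_hol_def by (auto intro!: exI[of _ 0])
  qed
  show ?thesis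
  proof (rule spec_poly_eq_spectral_product[OF N, where u = "fls_taylor z0 (\<lambda>z. fps_to_fls (\<psi> z))"])
    have "c 0 = (\<lambda>_. 1)" using c0 by auto
    then show "fps_expansion (c 0) z0 = 1" by (simp add: fps_expansion_const)
    show "(\<Sum>j\<le>N. fls_fps (fps_expansion (c j) z0) * (twist_deriv ^^ (N - j)) (fls_taylor z0 (\<lambda>z. fps_to_fls (\<psi> z)))) =
        fps_const (fls_X_inv ^ N) * fls_taylor z0 (\<lambda>z. fps_to_fls (\<psi> z))"
      by (rule trans[OF fls_taylor_formal_op[OF \<psi> c, symmetric] trans[OF fls_taylor_cong[OF P] fls_taylor_const_mult[OF \<psi>]]])
    show "(\<Sum>j\<le>M. fls_fps (fps_expansion (d j) z0) * (twist_deriv ^^ (M - j)) (fls_taylor z0 (\<lambda>z. fps_to_fls (\<psi> z)))) =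
        fps_const A * fls_taylor z0 (\<lambda>z. fps_to_fls (\<psi> z))"
      by (rule trans[OF fls_taylor_formal_op[OF \<psi> d, symmetric] trans[OF fls_taylor_cong[OF Q] fls_taylor_const_mult[OF \<psi>]]])
    show "fls_nth (fps_nth (fls_taylor z0 (\<lambda>z. fps_to_fls (\<psi> z))) n) s = 0" if "s < 0" for n s
      using that by (simp add: fls_taylor_nth[OF \<psi>] fps_expansion_const)
    have "fps_expansion (\<lambda>x. fps_nth (\<psi> x) 0) z0 = fps_expansion (\<lambda>_. 1) z0"
      by (rule fps_expansion_cong_on[OF D z0]) (rule one)
    then show "fls_nth (fps_nth (fls_taylor z0 (\<lambda>z. fps_to_fls (\<psi> z))) n) 0 = (if n = 0 then 1 else 0)" for n
      by (simp add: fls_taylor_nth[OF \<psi>] fps_expansion_const)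
  qed
qed

end

text \<open>The argument is differentiated and must agree near \<open>z\<close>; the coefficients
  are only evaluated, so agreement at \<open>z\<close> itself is enough for them.\<close>

lemma formal_op_cong:
  assumes D: "open D" "z \<in> D" and f: "\<And>x. x \<in> D \<Longrightarrow> f x = g x" and c: "\<And>j. j \<le> M \<Longrightarrow> c j z = d j z"
  shows "formal_op M c f z = formal_op M d g z"
proof -
  have "(formal_deriv ^^ m) f x = (formal_deriv ^^ m) g x" if "x \<in> D" for m x
    using that
  proof (induction m arbitrary: x)
    case 0
    then show ?case by (simp add: f)
  next
    case (Suc m)
    have "deriv (\<lambda>\<zeta>. fls_nth ((formal_deriv ^^ m) f \<zeta>) s) x = deriv (\<lambda>\<zeta>. fls_nth ((formal_deriv ^^ m) g \<zeta>) s) x" for s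
      by (rule deriv_cong_ev) (use Suc D in \<open>auto simp: eventually_nhds\<close>)
    moreover have "(formal_deriv ^^ m) f x = (formal_deriv ^^ m) g x" using Suc by blast
    ultimately show ?case
      by (simp only: funpow.simps comp_def formal_deriv_def[of "(formal_deriv ^^ m) f"]
          formal_deriv_def[of "(formal_deriv ^^ m) g"])
  qed
  then show ?thesis using D c by (simp add: formal_op_def)
qed

section \<open>Germs along paths\<close>

lemma path_join_linepath:
  assumes "path \<gamma>" "path_image \<gamma> \<subseteq> S" "closed_segment (pathfinish \<gamma>) z \<subseteq> S"
  shows "path (\<gamma> +++ linepath (pathfinish \<gamma>) z)" "path_image (\<gamma> +++ linepath (pathfinish \<gamma>) z) \<subseteq> S"
    "pathfinish (\<gamma> +++ linepath (pathfinish \<gamma>) z) = z"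
  using assms by (auto simp: path_image_join)

text \<open>Inside the convex set \<open>D\<close> a broken line is linearly homotopic to the
  segment with the same ends. Prolonging a path within \<open>D\<close> therefore does not change
  the branch, and conditions stated at end points of paths can be moved to all points of
  \<open>D\<close>.\<close>

lemma germ_join_linepath:
  assumes inv: "\<And>\<gamma> \<delta>. homotopic_paths S \<gamma> \<delta> \<Longrightarrow> f \<gamma> = f \<delta>"
    and \<gamma>: "path \<gamma>" "path_image \<gamma> \<subseteq> S"
    and D: "convex D" "D \<subseteq> S" "pathfinish \<gamma> \<in> D" "z \<in> D" "\<zeta> \<in> D"
  shows "germ f (\<gamma> +++ linepath (pathfinish \<gamma>) z) \<zeta> = germ f \<gamma> \<zeta>"
proof -
  define w where "w = pathfinish \<gamma>"
  have seg: "closed_segment x y \<subseteq> D" if "x \<in> D" "y \<in> D" for x y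
    using D(1) that by (simp add: convex_contains_segment)
  have w: "w \<in> D" using D by (simp add: w_def)
  have lin: "homotopic_paths S (linepath w z +++ linepath z \<zeta>) (linepath w \<zeta>)"
  proof (rule homotopic_paths_linear)
    fix t :: real assume t: "t \<in> {0..1}"
    have "(linepath w z +++ linepath z \<zeta>) t \<in> path_image (linepath w z +++ linepath z \<zeta>)"
      "linepath w \<zeta> t \<in> path_image (linepath w \<zeta>)"
      using t by (auto simp: path_image_def)
    then have "(linepath w z +++ linepath z \<zeta>) t \<in> D" "linepath w \<zeta> t \<in> D"
      using seg w D by (auto simp: path_image_join)
    then show "closed_segment ((linepath w z +++ linepath z \<zeta>) t) (linepath w \<zeta> t) \<subseteq> S"
      using seg D(2) by blast
  qed auto
  have "homotopic_paths S (\<gamma> +++ (linepath w z +++ linepath z \<zeta>)) ((\<gamma> +++ linepath w z) +++ linepath z \<zeta>)"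
    using \<gamma> seg[OF w D(4)] seg[OF D(4) D(5)] D(2) by (intro homotopic_paths_assoc) (auto simp: w_def)
  moreover have "homotopic_paths S (\<gamma> +++ (linepath w z +++ linepath z \<zeta>)) (\<gamma> +++ linepath w \<zeta>)"
    using \<gamma> lin by (intro homotopic_paths_join) (auto simp: w_def)
  ultimately have "f ((\<gamma> +++ linepath w z) +++ linepath z \<zeta>) = f (\<gamma> +++ linepath w \<zeta>)"
    using inv by metis
  then show ?thesis by (simp add: germ_def w_def)
qed

text \<open>Analyticity is postulated only at the end of a path. For another point of
  \<open>D\<close> the path is prolonged by a segment to that point, which gives the same
  germ.\<close>

lemma germ_holomorphic:
  assumes f: "multivalued_analytic S f" and \<gamma>: "path \<gamma>" "path_image \<gamma> \<subseteq> S"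
    and D: "convex D" "open D" "D \<subseteq> S" "pathfinish \<gamma> \<in> D"
  shows "germ f \<gamma> holomorphic_on D"
proof -
  have inv: "\<And>\<gamma> \<delta>. homotopic_paths S \<gamma> \<delta> \<Longrightarrow> f \<gamma> = f \<delta>"
    and an: "\<And>\<gamma>. path \<gamma> \<Longrightarrow> path_image \<gamma> \<subseteq> S \<Longrightarrow> germ f \<gamma> analytic_on {pathfinish \<gamma>}"
    using f by (auto simp: multivalued_analytic_def)
  have "germ f \<gamma> analytic_on {z}" if z: "z \<in> D" for z
  proof -
    have "closed_segment (pathfinish \<gamma>) z \<subseteq> S"
      using D z by (meson convex_contains_segment order_trans)
    note p = path_join_linepath[OF \<gamma> this]
    have "germ f (\<gamma> +++ linepath (pathfinish \<gamma>) z) analytic_on {z}"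
      using an[OF p(1,2)] p(3) by simp
    moreover have "eventually (\<lambda>\<zeta>. \<zeta> \<in> D) (nhds z)"
      using D(2) z by (simp add: eventually_nhds_in_open)
    then have "eventually (\<lambda>\<zeta>. germ f (\<gamma> +++ linepath (pathfinish \<gamma>) z) \<zeta> = germ f \<gamma> \<zeta>) (nhds z)"
      by eventually_elim (rule germ_join_linepath[OF inv \<gamma> D(1,3,4) z])
    ultimately show ?thesis by (simp add: analytic_at_cong)
  qed
  then show ?thesis
    using analytic_imp_holomorphic analytic_on_analytic_at by blast
qed

lemma analytic_at_imp_no_pole_near:
  assumes "f analytic_on {z}"
  shows "eventually (\<lambda>x. \<not> is_pole f x) (nhds z)"
proof -
  obtain S where "open S" "z \<in> S" "f holomorphic_on S"
    using assms unfolding analytic_at by blast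
  then show ?thesis
    using not_is_pole_holomorphic[of S _ f] by (auto simp: eventually_nhds)
qed

lemma open_Compl_pole_set:
  assumes "\<And>l. l \<in> {2..N} \<Longrightarrow> a l \<Omega> analytic_on {z. \<not> is_pole (a l \<Omega>) z}"
  shows "open (- pole_set N a \<Omega>)"
proof (subst open_subopen, intro ballI)
  fix z assume z: "z \<in> - pole_set N a \<Omega>"
  have "eventually (\<lambda>x. \<forall>l\<in>{2..N}. \<not> is_pole (a l \<Omega>) x) (nhds z)"
  proof (intro eventually_ball_finite ballI)
    fix l assume l: "l \<in> {2..N}"
    then have "a l \<Omega> analytic_on {z}"
      using z assms[OF l] by (auto simp: pole_set_def intro: analytic_on_subset)
    then show "eventually (\<lambda>x. \<not> is_pole (a l \<Omega>) x) (nhds z)"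
      by (rule analytic_at_imp_no_pole_near)
  qed simp
  then obtain T where "open T" "z \<in> T" "\<And>x. x \<in> T \<Longrightarrow> \<forall>l\<in>{2..N}. \<not> is_pole (a l \<Omega>) x"
    by (auto simp: eventually_nhds)
  then show "\<exists>T. open T \<and> z \<in> T \<and> T \<subseteq> - pole_set N a \<Omega>"
    by (intro exI[of _ T]) (auto simp: pole_set_def)
qed

lemma P_coeff_holomorphic:
  assumes an: "\<And>l. l \<in> {2..N} \<Longrightarrow> a l \<Omega> analytic_on {z. \<not> is_pole (a l \<Omega>) z}"
    and "D \<subseteq> - pole_set N a \<Omega>" "l \<le> N"
  shows "P_coeff a \<Omega> l holomorphic_on D"
proof (cases "l \<ge> 2")
  case True
  then have "a l \<Omega> holomorphic_on D"
    using assms by (intro analytic_imp_holomorphic analytic_on_subset[OF an]) (auto simp: pole_set_def)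
  moreover have "P_coeff a \<Omega> l = a l \<Omega>"
    using True by (auto simp: P_coeff_def)
  ultimately show ?thesis by simp
next
  case False
  then consider "l = 0" | "l = 1" by linarith
  then show ?thesis by cases (simp_all add: P_coeff_def[abs_def])
qed

text \<open>The equations for \<Psi> hold at the end point of each path, whereas a whole disc is
  needed. They are applied to \<gamma> prolonged by segments to all points of a disc free of poles,
  on which all branches continue those along \<gamma>.\<close>

lemma spec_poly_eq_at:
  assumes N: "N \<ge> 1"
    and an: "\<And>l. l \<in> {2..N} \<Longrightarrow> a l \<Omega> analytic_on {z. \<not> is_pole (a l \<Omega>) z}"
    and b: "\<And>j. j \<le> M \<Longrightarrow> multivalued_analytic (- pole_set N a \<Omega>) (b j \<Omega>)"
    and BA: "baker_akhiezer N a \<xi>" and A: "eigen_series N a \<xi> M b A" and \<Omega>: "\<Omega> \<in> siegel_prod"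
    and \<gamma>: "path \<gamma>" "path_image \<gamma> \<subseteq> - pole_set N a \<Omega>"
  shows "eval_X N (spec_poly N M (\<lambda>l. fps_expansion (P_coeff a \<Omega> l) (pathfinish \<gamma>))
    (\<lambda>j. fps_expansion (germ (b j \<Omega>) \<gamma>) (pathfinish \<gamma>))) = spectral_product N (A \<Omega>)"
proof -
  define S where "S = - pole_set N a \<Omega>"
  have "open S" unfolding S_def by (rule open_Compl_pole_set) (rule an)
  moreover have fin: "pathfinish \<gamma> \<in> S" using \<gamma> by (auto simp: S_def)
  ultimately obtain r where r: "r > 0" "ball (pathfinish \<gamma>) r \<subseteq> S"
    using openE by blast
  define D where "D = ball (pathfinish \<gamma>) r"
  have DS: "open D" "convex D" "pathfinish \<gamma> \<in> D" "D \<subseteq> S"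
    using r by (auto simp: D_def)
  interpret fls_hol_domain D "pathfinish \<gamma>"
    by standard (use DS in auto)
  note \<gamma>S = \<gamma>[folded S_def]
  have \<xi>: "multivalued_analytic S (\<lambda>\<gamma>. fps_nth (\<xi> \<Omega> \<gamma>) s)" for s
    using BA \<Omega> by (simp add: baker_akhiezer_def S_def)
  have inv: "\<xi> \<Omega> \<gamma> = \<xi> \<Omega> \<delta>" if "homotopic_paths S \<gamma> \<delta>" for \<gamma> \<delta>
    by (rule fps_ext) (use \<xi> that in \<open>auto simp: multivalued_analytic_def\<close>)
  have sub: "closed_segment (pathfinish \<gamma>) z \<subseteq> S" if "z \<in> D" for z
    using DS that by (meson convex_contains_segment order_trans)
  have BAz: "BA_series \<xi> \<Omega> (\<gamma> +++ linepath (pathfinish \<gamma>) z) x = fps_to_fls (germ (\<xi> \<Omega>) \<gamma> x)"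
    if "z \<in> D" "x \<in> D" for z x
    by (simp add: BA_series_def germ_join_linepath[OF inv \<gamma>S DS(2,4,3) that])
  have BA\<delta>: "fps_nth (\<xi> \<Omega> \<delta>) 0 = 1"
    "formal_op N (P_coeff a \<Omega>) (BA_series \<xi> \<Omega> \<delta>) (pathfinish \<delta>) = fls_X_inv ^ N * BA_series \<xi> \<Omega> \<delta> (pathfinish \<delta>)"
    "formal_op M (\<lambda>j. germ (b j \<Omega>) \<delta>) (BA_series \<xi> \<Omega> \<delta>) (pathfinish \<delta>) = A \<Omega> * BA_series \<xi> \<Omega> \<delta> (pathfinish \<delta>)"
    if "path \<delta>" "path_image \<delta> \<subseteq> S" for \<delta>
    using BA[unfolded baker_akhiezer_def, THEN bspec, OF \<Omega>, THEN conjunct2, THEN conjunct1, THEN spec, of \<delta>]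
      A[unfolded eigen_series_def, THEN bspec, OF \<Omega>, THEN conjunct2, THEN spec, of \<delta>] that
    by (simp_all add: S_def)
  show ?thesis
  proof (rule spec_poly_formal_solution[OF N, where \<psi> = "germ (\<xi> \<Omega>) \<gamma>"])
    show "P_coeff a \<Omega> l holomorphic_on D" if "l \<le> N" for l
      by (rule P_coeff_holomorphic[of N a \<Omega>]) (use an that DS in \<open>auto simp: S_def\<close>)
    show "P_coeff a \<Omega> 0 z = 1" for z
      by (simp add: P_coeff_def)
    show "germ (b j \<Omega>) \<gamma> holomorphic_on D" if "j \<le> M" for j
      by (rule germ_holomorphic[OF b[OF that, folded S_def] \<gamma>S DS(2,1,4,3)])
    show "(\<lambda>z. fps_nth (germ (\<xi> \<Omega>) \<gamma> z) s) holomorphic_on D" for s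
      using germ_holomorphic[OF \<xi> \<gamma>S DS(2,1,4,3)] by (simp add: germ_def)
    fix z assume z: "z \<in> D"
    note p = path_join_linepath[OF \<gamma>S sub[OF z]]
    note 1 = BA\<delta>(1)[OF p(1,2)] and 2 = BA\<delta>(2)[OF p(1,2), unfolded p(3)] and 3 = BA\<delta>(3)[OF p(1,2), unfolded p(3)]
    from 1 show "fps_nth (germ (\<xi> \<Omega>) \<gamma> z) 0 = 1"
      by (simp add: germ_def)
    have "formal_op N (P_coeff a \<Omega>) (\<lambda>z. fps_to_fls (germ (\<xi> \<Omega>) \<gamma> z)) z =
        formal_op N (P_coeff a \<Omega>) (BA_series \<xi> \<Omega> (\<gamma> +++ linepath (pathfinish \<gamma>) z)) z"
      by (rule formal_op_cong[OF DS(1) z]) (simp_all add: BAz z)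
    then show "formal_op N (P_coeff a \<Omega>) (\<lambda>z. fps_to_fls (germ (\<xi> \<Omega>) \<gamma> z)) z =
        fls_X_inv ^ N * fps_to_fls (germ (\<xi> \<Omega>) \<gamma> z)"
      unfolding 2 by (simp add: BAz z)
    have "formal_op M (\<lambda>j. germ (b j \<Omega>) \<gamma>) (\<lambda>z. fps_to_fls (germ (\<xi> \<Omega>) \<gamma> z)) z =
        formal_op M (\<lambda>j. germ (b j \<Omega>) (\<gamma> +++ linepath (pathfinish \<gamma>) z))
          (BA_series \<xi> \<Omega> (\<gamma> +++ linepath (pathfinish \<gamma>) z)) z"
    proof (rule formal_op_cong[OF DS(1) z])
      fix j assume "j \<le> M"
      then have "multivalued_analytic S (b j \<Omega>)" using b by (simp add: S_def)
      then show "germ (b j \<Omega>) \<gamma> z = germ (b j \<Omega>) (\<gamma> +++ linepath (pathfinish \<gamma>) z) z"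
        by (intro germ_join_linepath[OF _ \<gamma>S DS(2,4,3) z z, symmetric]) (auto simp: multivalued_analytic_def)
    qed (simp add: BAz z)
    then show "formal_op M (\<lambda>j. germ (b j \<Omega>) \<gamma>) (\<lambda>z. fps_to_fls (germ (\<xi> \<Omega>) \<gamma> z)) z =
        A \<Omega> * fps_to_fls (germ (\<xi> \<Omega>) \<gamma> z)"
      unfolding 3 by (simp add: BAz z)
  qed
qed

section \<open>The action on the product of Siegel upper half spaces\<close>

text \<open>Bilinear, without conjugation. The same symplectic identity then yields the symmetry of
  the transformed matrix, and, with conjugated second arguments, the positivity of its imaginary
  part.\<close>

definition dotc :: "complex^'n \<Rightarrow> complex^'n \<Rightarrow> complex" where
  "dotc x y = (\<Sum>i\<in>UNIV. x $ i * y $ i)"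

definition cnjv :: "complex^'n \<Rightarrow> complex^'n" where
  "cnjv x = (\<chi> i. cnj (x $ i))"

definition joinv :: "complex^'n \<Rightarrow> complex^'n \<Rightarrow> complex^('n + 'n)" where
  "joinv p x = (\<chi> s. case s of Inl i \<Rightarrow> p $ i | Inr i \<Rightarrow> x $ i)"

lemma sum_UNIV_Plus: "(\<Sum>s\<in>(UNIV :: ('n::finite + 'n) set). f s) = (\<Sum>i\<in>UNIV. f (Inl i)) + (\<Sum>i\<in>UNIV. f (Inr i))"
  unfolding UNIV_Plus_UNIV[symmetric] by (subst sum.Plus) auto

lemma dotc_matrix_vector: "dotc (M *v x) y = dotc x (Finite_Cartesian_Product.transpose M *v y)"
proof -
  have "dotc (M *v x) y = (\<Sum>i\<in>UNIV. \<Sum>k\<in>UNIV. M $ i $ k * x $ k * y $ i)"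
    by (simp add: dotc_def matrix_vector_mult_def sum_distrib_right)
  also have "\<dots> = (\<Sum>k\<in>UNIV. \<Sum>i\<in>UNIV. M $ i $ k * x $ k * y $ i)"
    by (rule sum.swap)
  also have "\<dots> = dotc x (Finite_Cartesian_Product.transpose M *v y)"
    by (simp add: dotc_def matrix_vector_mult_def sum_distrib_left Finite_Cartesian_Product.transpose_def mult_ac)
  finally show ?thesis .
qed

lemma dotc_commute: "dotc x y = dotc y x"
  by (simp add: dotc_def mult.commute)

lemma dotc_zero [simp]: "dotc 0 x = 0" "dotc x 0 = 0"
  by (simp_all add: dotc_def)

lemma dotc_joinv: "dotc (joinv p x) (joinv q y) = dotc p q + dotc x y"
  by (simp add: dotc_def joinv_def sum_UNIV_Plus)

lemma dotc_J: "dotc (joinv p x) (J_mat *v joinv q y) = dotc x q - dotc p y"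
proof -
  have "J_mat *v joinv q y = joinv (- y) q"
    unfolding vec_eq_iff
  proof
    fix s :: "'a + 'a"
    show "(J_mat *v joinv q y) $ s = joinv (- y) q $ s"
      by (cases s) (simp_all add: matrix_vector_mult_def J_mat_def joinv_def sum_UNIV_Plus
          if_distrib[of "\<lambda>c. c * _"] cong: if_cong)
  qed
  then show ?thesis
    by (simp add: dotc_joinv) (simp add: dotc_def sum_negf)
qed

lemma totally_real_embeddingsD:
  assumes "totally_real_embeddings \<phi>"
  shows "\<phi> \<nu> 1 = 1" "\<phi> \<nu> (x + y) = \<phi> \<nu> x + \<phi> \<nu> y" "\<phi> \<nu> (x * y) = \<phi> \<nu> x * \<phi> \<nu> y"
    "\<phi> \<nu> 0 = 0" "\<phi> \<nu> (- x) = - \<phi> \<nu> x" "\<phi> \<nu> (sum f I) = (\<Sum>i\<in>I. \<phi> \<nu> (f i))"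
proof -
  show 1: "\<phi> \<nu> 1 = 1" and add: "\<phi> \<nu> (x + y) = \<phi> \<nu> x + \<phi> \<nu> y" and "\<phi> \<nu> (x * y) = \<phi> \<nu> x * \<phi> \<nu> y" for x y
    using assms by (simp_all add: totally_real_embeddings_def)
  show 0: "\<phi> \<nu> 0 = 0" using add[of 0 0] by simp
  show "\<phi> \<nu> (- x) = - \<phi> \<nu> x" using add[of x "- x"] 0 by simp
  show "\<phi> \<nu> (sum f I) = (\<Sum>i\<in>I. \<phi> \<nu> (f i))"
    by (induction I rule: infinite_finite_induct) (simp_all add: 0 add)
qed

definition embed_mat :: "('f \<Rightarrow> real) \<Rightarrow> 'f^('n::finite + 'n)^('n + 'n) \<Rightarrow> complex^('n + 'n)^('n + 'n)" where
  "embed_mat h \<alpha> = (\<chi> p q. complex_of_real (h (\<alpha> $ p $ q)))"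

lemma embed_mat_joinv:
  "embed_mat (\<phi> \<nu>) \<alpha> *v joinv p x =
    joinv (block \<phi> \<nu> Inl Inl \<alpha> *v p + block \<phi> \<nu> Inl Inr \<alpha> *v x) (block \<phi> \<nu> Inr Inl \<alpha> *v p + block \<phi> \<nu> Inr Inr \<alpha> *v x)"
  unfolding vec_eq_iff
proof
  fix s
  show "(embed_mat (\<phi> \<nu>) \<alpha> *v joinv p x) $ s =
    joinv (block \<phi> \<nu> Inl Inl \<alpha> *v p + block \<phi> \<nu> Inl Inr \<alpha> *v x) (block \<phi> \<nu> Inr Inl \<alpha> *v p + block \<phi> \<nu> Inr Inr \<alpha> *v x) $ s"
    by (cases s) (simp_all add: embed_mat_def joinv_def block_def matrix_vector_mult_def sum_UNIV_Plus)
qed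

lemma embed_mat_symplectic:
  fixes \<alpha> :: "'f::field_char_0^('n::finite + 'n)^('n + 'n)"
  assumes \<phi>: "totally_real_embeddings \<phi>" and \<alpha>: "\<alpha> \<in> Sp UNIV"
  shows "Finite_Cartesian_Product.transpose (embed_mat (\<phi> \<nu>) \<alpha>) ** J_mat ** embed_mat (\<phi> \<nu>) \<alpha> = J_mat"
proof -
  note hom = totally_real_embeddingsD[OF \<phi>, of \<nu>]
  have J: "complex_of_real (\<phi> \<nu> (J_mat $ p $ q)) = J_mat $ p $ q" for p q :: "'n + 'n"
    by (auto simp: J_mat_def hom split: sum.split)
  have "Finite_Cartesian_Product.transpose \<alpha> ** J_mat ** \<alpha> = J_mat"
    using \<alpha> by (simp add: Sp_def)
  then have "(\<Sum>k\<in>UNIV. (\<Sum>l\<in>UNIV. \<alpha> $ l $ p * J_mat $ l $ k) * \<alpha> $ k $ q) = J_mat $ p $ q" for p q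
    by (simp add: vec_eq_iff matrix_matrix_mult_def Finite_Cartesian_Product.transpose_def)
  then have "complex_of_real (\<phi> \<nu> (\<Sum>k\<in>UNIV. (\<Sum>l\<in>UNIV. \<alpha> $ l $ p * J_mat $ l $ k) * \<alpha> $ k $ q)) = J_mat $ p $ q" for p q
    by (simp add: J)
  then show ?thesis
    by (simp add: vec_eq_iff matrix_matrix_mult_def Finite_Cartesian_Product.transpose_def embed_mat_def hom J)
qed

text \<open>Invariance of the alternating form of \<open>J_mat\<close> under the embedded matrix,
  evaluated on vectors split into two halves.\<close>

lemma symplectic_form:
  fixes \<phi> :: "'g::finite \<Rightarrow> 'f::field_char_0 \<Rightarrow> real" and \<alpha> :: "'f^('n::finite + 'n)^('n + 'n)" and \<nu> :: 'g
  assumes \<phi>: "totally_real_embeddings \<phi>" and \<alpha>: "\<alpha> \<in> Sp UNIV"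
  defines "T s t \<equiv> (\<lambda>v. block \<phi> \<nu> s t \<alpha> *v v)"
  shows "dotc (T Inl Inl p + T Inl Inr x) (T Inr Inl q + T Inr Inr y) -
      dotc (T Inr Inl p + T Inr Inr x) (T Inl Inl q + T Inl Inr y) = dotc p y - dotc x q"
proof -
  define E where "E = embed_mat (\<phi> \<nu>) \<alpha>"
  have "dotc (E *v joinv p x) (J_mat *v (E *v joinv q y)) = dotc (joinv p x) (J_mat *v joinv q y)"
    unfolding dotc_matrix_vector matrix_vector_mul_assoc
    using embed_mat_symplectic[OF \<phi> \<alpha>, of \<nu>] by (simp add: E_def matrix_mul_assoc)
  then show ?thesis
    unfolding E_def embed_mat_joinv dotc_J T_def by (simp add: algebra_simps)
qed

text \<open>Split \<open>x\<close> into real and imaginary parts. The real part of \<open>Z\<close>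
  contributes two sums that cancel by symmetry, and the imaginary part contributes its quadratic
  form on both halves, at least one of which is nonzero.\<close>

lemma siegel_form_pos:
  assumes Z: "Z \<in> siegel" and x: "x \<noteq> 0"
  shows "Im (dotc (Z *v x) (cnjv x)) > 0"
proof -
  define Y where "Y = (\<chi> i k. Im (Z $ i $ k))"
  define u v where "u = (\<chi> i. Re (x $ i))" and "v = (\<chi> i. Im (x $ i))"
  have sym: "Z $ i $ k = Z $ k $ i" for i k
  proof -
    have "Finite_Cartesian_Product.transpose Z $ i $ k = Z $ i $ k" using Z by (simp add: siegel_def)
    then show ?thesis by (simp add: Finite_Cartesian_Product.transpose_def)
  qed
  have pos: "w \<bullet> (Y *v w) > 0" if "w \<noteq> 0" for w
    using Z that unfolding siegel_def Y_def by blast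
  have pt: "Im (Z $ i $ k * x $ k * cnj (x $ i)) = Y $ i $ k * (u $ i * u $ k + v $ i * v $ k) +
      (Re (Z $ i $ k) * (v $ k * u $ i) - Re (Z $ i $ k) * (u $ k * v $ i))" for i k
  proof -
    have "Im (z * p * cnj q) = Im z * (Re q * Re p + Im q * Im p) + (Re z * (Im p * Re q) - Re z * (Re p * Im q))" for z p q
      by (simp add: algebra_simps)
    then show ?thesis by (simp add: Y_def u_def v_def)
  qed
  have "Im (dotc (Z *v x) (cnjv x)) = (\<Sum>i\<in>UNIV. \<Sum>k\<in>UNIV. Im (Z $ i $ k * x $ k * cnj (x $ i)))"
    by (simp add: dotc_def matrix_vector_mult_def cnjv_def sum_distrib_right)
  also have "\<dots> = (\<Sum>i\<in>UNIV. \<Sum>k\<in>UNIV. Y $ i $ k * (u $ i * u $ k + v $ i * v $ k)) +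
      ((\<Sum>i\<in>UNIV. \<Sum>k\<in>UNIV. Re (Z $ i $ k) * (v $ k * u $ i)) - (\<Sum>i\<in>UNIV. \<Sum>k\<in>UNIV. Re (Z $ i $ k) * (u $ k * v $ i)))"
    by (simp only: pt sum.distrib sum_subtractf)
  also have "(\<Sum>i\<in>UNIV. \<Sum>k\<in>UNIV. Re (Z $ i $ k) * (u $ k * v $ i)) = (\<Sum>i\<in>UNIV. \<Sum>k\<in>UNIV. Re (Z $ i $ k) * (v $ k * u $ i))"
    by (subst sum.swap) (simp add: sym mult_ac)
  also have "(\<Sum>i\<in>UNIV. \<Sum>k\<in>UNIV. Y $ i $ k * (u $ i * u $ k + v $ i * v $ k)) = u \<bullet> (Y *v u) + v \<bullet> (Y *v v)"
    by (simp add: inner_vec_def matrix_vector_mult_def sum_distrib_left sum.distrib[symmetric] algebra_simps)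
  finally have eq: "Im (dotc (Z *v x) (cnjv x)) = u \<bullet> (Y *v u) + v \<bullet> (Y *v v)" by simp
  have "u \<noteq> 0 \<or> v \<noteq> 0"
    using x by (auto simp: vec_eq_iff u_def v_def complex_eq_iff)
  moreover have "w \<bullet> (Y *v w) \<ge> 0" for w
    using pos[of w] by (cases "w = 0") auto
  ultimately show ?thesis
    unfolding eq using pos[of u] pos[of v] by (metis add_nonneg_pos add_pos_nonneg)
qed

section \<open>Nonvanishing of the automorphy factor and stability of the half spaces\<close>

context
  fixes \<phi> :: "'g::finite \<Rightarrow> 'f::field_char_0 \<Rightarrow> real" and \<alpha> :: "'f^('n::finite + 'n)^('n + 'n)" and \<Omega> :: "complex^'n^'n^'g"
  assumes \<phi>: "totally_real_embeddings \<phi>" and \<alpha>: "\<alpha> \<in> Sp UNIV" and \<Omega>: "\<Omega> \<in> siegel_prod"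
begin

definition numer where
  "numer \<nu> = block \<phi> \<nu> Inl Inl \<alpha> ** \<Omega> $ \<nu> + block \<phi> \<nu> Inl Inr \<alpha>"

lemma siegel_comp: "\<Omega> $ \<nu> \<in> siegel"
  using \<Omega> by (simp add: siegel_prod_def)

lemma siegel_comp_sym: "dotc (\<Omega> $ \<nu> *v x) y = dotc x (\<Omega> $ \<nu> *v y)"
  using siegel_comp[of \<nu>] by (simp add: dotc_matrix_vector siegel_def)

text \<open>On the graph of \<Omega>, that is, for the pairs formed by the image of a vector and the
  vector itself, the symplectic form vanishes because \<Omega> is symmetric; its invariance gives
  the claim.\<close>

lemma denom_numer_sym:
  "dotc (numer \<nu> *v x) (denom \<phi> \<alpha> \<Omega> \<nu> *v y) = dotc (denom \<phi> \<alpha> \<Omega> \<nu> *v x) (numer \<nu> *v y)"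
  using symplectic_form[OF \<phi> \<alpha>, of \<nu> "\<Omega> $ \<nu> *v x" x "\<Omega> $ \<nu> *v y" y]
  by (simp add: numer_def denom_def matrix_vector_mult_add_rdistrib matrix_vector_mul_assoc siegel_comp_sym)

lemma block_cnjv: "cnjv (block \<phi> \<nu> s t \<alpha> *v x) = block \<phi> \<nu> s t \<alpha> *v cnjv x"
  by (simp add: vec_eq_iff cnjv_def matrix_vector_mult_def block_def)

lemma cnjv_add: "cnjv (x + y) = cnjv x + cnjv y"
  by (simp add: vec_eq_iff cnjv_def)

text \<open>The symplectic identity with the second pair conjugated. The embedded blocks are real,
  so conjugation passes through them, and both sides become a number minus its conjugate.\<close>

lemma denom_numer_form:
  "Im (dotc (numer \<nu> *v x) (cnjv (denom \<phi> \<alpha> \<Omega> \<nu> *v x))) = Im (dotc (\<Omega> $ \<nu> *v x) (cnjv x))"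
proof -
  have eq: "dotc (numer \<nu> *v x) (cnjv (denom \<phi> \<alpha> \<Omega> \<nu> *v x)) - dotc (denom \<phi> \<alpha> \<Omega> \<nu> *v x) (cnjv (numer \<nu> *v x)) =
      dotc (\<Omega> $ \<nu> *v x) (cnjv x) - dotc x (cnjv (\<Omega> $ \<nu> *v x))"
    using symplectic_form[OF \<phi> \<alpha>, of \<nu> "\<Omega> $ \<nu> *v x" x "cnjv (\<Omega> $ \<nu> *v x)" "cnjv x"]
    by (simp add: numer_def denom_def matrix_vector_mult_add_rdistrib matrix_vector_mul_assoc[symmetric] cnjv_add block_cnjv)
  have c: "dotc x (cnjv y) = cnj (dotc y (cnjv x))" for x y :: "complex^'n"
    by (simp add: dotc_def cnjv_def mult.commute)
  from eq have "dotc (numer \<nu> *v x) (cnjv (denom \<phi> \<alpha> \<Omega> \<nu> *v x)) - cnj (dotc (numer \<nu> *v x) (cnjv (denom \<phi> \<alpha> \<Omega> \<nu> *v x))) =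
      dotc (\<Omega> $ \<nu> *v x) (cnjv x) - cnj (dotc (\<Omega> $ \<nu> *v x) (cnjv x))"
    unfolding c[of "denom \<phi> \<alpha> \<Omega> \<nu> *v x"] c[of x] .
  then show ?thesis by (simp add: complex_eq_iff)
qed

text \<open>On a nonzero kernel vector the positive form of \<Omega> would equal a pairing with
  zero.\<close>

lemma denom_invertible: "invertible (denom \<phi> \<alpha> \<Omega> \<nu>)"
proof -
  have "x = 0" if "denom \<phi> \<alpha> \<Omega> \<nu> *v x = 0" for x
  proof (rule ccontr)
    assume "x \<noteq> 0"
    then have "Im (dotc (\<Omega> $ \<nu> *v x) (cnjv x)) > 0" by (rule siegel_form_pos[OF siegel_comp])
    then have "Im (dotc (numer \<nu> *v x) (cnjv (denom \<phi> \<alpha> \<Omega> \<nu> *v x))) > 0" by (simp only: denom_numer_form)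
    moreover have "cnjv 0 = (0 :: complex^'n)" by (simp add: vec_eq_iff cnjv_def)
    ultimately show False using that by simp
  qed
  then show ?thesis
    using matrix_left_invertible_ker[of "denom \<phi> \<alpha> \<Omega> \<nu>"] invertible_left_inverse by blast
qed

lemma jfac_nonzero: "jfac \<phi> \<alpha> \<Omega> \<noteq> 0"
  using denom_invertible by (simp add: jfac_def invertible_det_nz)

text \<open>Substituting vectors of the form \<open>matrix_inv V *v x\<close> in the two preceding
  identities turns them into symmetry and positivity for the quotient of numerator and
  denominator.\<close>

lemma act_siegel_prod: "act \<phi> \<alpha> \<Omega> \<in> siegel_prod"
proof -
  have "act \<phi> \<alpha> \<Omega> $ \<nu> \<in> siegel" for \<nu>
  proof -
    define V where "V = denom \<phi> \<alpha> \<Omega> \<nu>"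
    define W where "W = numer \<nu> ** matrix_inv V"
    have W: "act \<phi> \<alpha> \<Omega> $ \<nu> = W"
      by (simp add: act_def W_def V_def numer_def)
    have inv: "V ** matrix_inv V = mat 1"
      using someI_ex[OF denom_invertible[of \<nu>, unfolded invertible_def]]
      by (simp add: V_def matrix_inv_def)
    then have Vinv: "V *v (matrix_inv V *v x) = x" for x
      by (simp add: matrix_vector_mul_assoc)
    have Wv: "W *v x = numer \<nu> *v (matrix_inv V *v x)" for x
      by (simp add: W_def matrix_vector_mul_assoc)
    have sym: "dotc (W *v x) y = dotc x (W *v y)" for x y
      using denom_numer_sym[of \<nu> "matrix_inv V *v x" "matrix_inv V *v y"]
      by (simp add: Wv Vinv flip: V_def)
    have ax: "dotc (M *v axis k 1) (axis i 1) = M $ i $ k" for M :: "complex^'n^'n" and i k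
      by (simp add: dotc_def axis_def matrix_vector_mult_def if_distrib[of "\<lambda>c. _ * c"] cong: if_cong)
    have "W $ i $ k = W $ k $ i" for i k
      using sym[of "axis k 1" "axis i 1"] ax[of W k i] ax[of W i k] by (simp add: dotc_commute)
    then have tr: "Finite_Cartesian_Product.transpose W = W"
      by (simp add: vec_eq_iff Finite_Cartesian_Product.transpose_def)
    have "0 < y \<bullet> ((\<chi> i k. Im (W $ i $ k)) *v y)" if y: "y \<noteq> 0" for y :: "real^'n"
    proof -
      define yc where "yc = (\<chi> i. complex_of_real (y $ i))"
      have "yc \<noteq> 0" using y by (auto simp: yc_def vec_eq_iff)
      moreover have V0: "V *v 0 = 0" by simp
      ultimately have "matrix_inv V *v yc \<noteq> 0" using Vinv[of yc] by metis
      then have "0 < Im (dotc (\<Omega> $ \<nu> *v (matrix_inv V *v yc)) (cnjv (matrix_inv V *v yc)))"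
        by (rule siegel_form_pos[OF siegel_comp])
      also have "\<dots> = Im (dotc (W *v yc) (cnjv yc))"
        using denom_numer_form[of \<nu> "matrix_inv V *v yc"] by (simp add: Wv Vinv flip: V_def)
      also have "\<dots> = y \<bullet> ((\<chi> i k. Im (W $ i $ k)) *v y)"
        by (simp add: dotc_def cnjv_def yc_def matrix_vector_mult_def inner_vec_def sum_distrib_left
            sum_distrib_right mult_ac)
      finally show ?thesis .
    qed
    with tr show ?thesis by (simp add: W siegel_def)
  qed
  then show ?thesis by (simp add: siegel_prod_def)
qed

end

section \<open>Families of meromorphic functions\<close>

text \<open>If every closure had empty interior, the complements of the closures would be dense open
  sets, and by Baire some point of \<open>D\<close> would lie in all of them and satisfy no
  \<open>Q k\<close>. Only density in a ball results, as the sets need not be closed.\<close>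

lemma Baire_increasing_sets:
  fixes D :: "complex set" and Q :: "nat \<Rightarrow> complex \<Rightarrow> bool"
  assumes "open D" "D \<noteq> {}" and Q: "\<And>z. z \<in> D \<Longrightarrow> \<exists>k. Q k z"
  obtains k z r where "r > 0" "ball z r \<subseteq> D" "ball z r \<subseteq> closure {z \<in> D. Q k z}"
proof -
  define Z where "Z k = {z \<in> D. Q k z}" for k
  have "\<exists>k. interior (closure (Z k)) \<noteq> {}"
  proof (rule ccontr)
    assume "\<not> ?thesis"
    then have "closure (- closure (Z k)) = UNIV" for k
      by (simp add: closure_complement)
    then have "(UNIV :: complex set) \<subseteq> closure (\<Inter>(range (\<lambda>k. - closure (Z k))))"
      by (intro Baire) auto
    then have "D \<inter> \<Inter>(range (\<lambda>k. - closure (Z k))) \<noteq> {}"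
      using assms(1,2) open_Int_closure_eq_empty[of D "\<Inter>(range (\<lambda>k. - closure (Z k)))"] by auto
    then obtain z where z: "z \<in> D" "\<And>k. z \<notin> closure (Z k)" by auto
    moreover obtain k where "Q k z" using Q z by blast
    ultimately show False
      using closure_subset[of "Z k"] by (auto simp: Z_def)
  qed
  then obtain k p where p: "p \<in> interior (closure (Z k))" by auto
  \<comment> \<open>The interior meets \<open>Z k\<close> itself and hence \<open>D\<close>, so that
    the ball can be chosen inside \<open>D\<close>.\<close>
  then have "interior (closure (Z k)) \<inter> Z k \<noteq> {}"
    using open_Int_closure_eq_empty[of "interior (closure (Z k))" "Z k"] interior_subset by auto
  then obtain z where "z \<in> interior (closure (Z k)) \<inter> D" by (auto simp: Z_def)
  then obtain r where "r > 0" "ball z r \<subseteq> interior (closure (Z k)) \<inter> D"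
    using openE[OF open_Int[OF open_interior assms(1)]] by metis
  then show ?thesis
    using that[of r z k] interior_subset[of "closure (Z k)"] unfolding Z_def by blast
qed

text \<open>The bound is available only where the whole family is free of poles. Near
  \<open>p\<close> this holds off \<open>p\<close>, since poles are isolated, and a dense set meets
  every small open set there. A pole at \<open>p\<close>, or a value exceeding the bound, would
  persist on such a set.\<close>

lemma meromorphic_bounded_on_dense:
  assumes L: "finite L" and mero: "\<And>l. l \<in> L \<Longrightarrow> f l meromorphic_on W"
    and an: "\<And>l. l \<in> L \<Longrightarrow> f l analytic_on {z \<in> W. \<not> is_pole (f l) z}"
    and W: "open W" "W \<subseteq> closure Z"
    and bd: "\<And>z l. z \<in> Z \<Longrightarrow> \<forall>l\<in>L. \<not> is_pole (f l) z \<Longrightarrow> l \<in> L \<Longrightarrow> norm (f l z) \<le> B"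
    and p: "p \<in> W" and l: "l \<in> L"
  shows "\<not> is_pole (f l) p" "norm (f l p) \<le> B"
proof -
  have meet: "\<exists>z\<in>Z. z \<in> V" if "open V" "V \<noteq> {}" "V \<subseteq> W" for V
    using that W open_Int_closure_eq_empty[of V Z] by auto
  have ev: "eventually (\<lambda>z. \<forall>l\<in>L. \<not> is_pole (f l) z) (at p)"
  proof (intro eventually_ball_finite[OF L] ballI)
    fix l assume "l \<in> L"
    then have "f l meromorphic_on {p}" using mero p by (auto intro: meromorphic_on_subset)
    then have "isolated_singularity_at (f l) p" by (rule meromorphic_on_isolated_singularity)
    then obtain r where r: "r > 0" "f l analytic_on ball p r - {p}"
      by (auto simp: isolated_singularity_at_def)
    have "\<not> is_pole (f l) z" if "z \<noteq> p" "dist z p < r" for z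
      by (rule not_is_pole_holomorphic[OF _ _ analytic_imp_holomorphic[OF r(2)]])
        (use that in \<open>auto simp: dist_commute\<close>)
    then show "eventually (\<lambda>z. \<not> is_pole (f l) z) (at p)"
      using r(1) by (auto simp: eventually_at)
  qed
  have np: "\<not> is_pole (f l) p" if l: "l \<in> L" for l
  proof
    assume pole: "is_pole (f l) p"
    \<comment> \<open>Convergence to infinity is stated for positive bounds, hence the case
      distinction: \<open>B\<close> may be negative.\<close>
    have "eventually (\<lambda>z. norm (f l z) \<ge> B + 1) (at p)"
      using pole unfolding is_pole_def filterlim_at_infinity[OF order.refl[of "0::real"]]
      by (cases "B + 1 > 0") (auto intro: always_eventually order.trans[OF _ norm_ge_zero] simp: not_less)
    with ev have "eventually (\<lambda>z. (\<forall>l\<in>L. \<not> is_pole (f l) z) \<and> norm (f l z) \<ge> B + 1) (at p)"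
      by eventually_elim auto
    then obtain e where e: "e > 0" "\<And>z. z \<noteq> p \<Longrightarrow> dist z p < e \<Longrightarrow> \<forall>l\<in>L. \<not> is_pole (f l) z"
      "\<And>z. z \<noteq> p \<Longrightarrow> dist z p < e \<Longrightarrow> norm (f l z) \<ge> B + 1"
      by (auto simp: eventually_at)
    obtain d where d: "d > 0" "ball p d \<subseteq> W" using W(1) p openE by blast
    define V where "V = ball p (min e d) - {p}"
    have "V \<noteq> {}"
    proof -
      have "p + of_real (min e d / 2) \<in> V"
        using e d by (auto simp: V_def dist_norm)
      then show ?thesis by blast
    qed
    moreover have "open V" unfolding V_def by (intro open_Diff) auto
    moreover have "V \<subseteq> W" using d by (auto simp: V_def)
    ultimately obtain z where z: "z \<in> Z" "z \<in> V" using meet by blast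
    then have z': "z \<noteq> p" "dist z p < e" by (auto simp: V_def dist_commute)
    show False using bd[OF z(1) e(2)[OF z'] l] e(3)[OF z'] by simp
  qed
  with l show "\<not> is_pole (f l) p" by blast
  show "norm (f l p) \<le> B"
  proof (rule ccontr)
    assume nb: "\<not> norm (f l p) \<le> B"
    have "f l analytic_on {p}" using an[OF l] np[OF l] p by (auto intro: analytic_on_subset)
    then have "isCont (f l) p" by (rule analytic_at_imp_isCont)
    then have "eventually (\<lambda>z. norm (f l z) > B) (at p)"
      using nb by (intro order_tendstoD(1)[OF tendsto_norm]) (auto simp: isCont_def)
    with ev have "eventually (\<lambda>z. (\<forall>l\<in>L. \<not> is_pole (f l) z) \<and> norm (f l z) > B) (at p)"
      by eventually_elim auto
    with np nb have "eventually (\<lambda>z. (\<forall>l\<in>L. \<not> is_pole (f l) z) \<and> norm (f l z) > B) (nhds p)"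
      by (auto simp: eventually_nhds_conv_at)
    then obtain S where S: "open S" "p \<in> S" "\<And>z. z \<in> S \<Longrightarrow> (\<forall>l\<in>L. \<not> is_pole (f l) z) \<and> norm (f l z) > B"
      unfolding eventually_nhds by blast
    then obtain z where "z \<in> Z" "z \<in> S" using meet[of "S \<inter> W"] W(1) p by auto
    then show False using S(3) bd[of z l] l by force
  qed
qed

text \<open>By Cauchy's estimate coefficient \<open>i\<close> is at most
  \<open>B / \<rho> ^ i\<close>. The remainder is then dominated by a geometric series with ratio at
  most \<open>1/2\<close>, which is the origin of the factor 2. The bound depends on
  \<open>f\<close> only through \<open>B\<close>, so it is uniform over a bounded family.\<close>

lemma norm_Taylor_remainder_le:
  assumes hol: "f holomorphic_on ball z r" and bd: "\<And>x. x \<in> ball z r \<Longrightarrow> norm (f x) \<le> B"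
    and \<rho>: "0 < \<rho>" "\<rho> < r" and h: "h \<noteq> 0" "norm h \<le> \<rho> / 2"
  defines "c \<equiv> \<lambda>i. fps_nth (fps_expansion f z) i"
  shows "norm ((f (z + h) - (\<Sum>i<n. c i * h ^ i)) / h ^ n - c n) \<le> 2 * B / \<rho> ^ (n + 1) * norm h"
proof -
  have B: "B \<ge> 0" using bd[of z] \<rho> norm_ge_zero[of "f z"] by (metis centre_in_ball less_trans order_trans)
  have c: "norm (c i) \<le> B / \<rho> ^ i" for i
  proof -
    have "norm ((deriv ^^ i) f z) \<le> fact i * B / \<rho> ^ i"
    proof (rule Cauchy_inequality)
      show "f holomorphic_on ball z \<rho>" using hol \<rho> by (auto intro: holomorphic_on_subset)
      show "continuous_on (cball z \<rho>) f"
        using hol \<rho> by (intro holomorphic_on_imp_continuous_on) (auto intro: holomorphic_on_subset)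
    qed (use \<rho> bd in \<open>auto simp: dist_norm\<close>)
    then show ?thesis by (simp add: c_def fps_expansion_def norm_divide field_simps)
  qed
  have sums: "(\<lambda>i. c i * h ^ i) sums f (z + h)"
    using holomorphic_power_series[OF hol, of "z + h"] h \<rho> by (simp add: c_def fps_expansion_def dist_norm)
  have "(\<lambda>i. c (i + Suc n) * h ^ (i + Suc n)) sums (f (z + h) - (\<Sum>i<Suc n. c i * h ^ i))"
    using sums_split_initial_segment[OF sums] .
  from sums_divide[OF this, of "h ^ n"]
  have S: "(\<lambda>i. c (i + Suc n) * h ^ Suc i) sums ((f (z + h) - (\<Sum>i<n. c i * h ^ i)) / h ^ n - c n)"
    using h by (simp add: power_add field_simps)
  have q: "norm h / \<rho> \<le> 1 / 2" using h \<rho> by (simp add: field_simps)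
  have "norm (c (i + Suc n) * h ^ Suc i) \<le> B / \<rho> ^ (n + 1) * norm h * (1 / 2) ^ i" for i
  proof -
    have "norm (c (i + Suc n) * h ^ Suc i) \<le> B / \<rho> ^ (i + Suc n) * norm h ^ Suc i"
      unfolding norm_mult norm_power by (intro mult_right_mono c) auto
    also have "\<dots> = B / \<rho> ^ (n + 1) * norm h * (norm h / \<rho>) ^ i"
      using \<rho> by (simp add: power_add power_divide field_simps)
    also have "\<dots> \<le> B / \<rho> ^ (n + 1) * norm h * (1 / 2) ^ i"
      using \<rho> B q by (intro mult_left_mono power_mono) auto
    finally show ?thesis .
  qed
  moreover have G: "(\<lambda>i. B / \<rho> ^ (n + 1) * norm h * (1 / 2) ^ i) sums (B / \<rho> ^ (n + 1) * norm h * 2)"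
  proof (rule sums_mult)
    show "(\<lambda>i. (1 / 2) ^ i) sums (2 :: real)" using geometric_sums[of "1/2 :: real"] by simp
  qed
  ultimately have "norm (\<Sum>i. c (i + Suc n) * h ^ Suc i) \<le> (\<Sum>i. B / \<rho> ^ (n + 1) * norm h * (1 / 2) ^ i)"
    by (intro norm_suminf_le sums_summable[OF G])
  then show ?thesis
    using S G by (simp add: sums_iff mult_ac)
qed

text \<open>By induction, coefficient \<open>n\<close> is the limit of a combination of one value
  \<open>f x y\<close> and the lower coefficients, as \<open>y\<close> in \<open>Z\<close> tends to
  \<open>z\<close>. The preceding estimate makes the limit uniform in \<open>x\<close>, so
  regularity at points accumulating at \<open>z\<close> is enough.\<close>

lemma Taylor_coeff_closed:
  assumes C: "fun_subring C"
    and lim: "\<And>g h. (\<And>e. e > 0 \<Longrightarrow> \<exists>h. C h \<and> (\<forall>x\<in>T. norm (h x - g x) \<le> e)) \<Longrightarrow> C g"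
    and r: "r > 0" and hol: "\<And>x. x \<in> T \<Longrightarrow> f x holomorphic_on ball z r"
    and bd: "\<And>x y. x \<in> T \<Longrightarrow> y \<in> ball z r \<Longrightarrow> norm (f x y) \<le> B"
    and Z: "z islimpt Z" and CZ: "\<And>y. y \<in> Z \<Longrightarrow> C (\<lambda>x. f x y)"
  shows "C (\<lambda>x. fps_nth (fps_expansion (f x) z) n)"
proof (induction n rule: less_induct)
  case (less n)
  define \<rho> where "\<rho> = r / 2"
  have \<rho>: "0 < \<rho>" "\<rho> < r" using r by (auto simp: \<rho>_def)
  \<comment> \<open>The absolute value covers the case that \<open>T\<close> is empty and
    \<open>B\<close> negative; adding 1 makes division by \<open>K\<close> possible when
    \<open>B = 0\<close>.\<close>
  define K where "K = 2 * \<bar>B\<bar> / \<rho> ^ (n + 1) + 1"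
  have K: "K > 0" using \<rho> by (simp add: K_def add_nonneg_pos)
  show ?case
  proof (rule lim)
    fix e :: real assume e: "e > 0"
    define d where "d = min (\<rho> / 2) (e / K)"
    have "d > 0" using \<rho> e K by (simp add: d_def)
    then obtain y where y: "y \<in> Z" "y \<noteq> z" "dist y z < d"
      using Z unfolding islimpt_approachable by blast
    define h where "h = y - z"
    have h: "h \<noteq> 0" "norm h < d" using y by (auto simp: h_def dist_norm)
    define g where "g x = (1 / h ^ n) * (f x y + (\<Sum>i<n. (- (h ^ i)) * fps_nth (fps_expansion (f x) z) i))" for x
    have "C g" unfolding g_def
      by (intro fun_subringD[OF C] CZ[OF y(1)] fun_subring_sum[OF C] less.IH) simp
    moreover have "norm (g x - fps_nth (fps_expansion (f x) z) n) \<le> e" if x: "x \<in> T" for x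
    proof -
      have "g x = (f x (z + h) - (\<Sum>i<n. fps_nth (fps_expansion (f x) z) i * h ^ i)) / h ^ n"
        by (simp add: g_def h_def sum_negf mult.commute)
      then have "norm (g x - fps_nth (fps_expansion (f x) z) n) \<le> 2 * \<bar>B\<bar> / \<rho> ^ (n + 1) * norm h"
        using norm_Taylor_remainder_le[OF hol[OF x], of "\<bar>B\<bar>" \<rho> h n] bd[OF x] \<rho> h by (force simp: d_def)
      also have "\<dots> \<le> K * norm h"
        by (intro mult_right_mono) (auto simp: K_def)
      also have "\<dots> \<le> K * (e / K)"
        using h K by (intro mult_left_mono) (auto simp: d_def)
      finally show ?thesis using K by simp
    qed
    ultimately show "\<exists>h. C h \<and> (\<forall>x\<in>T. norm (h x - fps_nth (fps_expansion (f x) z) n) \<le> e)" by blast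
  qed
qed

text \<open>
  The Baire category theorem replaces a bound and a regularity property that hold for each \<open>z\<close> on
  some \<open>T k\<close>, with \<open>k\<close> depending on \<open>z\<close>, by bounds for fixed \<open>k\<close> and \<open>z\<close> in a dense subset of a disc.
  A meromorphic function which is bounded on a dense set has no poles, and so the bound holds on the
  whole disc.
\<close>

lemma meromorphic_family:
  fixes T :: "nat \<Rightarrow> 'x set" and C :: "nat \<Rightarrow> ('x \<Rightarrow> complex) \<Rightarrow> bool"
    and f :: "'l \<Rightarrow> 'x \<Rightarrow> complex \<Rightarrow> complex"
  assumes T: "\<And>k. T k \<subseteq> T 0" and L: "finite L" and D: "open D" "D \<noteq> {}"
    and C: "\<And>k. fun_subring (C k)"
    and lim: "\<And>k g. (\<And>e. e > 0 \<Longrightarrow> \<exists>h. C k h \<and> (\<forall>x\<in>T k. norm (h x - g x) \<le> e)) \<Longrightarrow> C k g"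
    and mero: "\<And>l x. l \<in> L \<Longrightarrow> x \<in> T 0 \<Longrightarrow> f l x meromorphic_on D"
    and an: "\<And>l x. l \<in> L \<Longrightarrow> x \<in> T 0 \<Longrightarrow> f l x analytic_on {z \<in> D. \<not> is_pole (f l x) z}"
    and loc: "\<And>l z. l \<in> L \<Longrightarrow> z \<in> D \<Longrightarrow> \<exists>k. \<forall>k'\<ge>k.
      (\<forall>x\<in>T k'. (\<forall>l\<in>L. \<not> is_pole (f l x) z) \<longrightarrow> norm (f l x z) \<le> real k) \<and>
      ((\<forall>x\<in>T k'. \<forall>l\<in>L. \<not> is_pole (f l x) z) \<longrightarrow> C k' (\<lambda>x. f l x z))"
  shows "\<exists>k z0 r. r > 0 \<and> ball z0 r \<subseteq> D \<and>
    (\<forall>l\<in>L. \<forall>x\<in>T k. \<forall>z\<in>ball z0 r. \<not> is_pole (f l x) z) \<and>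
    (\<forall>l\<in>L. \<forall>z\<in>ball z0 r. \<forall>n. C k (\<lambda>x. fps_nth (fps_expansion (f l x) z) n))"
proof -
  define Q where "Q k z \<longleftrightarrow> (\<forall>l\<in>L. (\<forall>x\<in>T k. (\<forall>l\<in>L. \<not> is_pole (f l x) z) \<longrightarrow> norm (f l x z) \<le> real k) \<and>
      ((\<forall>x\<in>T k. \<forall>l\<in>L. \<not> is_pole (f l x) z) \<longrightarrow> C k (\<lambda>x. f l x z)))" for k z
  have "\<exists>k. Q k z" if z: "z \<in> D" for z
  proof -
    obtain k where k: "\<And>l k'. l \<in> L \<Longrightarrow> k' \<ge> k l \<Longrightarrow>
      (\<forall>x\<in>T k'. (\<forall>l\<in>L. \<not> is_pole (f l x) z) \<longrightarrow> norm (f l x z) \<le> real (k l)) \<and>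
      ((\<forall>x\<in>T k'. \<forall>l\<in>L. \<not> is_pole (f l x) z) \<longrightarrow> C k' (\<lambda>x. f l x z))"
      using loc[OF _ z] by metis
    \<comment> \<open>The indices that work for the finitely many \<open>l\<close> are merged;
      inserting 0 covers empty \<open>L\<close>.\<close>
    define m where "m = Max (insert 0 (k ` L))"
    have m: "k l \<le> m" if "l \<in> L" for l
      unfolding m_def using L that by (intro Max_ge) auto
    have "Q m z"
      unfolding Q_def
    proof (intro ballI conjI impI)
      fix l assume l: "l \<in> L"
      note kl = k[OF l m[OF l]]
      have le: "real (k l) \<le> real m" using m[OF l] by simp
      show "norm (f l x z) \<le> real m" if "x \<in> T m" "\<forall>l\<in>L. \<not> is_pole (f l x) z" for x
        by (rule order_trans[OF _ le]) (use kl that in blast)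
      show "C m (\<lambda>x. f l x z)" if "\<forall>x\<in>T m. \<forall>l\<in>L. \<not> is_pole (f l x) z"
        using kl that by blast
    qed
    then show ?thesis ..
  qed
  then obtain k z0 r where r: "r > 0" "ball z0 r \<subseteq> D" and cl: "ball z0 r \<subseteq> closure {z \<in> D. Q k z}"
    using Baire_increasing_sets[of D Q, OF D] by metis
  \<comment> \<open>The bounds are used first: they exclude poles on the ball for all parameters in
    \<open>T k\<close>. Only then does the regularity clause of \<open>Q\<close>, which is
    conditional on the absence of poles, become available.\<close>
  have *: "\<not> is_pole (f l x) z" "norm (f l x z) \<le> real k"
    if "l \<in> L" "x \<in> T k" "z \<in> ball z0 r" for l x z
  proof -
    have x0: "x \<in> T 0" using that T by blast
    have m: "f l x meromorphic_on ball z0 r" if "l \<in> L" for l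
      by (rule meromorphic_on_subset[OF mero[OF that x0] r(2)])
    have a: "f l x analytic_on {z \<in> ball z0 r. \<not> is_pole (f l x) z}" if "l \<in> L" for l
      by (rule analytic_on_subset[OF an[OF that x0]]) (use r in auto)
    have b: "norm (f l x z) \<le> real k" if "z \<in> {z \<in> D. Q k z}" "\<forall>l\<in>L. \<not> is_pole (f l x) z" "l \<in> L" for z l
      using that \<open>x \<in> T k\<close> by (auto simp: Q_def)
    show "\<not> is_pole (f l x) z" "norm (f l x z) \<le> real k"
      by (rule meromorphic_bounded_on_dense[where f = "\<lambda>l. f l x" and L = L and W = "ball z0 r" and
            Z = "{z \<in> D. Q k z}" and B = "real k" and p = z and l = l];
          (rule L m a open_ball cl that b; assumption)?)+
  qed
  have hol: "f l x holomorphic_on ball z0 r" if "l \<in> L" "x \<in> T k" for l x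
    using that T r(2) *(1)[OF that]
    by (intro analytic_imp_holomorphic analytic_on_subset[OF an]) blast+
  have "C k (\<lambda>x. fps_nth (fps_expansion (f l x) z) n)" if l: "l \<in> L" and z: "z \<in> ball z0 r" for l z n
  proof -
    obtain s where s: "s > 0" "ball z s \<subseteq> ball z0 r" using z openE open_ball by blast
    define Z where "Z = {y \<in> D. Q k y} \<inter> ball z0 r"
    have "z islimpt Z"
      unfolding islimpt_approachable
    proof (intro allI impI)
      fix e :: real assume e: "e > 0"
      define V where "V = ball z (min e s) - {z}"
      have "z + of_real (min e s / 2) \<in> V" using e s by (auto simp: V_def dist_norm)
      moreover have "open V" unfolding V_def by (intro open_Diff) auto
      moreover have "V \<subseteq> ball z0 r" using s by (auto simp: V_def)
      ultimately have "V \<inter> {y \<in> D. Q k y} \<noteq> {}"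
        using cl open_Int_closure_eq_empty[of V "{y \<in> D. Q k y}"] by auto
      then obtain y where y: "y \<in> V" "y \<in> D" "Q k y" by blast
      moreover have "y \<in> ball z0 r" using y \<open>V \<subseteq> ball z0 r\<close> by blast
      ultimately have "y \<in> Z" by (simp add: Z_def)
      with y(1) show "\<exists>x'\<in>Z. x' \<noteq> z \<and> dist x' z < e"
        by (intro bexI[of _ y]) (auto simp: V_def dist_commute)
    qed
    \<comment> \<open>The condition of the regularity clause of \<open>Q\<close> is now satisfied,
      since there are no poles on the ball.\<close>
    moreover have "C k (\<lambda>x. f l x y)" if "y \<in> Z" for y
      using that l *(1) by (auto simp: Z_def Q_def)
    ultimately show ?thesis
      using s hol[OF l] *(2)[OF l] lim
      by (intro Taylor_coeff_closed[where T = "T k" and B = "real k" and Z = Z and r = s, OF C])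
         (auto intro: holomorphic_on_subset)
  qed
  then show ?thesis
    using r *(1) by (intro exI[of _ k] exI[of _ z0] exI[of _ r]) blast
qed

section \<open>Holomorphic functions on the product of half spaces\<close>

definition cscale :: "complex \<Rightarrow> complex^'n^'n^'g \<Rightarrow> complex^'n^'n^'g" where
  "cscale c X = (\<chi> \<nu> i k. c * X $ \<nu> $ i $ k)"

text \<open>A derivative within the symmetric tuples is determined only on symmetric directions.
  Composing with this projection selects a canonical one, so that derivatives of different functions
  can be compared on all directions.\<close>

definition sym_part :: "complex^'n^'n^'g \<Rightarrow> complex^'n^'n^'g" where
  "sym_part X = (\<chi> \<nu> i k. (X $ \<nu> $ i $ k + X $ \<nu> $ k $ i) / 2)"

definition sym_tuples :: "(complex^'n^'n^'g) set" where
  "sym_tuples = {X. \<forall>\<nu>. Finite_Cartesian_Product.transpose (X $ \<nu>) = X $ \<nu>}"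

lemma sym_tuples_iff: "X \<in> sym_tuples \<longleftrightarrow> (\<forall>\<nu> i k. X $ \<nu> $ i $ k = X $ \<nu> $ k $ i)"
  unfolding sym_tuples_def vec_eq_iff Finite_Cartesian_Product.transpose_def by (auto simp: eq_commute)

lemma sym_part_in: "sym_part X \<in> sym_tuples"
  by (simp add: sym_tuples_iff sym_part_def add.commute)

lemma sym_part_id: "X \<in> sym_tuples \<Longrightarrow> sym_part X = X"
  unfolding sym_tuples_iff by (simp add: vec_eq_iff sym_part_def)

lemma sym_tuples_closed:
  "X \<in> sym_tuples \<Longrightarrow> Y \<in> sym_tuples \<Longrightarrow> X + Y \<in> sym_tuples"
  "X \<in> sym_tuples \<Longrightarrow> Y \<in> sym_tuples \<Longrightarrow> X - Y \<in> sym_tuples"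
  "X \<in> sym_tuples \<Longrightarrow> cscale c X \<in> sym_tuples"
  "X \<in> sym_tuples \<Longrightarrow> t *\<^sub>R X \<in> sym_tuples"
  by (simp_all add: sym_tuples_iff cscale_def)

lemma convex_sym_tuples: "convex sym_tuples"
  by (auto simp: convex_def intro: sym_tuples_closed)

lemma norm_vec_scale:
  assumes "\<And>i. norm (y $ i) = a * norm (x $ i)" "a \<ge> 0"
  shows "norm y = a * norm x"
  using assms by (simp add: norm_vec_def L2_set_right_distrib)

lemma norm_cscale: "norm (cscale c X) = norm c * norm X"
  by (intro norm_vec_scale) (simp_all add: cscale_def norm_mult)

lemma bounded_linear_sym_part: "bounded_linear (sym_part :: complex^'n^'n^'g \<Rightarrow> complex^'n^'n^'g)"
  unfolding linear_conv_bounded_linear[symmetric]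
  by (rule linearI) (simp_all add: vec_eq_iff sym_part_def complex_eq_iff field_simps)

lemma bounded_linear_cscale: "bounded_linear (\<lambda>c. cscale c X)"
  unfolding linear_conv_bounded_linear[symmetric]
  by (rule linearI) (simp_all add: vec_eq_iff cscale_def ring_distribs)

lemma cscale_1: "cscale 1 X = X" and cscale_0: "cscale 0 X = 0"
  by (simp_all add: vec_eq_iff cscale_def)

lemma holomorphic_mv_iff:
  "holomorphic_mv f S \<longleftrightarrow> (\<forall>x\<in>S. \<exists>D. (f has_derivative D) (at x within S) \<and> (\<forall>c X. D (cscale c X) = c * D X))"
  by (simp add: holomorphic_mv_def cscale_def)

lemma holomorphic_mv_subset: "holomorphic_mv f S \<Longrightarrow> T \<subseteq> S \<Longrightarrow> holomorphic_mv f T"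
  unfolding holomorphic_mv_iff by (meson has_derivative_subset subsetD)

lemma holomorphic_mv_cong:
  assumes "\<And>x. x \<in> S \<Longrightarrow> f x = g x" "holomorphic_mv g S"
  shows "holomorphic_mv f S"
  using assms unfolding holomorphic_mv_iff by (metis has_derivative_transform)

lemma holomorphic_mv_local:
  assumes "\<And>x. x \<in> S \<Longrightarrow> \<exists>U. open U \<and> x \<in> U \<and> holomorphic_mv f (U \<inter> S)"
  shows "holomorphic_mv f S"
  unfolding holomorphic_mv_iff
proof
  fix x assume x: "x \<in> S"
  then obtain U where U: "open U" "x \<in> U" "holomorphic_mv f (U \<inter> S)" using assms by blast
  then obtain D where "(f has_derivative D) (at x within U \<inter> S)" "\<forall>c X. D (cscale c X) = c * D X"
    using x unfolding holomorphic_mv_iff by blast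
  moreover have "at x within U \<inter> S = at x within S"
    by (rule at_within_nhd[OF U(2,1)]) auto
  ultimately show "\<exists>D. (f has_derivative D) (at x within S) \<and> (\<forall>c X. D (cscale c X) = c * D X)" by auto
qed

lemma holomorphic_mv_continuous:
  assumes "holomorphic_mv f S" "x \<in> S"
  shows "continuous (at x within S) f"
  using assms unfolding holomorphic_mv_iff by (blast intro: has_derivative_continuous)

lemma fun_subring_holomorphic_mv: "fun_subring (\<lambda>f. holomorphic_mv f S)"
  unfolding fun_subring_def
proof (intro conjI allI impI)
  show "holomorphic_mv (\<lambda>_. c) S" for c
    unfolding holomorphic_mv_iff by (auto intro!: exI[of _ "\<lambda>_. 0"] derivative_eq_intros)
  fix f g assume fg: "holomorphic_mv f S" "holomorphic_mv g S"
  show "holomorphic_mv (\<lambda>x. f x + g x) S" unfolding holomorphic_mv_iff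
  proof
    fix x assume x: "x \<in> S"
    obtain D E where D: "(f has_derivative D) (at x within S)" "\<forall>c X. D (cscale c X) = c * D X"
      and E: "(g has_derivative E) (at x within S)" "\<forall>c X. E (cscale c X) = c * E X"
      using fg x unfolding holomorphic_mv_iff by blast
    show "\<exists>D. ((\<lambda>x. f x + g x) has_derivative D) (at x within S) \<and> (\<forall>c X. D (cscale c X) = c * D X)"
      using has_derivative_add[OF D(1) E(1)] D(2) E(2) by (auto simp: ring_distribs)
  qed
  show "holomorphic_mv (\<lambda>x. f x * g x) S" unfolding holomorphic_mv_iff
  proof
    fix x assume x: "x \<in> S"
    obtain D E where D: "(f has_derivative D) (at x within S)" "\<forall>c X. D (cscale c X) = c * D X"
      and E: "(g has_derivative E) (at x within S)" "\<forall>c X. E (cscale c X) = c * E X"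
      using fg x unfolding holomorphic_mv_iff by blast
    show "\<exists>D. ((\<lambda>x. f x * g x) has_derivative D) (at x within S) \<and> (\<forall>c X. D (cscale c X) = c * D X)"
      using has_derivative_mult[OF D(1) E(1)] D(2) E(2) by (auto simp: algebra_simps)
  qed
qed

text \<open>Cauchy's inequality on the complex line through \<open>x\<close> in the direction
  \<open>h\<close>. The direction is symmetric, so the line stays in the set on which
  \<open>f\<close> is differentiable.\<close>

lemma holomorphic_mv_line:
  assumes f: "holomorphic_mv f (ball x r \<inter> sym_tuples)" and x: "x \<in> sym_tuples" and h: "h \<in> sym_tuples" and r: "r > 0"
    and D: "(f has_derivative D) (at x within ball x r \<inter> sym_tuples)" "\<And>c X. D (cscale c X) = c * D X"
    and bd: "\<And>y. y \<in> ball x r \<inter> sym_tuples \<Longrightarrow> norm (f y) \<le> B"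
  shows "norm (D h) \<le> 2 * B / r * norm h"
proof (cases "h = 0")
  case True
  then show ?thesis using D(2)[of 0 0] by (simp add: cscale_0)
next
  case False
  then have nh: "norm h > 0" by simp
  define W where "W = ball x r \<inter> sym_tuples"
  \<comment> \<open>The radius at which the line leaves the ball. Cauchy's inequality is used on the
    circle of half this radius, whence the factor 2.\<close>
  define R where "R = r / norm h"
  have R: "R > 0" using r nh by (simp add: R_def)
  have line: "x + cscale t h \<in> W" if "norm t < R" for t
    using that x h nh by (auto simp: W_def R_def dist_norm norm_cscale field_simps intro!: sym_tuples_closed)
  define g where "g t = f (x + cscale t h)" for t
  have der: "(g has_field_derivative E h) (at t)"
    if t: "norm t < R" and E: "(f has_derivative E) (at (x + cscale t h) within W)" "\<And>c X. E (cscale c X) = c * E X" for t E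
  proof -
    have "((\<lambda>t. x + cscale t h) has_derivative (\<lambda>s. cscale s h)) (at t within ball 0 R)"
      using bounded_linear.has_derivative[OF bounded_linear_cscale has_derivative_ident]
      by (auto intro!: derivative_eq_intros)
    moreover have "(f has_derivative E) (at (x + cscale t h) within (\<lambda>t. x + cscale t h) ` ball 0 R)"
      by (rule has_derivative_subset[OF E(1)]) (use line in auto)
    ultimately have "(g has_derivative (\<lambda>s. E (cscale s h))) (at t within ball 0 R)"
      unfolding g_def by (rule has_derivative_in_compose)
    moreover have "at t within ball 0 R = at t"
      using t by (intro at_within_open) auto
    moreover have "(\<lambda>s. E (cscale s h)) = (*) (E h)"
      by (simp add: fun_eq_iff E(2) mult.commute)
    ultimately show ?thesis
      by (simp add: has_field_derivative_def)
  qed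
  have hol: "g holomorphic_on ball 0 R"
    unfolding holomorphic_on_open[OF open_ball]
  proof
    fix t :: complex assume "t \<in> ball 0 R"
    then have t: "norm t < R" by simp
    obtain E where "(f has_derivative E) (at (x + cscale t h) within W)" "\<And>c X. E (cscale c X) = c * E X"
      using f line[OF t] unfolding holomorphic_mv_iff W_def by blast
    then show "\<exists>g'. (g has_field_derivative g') (at t)" using der[OF t] by blast
  qed
  have d0: "deriv g 0 = D h"
    by (rule DERIV_imp_deriv, rule der) (use R D in \<open>auto simp: cscale_0 W_def\<close>)
  have "norm ((deriv ^^ 1) g 0) \<le> fact 1 * B / (R / 2) ^ 1"
  proof (rule Cauchy_inequality)
    show "g holomorphic_on ball 0 (R / 2)" using hol R by (auto intro: holomorphic_on_subset)
    show "continuous_on (cball 0 (R / 2)) g"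
      using hol R by (intro holomorphic_on_imp_continuous_on) (auto intro: holomorphic_on_subset)
    show "norm (g y) \<le> B" if "norm (0 - y) = R / 2" for y
      using that R line[of y] bd unfolding g_def W_def by auto
  qed (use R in auto)
  then show ?thesis by (simp add: d0 R_def mult_ac)
qed

text \<open>Around each point of the half ball there is still a ball of radius \<open>r / 2\<close>
  inside the large one, so the Cauchy bound applied to differences makes the derivatives uniformly
  Cauchy. The limit may then be differentiated, and complex homogeneity of the derivatives survives
  the limit.\<close>

lemma holomorphic_mv_uniform_limit_ball:
  fixes f :: "nat \<Rightarrow> complex^'n::finite^'n^'g::finite \<Rightarrow> complex" and g :: "complex^'n::finite^'n^'g::finite \<Rightarrow> complex"
  assumes x0: "x0 \<in> sym_tuples" and r: "r > 0"
    and f: "\<And>n. holomorphic_mv (f n) (ball x0 r \<inter> sym_tuples)"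
    and lim: "\<And>e. e > 0 \<Longrightarrow> \<exists>N. \<forall>n\<ge>N. \<forall>x\<in>ball x0 r \<inter> sym_tuples. norm (f n x - g x) \<le> e"
  shows "holomorphic_mv g (ball x0 (r / 2) \<inter> sym_tuples)"
proof -
  define W where "W = ball x0 r \<inter> sym_tuples"
  define V where "V = ball x0 (r / 2) \<inter> sym_tuples"
  have VW: "V \<subseteq> W" using r by (auto simp: V_def W_def)
  have sub: "ball x (r / 2) \<inter> sym_tuples \<subseteq> W" if "x \<in> V" for x
  proof -
    have "ball x (r / 2) \<subseteq> ball x0 r"
    proof
      fix y assume "y \<in> ball x (r / 2)"
      then show "y \<in> ball x0 r" using that dist_triangle[of x0 y x] by (auto simp: V_def)
    qed
    then show ?thesis by (auto simp: W_def)
  qed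
  have "\<exists>D. \<forall>n. \<forall>x\<in>W. (f n has_derivative D n x) (at x within W) \<and> (\<forall>c X. D n x (cscale c X) = c * D n x X)"
    using f[folded W_def] unfolding holomorphic_mv_iff by metis
  then obtain D where D: "\<And>n x. x \<in> W \<Longrightarrow> (f n has_derivative D n x) (at x within W)"
    "\<And>n x c X. x \<in> W \<Longrightarrow> D n x (cscale c X) = c * D n x X" by blast
  have Cauchy: "norm (D n x h - D m x h) \<le> 4 * e / r * norm h"
    if x: "x \<in> V" and h: "h \<in> sym_tuples" and e: "\<And>y. y \<in> W \<Longrightarrow> norm (f n y - f m y) \<le> e" for n m x h e
  proof -
    have xW: "x \<in> W" using x VW by blast
    have s: "ball x (r / 2) \<inter> sym_tuples \<subseteq> W" by (rule sub[OF x])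
    have "norm ((\<lambda>X. D n x X - D m x X) h) \<le> 2 * e / (r / 2) * norm h"
    proof (rule holomorphic_mv_line[where f = "\<lambda>y. f n y - f m y" and x = x])
      have "holomorphic_mv (\<lambda>y. f n y + (- 1) * f m y) (ball x (r / 2) \<inter> sym_tuples)"
        by (intro fun_subringD[OF fun_subring_holomorphic_mv] holomorphic_mv_subset[OF f s[unfolded W_def]])
      then show "holomorphic_mv (\<lambda>y. f n y - f m y) (ball x (r / 2) \<inter> sym_tuples)" by simp
      show "((\<lambda>y. f n y - f m y) has_derivative (\<lambda>X. D n x X - D m x X)) (at x within ball x (r / 2) \<inter> sym_tuples)"
        by (intro has_derivative_diff has_derivative_subset[OF D(1)[OF xW] s])
      show "D n x (cscale c X) - D m x (cscale c X) = c * (D n x X - D m x X)" for c X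
        by (simp add: D(2)[OF xW] right_diff_distrib)
    qed (use x h r e s in \<open>auto simp: V_def\<close>)
    then show ?thesis by simp
  qed
  obtain Ks where Ks: "Ks > 0" "\<And>X :: complex^'n^'n^'g. norm (sym_part X) \<le> norm X * Ks"
    using bounded_linear.pos_bounded[OF bounded_linear_sym_part] by blast
  \<comment> \<open>The derivatives normalised on nonsymmetric directions; without this they need
    not converge there.\<close>
  define F where "F n x h = D n x (sym_part h)" for n x h
  have bdF: "\<exists>N. \<forall>n\<ge>N. \<forall>m\<ge>N. \<forall>x\<in>V. \<forall>h. norm (F n x h - F m x h) \<le> e * norm h" if e: "e > 0" for e
  proof -
    \<comment> \<open>The constant absorbs 4 from the bound for differences, 2 from the triangle
      inequality through \<open>g\<close>, and the norm bound \<open>Ks\<close> of the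
      projection.\<close>
    define e' where "e' = e * r / (8 * Ks)"
    have "e' > 0" using e r Ks by (simp add: e'_def)
    then obtain N where N: "\<And>n x. n \<ge> N \<Longrightarrow> x \<in> W \<Longrightarrow> norm (f n x - g x) \<le> e'"
      using lim unfolding W_def by blast
    have "norm (F n x h - F m x h) \<le> e * norm h" if "n \<ge> N" "m \<ge> N" "x \<in> V" for n m x h
    proof -
      have "norm (f n y - f m y) \<le> 2 * e'" if "y \<in> W" for y
        using norm_triangle_ineq4[of "f n y - g y" "f m y - g y"] N[OF \<open>n \<ge> N\<close> that] N[OF \<open>m \<ge> N\<close> that] by simp
      from Cauchy[OF \<open>x \<in> V\<close> sym_part_in this]
      have "norm (F n x h - F m x h) \<le> 4 * (2 * e') / r * norm (sym_part h)" by (simp add: F_def)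
      also have "\<dots> \<le> 4 * (2 * e') / r * (norm h * Ks)"
        using Ks r \<open>e' > 0\<close> by (intro mult_left_mono) auto
      also have "\<dots> = e * norm h" using r Ks(1) by (simp add: e'_def)
      finally show ?thesis .
    qed
    then show ?thesis by blast
  qed
  define G where "G x h = lim (\<lambda>n. F n x h)" for x h
  have convF: "(\<lambda>n. F n x h) \<longlonglongrightarrow> G x h" if x: "x \<in> V" for x h
  proof -
    have "Cauchy (\<lambda>n. F n x h)"
      unfolding Cauchy_altdef2 dist_norm
    proof (intro allI impI)
      fix e :: real assume e: "e > 0"
      define e' where "e' = e / 2 / (norm h + 1)"
      have e': "e' > 0" using e by (simp add: e'_def add_nonneg_pos)
      obtain N where N: "\<And>n m. n \<ge> N \<Longrightarrow> m \<ge> N \<Longrightarrow> norm (F n x h - F m x h) \<le> e' * norm h"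
        using bdF[OF e'] x by blast
      have "e' * norm h \<le> e' * (norm h + 1)" using e' by (intro mult_left_mono) auto
      also have "\<dots> = e / 2"
      proof -
        have "norm h + 1 \<noteq> 0" using norm_ge_zero[of h] by linarith
        then show ?thesis unfolding e'_def by (rule nonzero_eq_divide_eq[THEN iffD1, OF _ refl])
      qed
      also have "\<dots> < e" using e by simp
      finally show "\<exists>N. \<forall>n\<ge>N. norm (F n x h - F N x h) < e"
        using N by (meson le_less_trans order_refl)
    qed
    then show ?thesis unfolding G_def by (simp add: Cauchy_convergent_iff convergent_LIMSEQ_iff)
  qed
  have derF: "(f n has_derivative F n x) (at x within V)" if x: "x \<in> V" for n x
  proof -
    have im: "sym_part ` V = V" using sym_part_id by (force simp: V_def)
    have "(sym_part has_derivative sym_part) (at x within V)"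
      by (intro bounded_linear_imp_has_derivative bounded_linear_sym_part)
    moreover have "(f n has_derivative D n x) (at (sym_part x) within sym_part ` V)"
      using has_derivative_subset[OF D(1) VW] x VW by (auto simp: im V_def sym_part_id)
    ultimately have "((\<lambda>y. f n (sym_part y)) has_derivative (\<lambda>h. D n x (sym_part h))) (at x within V)"
      by (rule has_derivative_in_compose)
    then show ?thesis unfolding F_def
      by (rule has_derivative_transform[rotated 2]) (use x in \<open>auto simp: V_def sym_part_id\<close>)
  qed
  have unif: "\<forall>\<^sub>F n in sequentially. \<forall>x\<in>V. \<forall>h. norm (F n x h - G x h) \<le> e * norm h" if e: "e > 0" for e
  proof -
    obtain N where N: "\<And>n m x h. n \<ge> N \<Longrightarrow> m \<ge> N \<Longrightarrow> x \<in> V \<Longrightarrow> norm (F n x h - F m x h) \<le> e * norm h"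
      using bdF[OF e] by blast
    have "norm (F n x h - G x h) \<le> e * norm h" if "n \<ge> N" "x \<in> V" for n x h
    proof (rule tendsto_upperbound)
      show "(\<lambda>m. norm (F n x h - F m x h)) \<longlonglongrightarrow> norm (F n x h - G x h)"
        by (intro tendsto_intros convF that)
      show "\<forall>\<^sub>F m in sequentially. norm (F n x h - F m x h) \<le> e * norm h"
        using eventually_ge_at_top[of N] by eventually_elim (use N that in blast)
    qed simp
    then show ?thesis unfolding eventually_sequentially by blast
  qed
  have flim: "(\<lambda>n. f n x) \<longlonglongrightarrow> g x" if "x \<in> W" for x
    unfolding LIMSEQ_iff
  proof (intro allI impI)
    fix e :: real assume "e > 0"
    then obtain N where "\<forall>n\<ge>N. \<forall>x\<in>W. norm (f n x - g x) \<le> e / 2" using lim[of "e / 2"] unfolding W_def by auto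
    then show "\<exists>N. \<forall>n\<ge>N. norm (f n x - g x) < e" using that \<open>e > 0\<close> by (intro exI[of _ N]) force
  qed
  have "x0 \<in> V" using x0 r by (simp add: V_def)
  have "convex V" unfolding V_def by (intro convex_Int convex_ball convex_sym_tuples)
  from has_derivative_sequence[OF this derF unif \<open>x0 \<in> V\<close> flim]
  obtain g' where g': "\<And>x. x \<in> V \<Longrightarrow> (\<lambda>n. f n x) \<longlonglongrightarrow> g' x" "\<And>x. x \<in> V \<Longrightarrow> (g' has_derivative G x) (at x within V)"
    using \<open>x0 \<in> V\<close> VW by blast
  have g_eq: "g' x = g x" if "x \<in> V" for x
    using LIMSEQ_unique[OF g'(1)[OF that] flim] that VW by blast
  have "(g has_derivative G x) (at x within V)" if "x \<in> V" for x
    using g'(2)[OF that] by (rule has_derivative_transform[rotated 2]) (use that g_eq in auto)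
  moreover have "G x (cscale c X) = c * G x X" if x: "x \<in> V" for x c X
  proof -
    have "sym_part (cscale c X) = cscale c (sym_part X)"
      by (simp add: vec_eq_iff sym_part_def cscale_def ring_distribs)
    then have "F n x (cscale c X) = c * F n x X" for n
      using x VW D(2) by (auto simp: F_def)
    then have "(\<lambda>n. F n x (cscale c X)) \<longlonglongrightarrow> c * G x X"
      using tendsto_mult_left[OF convF[OF x]] by simp
    then show ?thesis using LIMSEQ_unique convF[OF x] by blast
  qed
  ultimately show ?thesis unfolding holomorphic_mv_iff V_def[symmetric] by blast
qed

lemma holomorphic_mv_uniform_limit:
  fixes g :: "complex^'n::finite^'n^'g::finite \<Rightarrow> complex"
  assumes U: "open U"
    and lim: "\<And>e. e > 0 \<Longrightarrow> \<exists>f. holomorphic_mv f (U \<inter> sym_tuples) \<and> (\<forall>x\<in>U \<inter> sym_tuples. norm (f x - g x) \<le> e)"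
  shows "holomorphic_mv g (U \<inter> sym_tuples)"
proof (rule holomorphic_mv_local)
  fix x assume x: "x \<in> U \<inter> sym_tuples"
  obtain r where r: "r > 0" "ball x r \<subseteq> U" using U x openE by blast
  have "\<forall>n. \<exists>f. holomorphic_mv f (U \<inter> sym_tuples) \<and> (\<forall>x\<in>U \<inter> sym_tuples. norm (f x - g x) \<le> inverse (Suc n))"
    using lim by simp
  then obtain f where f: "\<And>n. holomorphic_mv (f n) (U \<inter> sym_tuples)"
    "\<And>n x. x \<in> U \<inter> sym_tuples \<Longrightarrow> norm (f n x - g x) \<le> inverse (Suc n)" by metis
  have "holomorphic_mv g (ball x (r / 2) \<inter> sym_tuples)"
  proof (rule holomorphic_mv_uniform_limit_ball[OF _ r(1), of x f])
    show "holomorphic_mv (f n) (ball x r \<inter> sym_tuples)" for n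
      by (rule holomorphic_mv_subset[OF f(1)]) (use r in auto)
    fix e :: real assume "e > 0"
    then obtain N where N: "inverse (Suc N) < e" using reals_Archimedean by blast
    have "norm (f n y - g y) \<le> e" if "n \<ge> N" "y \<in> ball x r \<inter> sym_tuples" for n y
    proof -
      have "norm (f n y - g y) \<le> inverse (Suc n)" using f(2) that r by blast
      also have "\<dots> \<le> inverse (Suc N)" using that by (simp add: field_simps)
      finally show ?thesis using N by simp
    qed
    then show "\<exists>N. \<forall>n\<ge>N. \<forall>x\<in>ball x r \<inter> sym_tuples. norm (f n x - g x) \<le> e" by blast
  qed (use x in auto)
  moreover have "ball x (r / 2) \<subseteq> U"
    using r subset_ball[of "r / 2" r x] by auto
  then have "ball x (r / 2) \<inter> (U \<inter> sym_tuples) = ball x (r / 2) \<inter> sym_tuples"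
    by blast
  ultimately show "\<exists>V. open V \<and> x \<in> V \<and> holomorphic_mv g (V \<inter> (U \<inter> sym_tuples))"
    using r by (intro exI[of _ "ball x (r / 2)"]) simp
qed

text \<open>Positivity is tested on the compact unit sphere, so by the tube lemma it persists for
  nearby matrices.\<close>

lemma siegel_prod_open:
  obtains U where "open U" "siegel_prod = U \<inter> (sym_tuples :: (complex^'n::finite^'n^'g::finite) set)"
proof -
  define q where "q \<nu> p = (\<Sum>i\<in>UNIV. \<Sum>k\<in>UNIV. snd p $ i * Im (fst p $ \<nu> $ i $ k) * snd p $ k)"
    for \<nu> and p :: "(complex^'n^'n^'g) \<times> (real^'n)"
  have q: "x \<bullet> ((\<chi> i k. Im (\<Omega> $ \<nu> $ i $ k)) *v x) = q \<nu> (\<Omega>, x)" for \<Omega> :: "complex^'n^'n^'g" and \<nu> and x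
    by (simp add: q_def inner_vec_def matrix_vector_mult_def sum_distrib_left mult_ac)
  define U where "U = {\<Omega> :: complex^'n^'n^'g. \<forall>\<nu>. \<forall>x\<in>sphere 0 1. q \<nu> (\<Omega>, x) > 0}"
  have "open U"
    unfolding open_subopen[of U]
  proof
    fix \<Omega> assume \<Omega>: "\<Omega> \<in> U"
    have "\<exists>V. open V \<and> \<Omega> \<in> V \<and> (\<forall>\<Omega>'\<in>V. \<forall>x\<in>sphere 0 1. q \<nu> (\<Omega>', x) > 0)" for \<nu>
    proof -
      have "open {p. q \<nu> p > 0}"
        unfolding q_def by (intro open_Collect_less continuous_intros)
      moreover have "{\<Omega>} \<times> sphere 0 1 \<subseteq> {p. q \<nu> p > 0}" using \<Omega> by (auto simp: U_def)
      ultimately obtain V where "open V" "\<Omega> \<in> V" "V \<times> sphere 0 1 \<subseteq> {p. q \<nu> p > 0}"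
        using Elementary_Topology.tube_lemma[of "sphere 0 1 :: (real^'n) set" "{p. q \<nu> p > 0}" \<Omega>] compact_sphere
        by (metis (no_types, lifting))
      then show ?thesis by (intro exI[of _ V]) auto
    qed
    then obtain V where V: "\<And>\<nu>. open (V \<nu>)" "\<And>\<nu>. \<Omega> \<in> V \<nu>" "\<And>\<nu> \<Omega>' x. \<Omega>' \<in> V \<nu> \<Longrightarrow> x \<in> sphere 0 1 \<Longrightarrow> q \<nu> (\<Omega>', x) > 0"
      by metis
    show "\<exists>T. open T \<and> \<Omega> \<in> T \<and> T \<subseteq> U"
      by (rule exI[of _ "\<Inter>\<nu>. V \<nu>"]) (use V in \<open>auto simp: U_def intro!: open_INT\<close>)
  qed
  moreover have "siegel_prod = U \<inter> sym_tuples"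
  proof -
    have "(\<forall>x. x \<noteq> 0 \<longrightarrow> 0 < q \<nu> (\<Omega>, x)) \<longleftrightarrow> (\<forall>x\<in>sphere 0 1. 0 < q \<nu> (\<Omega>, x))" for \<Omega> \<nu>
    proof (intro iffI ballI allI impI)
      fix x assume *: "\<forall>x. x \<noteq> 0 \<longrightarrow> 0 < q \<nu> (\<Omega>, x)" "x \<in> sphere (0::real^'n) 1"
      then show "0 < q \<nu> (\<Omega>, x)" by (metis mem_sphere_0 norm_zero zero_neq_one)
    next
      fix x :: "real^'n" assume *: "\<forall>x\<in>sphere 0 1. 0 < q \<nu> (\<Omega>, x)" "x \<noteq> 0"
      define y where "y = (1 / norm x) *\<^sub>R x"
      have "y \<in> sphere 0 1" using * by (simp add: y_def)
      then have "0 < q \<nu> (\<Omega>, y)" using * by blast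
      moreover have "q \<nu> (\<Omega>, x) = (norm x)\<^sup>2 * q \<nu> (\<Omega>, y)"
        using *(2) by (simp add: q_def y_def sum_distrib_left power2_eq_square)
      ultimately show "0 < q \<nu> (\<Omega>, x)" using *(2) by simp
    qed
    then show ?thesis
      by (auto simp: siegel_prod_def siegel_def U_def sym_tuples_def q)
  qed
  ultimately show thesis using that by blast
qed

lemma poly_pole_set_iff: "z \<in> - pole_set N a \<Omega> \<longleftrightarrow> (\<forall>l\<in>{2..N}. \<not> is_pole (a l \<Omega>) z)"
  by (auto simp: pole_set_def)

text \<open>On a convex set free of poles the values along segments from a fixed point form a
  single-valued branch. A constant path is put in front to reduce this to the prolongation of
  paths.\<close>

lemma germ_linepath:
  assumes inv: "\<And>\<gamma> \<delta>. homotopic_paths S \<gamma> \<delta> \<Longrightarrow> f \<gamma> = f \<delta>"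
    and D: "convex D" "D \<subseteq> S" "w \<in> D" "z \<in> D" "\<zeta> \<in> D"
  shows "germ f (linepath w z) \<zeta> = f (linepath w \<zeta>)"
proof -
  have seg: "closed_segment x y \<subseteq> S" if "x \<in> D" "y \<in> D" for x y
    using D(1,2) that by (meson convex_contains_segment order_trans)
  have const: "f (linepath w w +++ linepath w z') = f (linepath w z')" if "z' \<in> D" for z'
    using inv[OF homotopic_paths_lid'[of "linepath w z'" S w]] seg[OF D(3) that] by simp
  have p: "path (linepath w w)" "path_image (linepath w w) \<subseteq> S" "pathfinish (linepath w w) \<in> D"
    using D by auto
  have "homotopic_paths S ((linepath w w +++ linepath w z) +++ linepath z \<zeta>) (linepath w z +++ linepath z \<zeta>)"
    using seg[OF D(3,4)] seg[OF D(4,5)] D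
    by (intro homotopic_paths_join homotopic_paths_lid') auto
  then have "germ f (linepath w z) \<zeta> = f ((linepath w w +++ linepath w z) +++ linepath z \<zeta>)"
    using inv by (simp add: germ_def)
  also have "\<dots> = f (linepath w w +++ linepath w \<zeta>)"
    using germ_join_linepath[OF inv p(1,2) D(1,2) p(3)] D(4,5) by (simp add: germ_def)
  finally show ?thesis by (simp add: const D)
qed

text \<open>The common core of holomorphy and of the cusp expansion, for shrinking domains
  \<open>T k\<close> and regularity predicates \<open>C k\<close>. The argument for meromorphic
  families is used twice, because the \<open>b j\<close> are comparable over all parameters only on
  a disc already known to contain no poles.\<close>

lemma spec_poly_family:
  fixes T :: "nat \<Rightarrow> (complex^'n::finite^'n^'g::finite) set" and C :: "nat \<Rightarrow> (complex^'n^'n^'g \<Rightarrow> complex) \<Rightarrow> bool"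
  assumes N: "N \<ge> 1"
    and T: "\<And>k k'. k \<le> k' \<Longrightarrow> T k' \<subseteq> T k"
    and C: "\<And>k. fun_subring (C k)" and Cmono: "\<And>k k' g. C k g \<Longrightarrow> k \<le> k' \<Longrightarrow> C k' g"
    and lim: "\<And>k g. (\<And>e. e > 0 \<Longrightarrow> \<exists>h. C k h \<and> (\<forall>x\<in>T k. norm (h x - g x) \<le> e)) \<Longrightarrow> C k g"
    and D: "open D" "D \<noteq> {}"
    and mero: "\<And>l \<Omega>. l \<in> {2..N} \<Longrightarrow> \<Omega> \<in> T 0 \<Longrightarrow> a l \<Omega> meromorphic_on UNIV"
    and an: "\<And>l \<Omega>. l \<in> {2..N} \<Longrightarrow> \<Omega> \<in> T 0 \<Longrightarrow> a l \<Omega> analytic_on {z. \<not> is_pole (a l \<Omega>) z}"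
    and mv: "\<And>j \<Omega>. j \<le> M \<Longrightarrow> \<Omega> \<in> T 0 \<Longrightarrow> multivalued_analytic (- pole_set N a \<Omega>) (b j \<Omega>)"
    and loc_a: "\<And>l z. l \<in> {2..N} \<Longrightarrow> z \<in> D \<Longrightarrow> \<exists>k. \<forall>k'\<ge>k.
      (\<forall>\<Omega>\<in>T k'. z \<in> - pole_set N a \<Omega> \<longrightarrow> norm (a l \<Omega> z) \<le> real k) \<and>
      ((\<forall>\<Omega>\<in>T k'. z \<in> - pole_set N a \<Omega>) \<longrightarrow> C k' (\<lambda>\<Omega>. a l \<Omega> z))"
    and loc_b: "\<And>j \<gamma>. j \<le> M \<Longrightarrow> path \<gamma> \<Longrightarrow> path_image \<gamma> \<subseteq> D \<Longrightarrow> \<exists>k. \<forall>k'\<ge>k.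
      (\<forall>\<Omega>\<in>T k'. path_image \<gamma> \<subseteq> - pole_set N a \<Omega>) \<longrightarrow>
      (\<forall>\<Omega>\<in>T k'. norm (b j \<Omega> \<gamma>) \<le> real k) \<and> C k' (\<lambda>\<Omega>. b j \<Omega> \<gamma>)"
  shows "\<exists>k z1 z2. (\<forall>\<Omega>\<in>T k. closed_segment z1 z2 \<subseteq> - pole_set N a \<Omega>) \<and>
    (\<forall>p q. C k (\<lambda>\<Omega>. coeff (coeff (spec_poly N M (\<lambda>l. fps_expansion (P_coeff a \<Omega> l) z2)
        (\<lambda>j. fps_expansion (germ (b j \<Omega>) (linepath z1 z2)) z2)) p) q))"
proof -
  have T0: "T k \<subseteq> T 0" for k by (rule T) simp
  note pole_set = poly_pole_set_iff[symmetric]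
  have "\<exists>k z0 r. r > 0 \<and> ball z0 r \<subseteq> D \<and>
    (\<forall>l\<in>{2..N}. \<forall>x\<in>T k. \<forall>z\<in>ball z0 r. \<not> is_pole (a l x) z) \<and>
    (\<forall>l\<in>{2..N}. \<forall>z\<in>ball z0 r. \<forall>n. C k (\<lambda>x. fps_nth (fps_expansion (a l x) z) n))"
  proof (rule meromorphic_family[where L = "{2..N}" and T = T and C = C and f = a and D = D])
    show "a l \<Omega> meromorphic_on D" if "l \<in> {2..N}" "\<Omega> \<in> T 0" for l \<Omega>
      by (rule meromorphic_on_subset[OF mero[OF that]]) simp
    show "a l \<Omega> analytic_on {z \<in> D. \<not> is_pole (a l \<Omega>) z}" if "l \<in> {2..N}" "\<Omega> \<in> T 0" for l \<Omega>
      by (rule analytic_on_subset[OF an[OF that]]) auto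
    show "\<exists>k. \<forall>k'\<ge>k. (\<forall>\<Omega>\<in>T k'. (\<forall>l\<in>{2..N}. \<not> is_pole (a l \<Omega>) z) \<longrightarrow> norm (a l \<Omega> z) \<le> real k) \<and>
      ((\<forall>\<Omega>\<in>T k'. \<forall>l\<in>{2..N}. \<not> is_pole (a l \<Omega>) z) \<longrightarrow> C k' (\<lambda>\<Omega>. a l \<Omega> z))" if "l \<in> {2..N}" "z \<in> D" for l z
      unfolding pole_set by (rule loc_a[OF that])
  qed (fact T0 finite_atLeastAtMost D C | rule lim, assumption)+
  then obtain k1 z1 r1 where r1: "r1 > 0" "ball z1 r1 \<subseteq> D"
    and np: "\<And>l \<Omega> z. l \<in> {2..N} \<Longrightarrow> \<Omega> \<in> T k1 \<Longrightarrow> z \<in> ball z1 r1 \<Longrightarrow> \<not> is_pole (a l \<Omega>) z"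
    and Ca: "\<And>l z n. l \<in> {2..N} \<Longrightarrow> z \<in> ball z1 r1 \<Longrightarrow> C k1 (\<lambda>\<Omega>. fps_nth (fps_expansion (a l \<Omega>) z) n)"
    by blast
  define B where "B = ball z1 r1"
  have B: "open B" "convex B" "z1 \<in> B" "B \<noteq> {}" using r1 by (auto simp: B_def)
  have BS: "B \<subseteq> - pole_set N a \<Omega>" if "\<Omega> \<in> T k1" for \<Omega>
    using np that unfolding subset_iff poly_pole_set_iff by (auto simp: B_def)
  have seg: "closed_segment z1 z \<subseteq> B" if "z \<in> B" for z
    using B that by (simp add: convex_contains_segment)
  \<comment> \<open>On the disc \<open>B\<close> segments from \<open>z1\<close> avoid the poles for
    all parameters in \<open>T k1\<close>, so these branches are ordinary holomorphic functions of
    \<open>z\<close>.\<close>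
  define f where "f j \<Omega> z = b j \<Omega> (linepath z1 z)" for j \<Omega> z
  have f: "germ (b j \<Omega>) (linepath z1 z) \<zeta> = f j \<Omega> \<zeta>" if "j \<le> M" "\<Omega> \<in> T k1" "z \<in> B" "\<zeta> \<in> B" for j \<Omega> z \<zeta>
    unfolding f_def
  proof (rule germ_linepath[OF _ B(2) BS[OF that(2)] B(3) that(3,4)])
    show "b j \<Omega> \<gamma> = b j \<Omega> \<delta>" if "homotopic_paths (- pole_set N a \<Omega>) \<gamma> \<delta>" for \<gamma> \<delta>
      using mv[OF \<open>j \<le> M\<close>] \<open>\<Omega> \<in> T k1\<close> T0 that by (auto simp: multivalued_analytic_def)
  qed
  have fhol: "f j \<Omega> holomorphic_on B" if "j \<le> M" "\<Omega> \<in> T k1" for j \<Omega>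
  proof (rule holomorphic_transform)
    show "germ (b j \<Omega>) (linepath z1 z1) holomorphic_on B"
      using mv[OF that(1)] that T0 BS[OF that(2)] B
      by (intro germ_holomorphic[of "- pole_set N a \<Omega>"]) auto
  qed (use f that B in auto)
  \<comment> \<open>The second use, with indices shifted by \<open>k1\<close> and inside the disc
    just found. The functions have no poles there; what is gained is the uniform index for their
    Taylor coefficients.\<close>
  have "\<exists>k z0 r. r > 0 \<and> ball z0 r \<subseteq> B \<and>
    (\<forall>l\<in>{..M}. \<forall>x\<in>T (k1 + k). \<forall>z\<in>ball z0 r. \<not> is_pole (f l x) z) \<and>
    (\<forall>l\<in>{..M}. \<forall>z\<in>ball z0 r. \<forall>n. C (k1 + k) (\<lambda>x. fps_nth (fps_expansion (f l x) z) n))"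
  proof (rule meromorphic_family[where L = "{..M}" and T = "\<lambda>k. T (k1 + k)" and C = "\<lambda>k. C (k1 + k)" and f = f and D = B])
    show "T (k1 + k) \<subseteq> T (k1 + 0)" for k by (rule T) simp
    show "f j \<Omega> meromorphic_on B" if "j \<in> {..M}" "\<Omega> \<in> T (k1 + 0)" for j \<Omega>
      using fhol that B(1) by (intro analytic_on_imp_meromorphic_on) (auto simp: analytic_on_open)
    show "f j \<Omega> analytic_on {z \<in> B. \<not> is_pole (f j \<Omega>) z}" if "j \<in> {..M}" "\<Omega> \<in> T (k1 + 0)" for j \<Omega>
    proof (rule analytic_on_subset)
      show "f j \<Omega> analytic_on B" using fhol that B(1) by (auto simp: analytic_on_open)
    qed auto
    show "\<exists>k. \<forall>k'\<ge>k. (\<forall>\<Omega>\<in>T (k1 + k'). (\<forall>l\<in>{..M}. \<not> is_pole (f l \<Omega>) z) \<longrightarrow> norm (f j \<Omega> z) \<le> real k) \<and>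
      ((\<forall>\<Omega>\<in>T (k1 + k'). \<forall>l\<in>{..M}. \<not> is_pole (f l \<Omega>) z) \<longrightarrow> C (k1 + k') (\<lambda>\<Omega>. f j \<Omega> z))"
      if "j \<in> {..M}" "z \<in> B" for j z
    proof -
      have j: "j \<le> M" using that(1) by simp
      have "path_image (linepath z1 z) \<subseteq> D" using seg[OF that(2)] r1 by (auto simp: B_def)
      then obtain k where k: "\<And>k'. k' \<ge> k \<Longrightarrow>
        (\<forall>\<Omega>\<in>T k'. path_image (linepath z1 z) \<subseteq> - pole_set N a \<Omega>) \<longrightarrow>
        (\<forall>\<Omega>\<in>T k'. norm (f j \<Omega> z) \<le> real k) \<and> C k' (\<lambda>\<Omega>. f j \<Omega> z)"
        using loc_b[OF j path_linepath] unfolding f_def by blast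
      have "path_image (linepath z1 z) \<subseteq> - pole_set N a \<Omega>" if "\<Omega> \<in> T (k1 + k')" for \<Omega> k'
        using BS[of \<Omega>] T[of k1 "k1 + k'"] that seg[OF \<open>z \<in> B\<close>] by auto
      then show ?thesis
        using k by (intro exI[of _ k] allI impI) (meson le_add2 order_trans)
    qed
  qed (fact finite_atMost B C | rule lim, assumption)+
  then obtain k2 z2 r2 where r2: "r2 > 0" "ball z2 r2 \<subseteq> B"
    and Cb: "\<And>j z n. j \<in> {..M} \<Longrightarrow> z \<in> ball z2 r2 \<Longrightarrow> C (k1 + k2) (\<lambda>\<Omega>. fps_nth (fps_expansion (f j \<Omega>) z) n)"
    by blast
  define k where "k = k1 + k2"
  have z2: "z2 \<in> B" using r2 by auto
  have Tk: "T k \<subseteq> T k1" by (rule T) (simp add: k_def)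
  show ?thesis
  proof (rule exI[of _ k], rule exI[of _ z1], rule exI[of _ z2], intro conjI allI ballI)
    show "closed_segment z1 z2 \<subseteq> - pole_set N a \<Omega>" if "\<Omega> \<in> T k" for \<Omega>
      using seg[OF z2] BS[of \<Omega>] that Tk by blast
    fix p q
    have "C k (\<lambda>\<Omega>. coeff (coeff (spec_poly N M (\<lambda>l. fps_expansion (P_coeff a \<Omega> l) z2)
        (\<lambda>j. fps_expansion (f j \<Omega>) z2)) p) q)"
    proof (rule fun_subring_spec_poly[OF C N])
      fix l n assume "l \<le> N"
      then consider "l = 0" | "l = 1" | "l \<in> {2..N}" by fastforce
      then show "C k (\<lambda>\<Omega>. fps_nth (fps_expansion (P_coeff a \<Omega> l) z2) n)"
      proof cases
        case 3
        then have "P_coeff a \<Omega> l = a l \<Omega>" for \<Omega> by (auto simp: P_coeff_def)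
        then show ?thesis
          using Cmono[OF Ca[OF 3], of z2 k n] z2 by (simp add: k_def B_def)
      qed (simp_all add: P_coeff_def[abs_def] fps_expansion_const fun_subringD(1)[OF C])
    next
      show "C k (\<lambda>\<Omega>. fps_nth (fps_expansion (f j \<Omega>) z2) n)" if "j \<le> M" for j n
        using Cb[of j z2 n] that r2 by (simp add: k_def)
    qed
    moreover have "fps_expansion (germ (b j \<Omega>) (linepath z1 z2)) z2 = fps_expansion (f j \<Omega>) z2"
      if "j \<le> M" "\<Omega> \<in> T k" for j \<Omega>
      by (rule fps_expansion_cong_on[OF B(1) z2]) (use f that Tk z2 in auto)
    then have eq: "spec_poly N M (\<lambda>l. fps_expansion (P_coeff a \<Omega> l) z2) (\<lambda>j. fps_expansion (f j \<Omega>) z2) =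
        spec_poly N M (\<lambda>l. fps_expansion (P_coeff a \<Omega> l) z2) (\<lambda>j. fps_expansion (germ (b j \<Omega>) (linepath z1 z2)) z2)"
      if "\<Omega> \<in> T k" for \<Omega>
      using that by (intro spec_poly_cong) auto
    \<comment> \<open>The two functions agree only on \<open>T k\<close>; closure under uniform
      limits on \<open>T k\<close> also transfers \<open>C k\<close> between functions that agree
      there.\<close>
    ultimately show "C k (\<lambda>\<Omega>. coeff (coeff (spec_poly N M (\<lambda>l. fps_expansion (P_coeff a \<Omega> l) z2)
        (\<lambda>j. fps_expansion (germ (b j \<Omega>) (linepath z1 z2)) z2)) p) q)"
      by (intro lim[of k]) (auto simp: eq intro!: exI)
  qed
qed

section \<open>Pulling back along the action\<close>

lemma is_pole_rescale_iff:
  fixes J c :: complex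
  assumes "J \<noteq> 0" "c \<noteq> 0"
  shows "is_pole (\<lambda>x. c * f (x / J)) z \<longleftrightarrow> is_pole f (z / J)"
proof -
  have *: "is_pole (\<lambda>x. g (x / I)) z" if "is_pole g (z / I)" "I \<noteq> 0" for g :: "complex \<Rightarrow> complex" and I z
  proof (rule is_pole_compose[OF that(1)])
    show "(\<lambda>x. x / I) \<midarrow>z\<rightarrow> z / I" using that(2) by (intro tendsto_intros)
    show "eventually (\<lambda>x. x / I \<noteq> z / I) (at z)"
      using that(2) by (auto simp: eventually_at intro!: exI[of _ 1])
  qed
  have "is_pole (\<lambda>x. f (x / J)) z \<longleftrightarrow> is_pole f (z / J)"
  proof
    assume "is_pole (\<lambda>x. f (x / J)) z"
    then have "is_pole (\<lambda>x. (\<lambda>x. f (x / J)) (x / inverse J)) (z / J)"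
      using assms by (intro *[of "\<lambda>x. f (x / J)"]) (simp_all add: divide_inverse mult.assoc)
    moreover have "(\<lambda>x. f (x / inverse J / J)) = f"
      using assms by (simp add: divide_inverse mult.assoc)
    ultimately show "is_pole f (z / J)" by simp
  qed (use * assms in blast)
  then show ?thesis using assms by simp
qed

lemma fps_expansion_rescale:
  fixes J c :: complex
  assumes "f analytic_on {z / J}" "J \<noteq> 0"
  shows "fps_nth (fps_expansion (\<lambda>x. c * f (x / J)) z) n = c * J powi (- int n) * fps_nth (fps_expansion f (z / J)) n"
proof -
  obtain T where T: "open T" "z / J \<in> T" "f holomorphic_on T"
    using assms(1) unfolding analytic_at by blast
  define S where "S = (\<lambda>x. x / J) -` T"
  have S: "open S" "z \<in> S"
    using T assms(2) by (auto simp: S_def intro!: open_vimage continuous_intros)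
  have an: "(\<lambda>x. f (x / J)) analytic_on {z}"
  proof -
    have "f \<circ> (\<lambda>x. x / J) holomorphic_on S"
      by (rule holomorphic_on_compose_gen[OF _ T(3)]) (use assms in \<open>auto simp: S_def intro!: holomorphic_intros\<close>)
    then have "(\<lambda>x. f (x / J)) holomorphic_on S" by (simp add: comp_def)
    then show ?thesis using S analytic_at by blast
  qed
  have "(deriv ^^ n) (\<lambda>w. f ((1 / J) * w)) z = (1 / J) ^ n * (deriv ^^ n) f ((1 / J) * z)"
    by (rule higher_deriv_compose_linear[OF T(3) S(1) T(1) S(2)]) (simp add: S_def)
  then have "fps_nth (fps_expansion (\<lambda>x. f (x / J)) z) n = J powi (- int n) * fps_nth (fps_expansion f (z / J)) n"
    by (simp add: fps_expansion_def power_int_minus power_inverse divide_inverse mult_ac)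
  moreover have "fps_expansion (\<lambda>x. c * f (x / J)) z = fps_const c * fps_expansion (\<lambda>x. f (x / J)) z"
    using fps_expansion_mult[of "\<lambda>_. c", OF _ an] by (simp add: fps_expansion_const)
  ultimately show ?thesis by simp
qed

lemma linepath_divide: "linepath x y t / J = linepath (x / J) (y / J) t" for J :: complex
  by (simp add: linepath_def add_divide_distrib scaleR_conv_of_real)

lemma joinpaths_divide: "(\<lambda>t. (\<gamma> +++ \<delta>) t / J) = (\<lambda>t. \<gamma> t / J) +++ (\<lambda>t. \<delta> t / (J :: complex))"
  by (auto simp: joinpaths_def fun_eq_iff)

lemma path_divide:
  fixes J :: complex
  assumes "path \<gamma>" "J \<noteq> 0" "path_image \<gamma> \<subseteq> (*) J ` S"
  shows "path (\<lambda>t. \<gamma> t / J)" "path_image (\<lambda>t. \<gamma> t / J) \<subseteq> S" "pathfinish (\<lambda>t. \<gamma> t / J) = pathfinish \<gamma> / J"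
  using assms by (auto simp: path_def path_image_def pathfinish_def image_subset_iff intro!: continuous_intros)

lemma germ_divide:
  "germ (\<lambda>\<gamma>. c * b (\<lambda>t. \<gamma> t / (J :: complex))) \<gamma> \<zeta> = c * germ b (\<lambda>t. \<gamma> t / J) (\<zeta> / J)"
  by (simp add: germ_def joinpaths_divide linepath_divide pathfinish_def)

lemma image_times_subset_iff:
  fixes J :: complex
  assumes "J \<noteq> 0"
  shows "z \<in> (*) J ` S \<longleftrightarrow> z / J \<in> S"
  using assms by (auto simp: image_iff intro!: bexI[of _ "z / J"])

lemma multivalued_analytic_divide:
  fixes J :: complex
  assumes b: "multivalued_analytic S b" and J: "J \<noteq> 0"
  shows "multivalued_analytic ((*) J ` S) (\<lambda>\<gamma>. c * b (\<lambda>t. \<gamma> t / J))"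
  unfolding multivalued_analytic_def
proof (intro conjI allI impI)
  fix \<gamma> \<delta> assume "homotopic_paths ((*) J ` S) \<gamma> \<delta>"
  then have "homotopic_paths S ((\<lambda>x. x / J) \<circ> \<gamma>) ((\<lambda>x. x / J) \<circ> \<delta>)"
    by (rule homotopic_paths_continuous_image) (use J in \<open>auto intro!: continuous_intros\<close>)
  then show "c * b (\<lambda>t. \<gamma> t / J) = c * b (\<lambda>t. \<delta> t / J)"
    using b by (simp add: multivalued_analytic_def comp_def)
next
  fix \<gamma> assume "path \<gamma> \<and> path_image \<gamma> \<subseteq> (*) J ` S"
  then have p: "path (\<lambda>t. \<gamma> t / J)" "path_image (\<lambda>t. \<gamma> t / J) \<subseteq> S" "pathfinish (\<lambda>t. \<gamma> t / J) = pathfinish \<gamma> / J"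
    using path_divide J by blast+
  have lin: "(\<lambda>\<zeta>. \<zeta> / J) analytic_on {pathfinish \<gamma>}"
    using J by (intro analytic_intros) auto
  from p have "germ b (\<lambda>t. \<gamma> t / J) analytic_on {pathfinish \<gamma> / J}"
    using b unfolding multivalued_analytic_def by metis
  then have "(\<lambda>\<zeta>. germ b (\<lambda>t. \<gamma> t / J) (\<zeta> / J)) analytic_on {pathfinish \<gamma>}"
    using analytic_on_compose_gen[OF lin] by (simp add: comp_def)
  then show "germ (\<lambda>\<gamma>. c * b (\<lambda>t. \<gamma> t / J)) \<gamma> analytic_on {pathfinish \<gamma>}"
    unfolding germ_divide[abs_def] by (intro analytic_intros)
qed

section \<open>The coefficients of the spectral polynomial\<close>

locale spectral_setup =
  fixes \<phi> :: "'g::finite \<Rightarrow> 'f::field_char_0 \<Rightarrow> real"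
    and \<Gamma> :: "('f^('n::finite + 'n)^('n + 'n)) set"
    and N M :: nat and K :: int
    and a :: "nat \<Rightarrow> complex^'n^'n^'g \<Rightarrow> complex \<Rightarrow> complex"
    and b :: "nat \<Rightarrow> complex^'n^'n^'g \<Rightarrow> (real \<Rightarrow> complex) \<Rightarrow> complex"
    and \<xi> :: "complex^'n^'n^'g \<Rightarrow> (real \<Rightarrow> complex) \<Rightarrow> complex fps"
    and A :: "complex^'n^'n^'g \<Rightarrow> complex fls"
  assumes embeddings: "totally_real_embeddings \<phi>"
    and congruence: "congruence_subgroup \<Gamma>"
    and N: "N \<ge> 1"
    and operator_P: "operator_P \<phi> \<Gamma> N a"
    and D_space: "D_space \<phi> \<Gamma> N a K M b"
    and BA: "baker_akhiezer N a \<xi>"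
    and eigen: "eigen_series N a \<xi> M b A"
begin

abbreviation wt :: "nat \<Rightarrow> nat \<Rightarrow> int" where
  "wt j k \<equiv> int N * K - int N * int j - K * int k"

lemmas P_generic = operator_P[unfolded operator_P_def, THEN conjunct1, rule_format]
lemmas P_meromorphic = operator_P[unfolded operator_P_def, THEN conjunct2, THEN conjunct1, rule_format]
lemmas P_weight = operator_P[unfolded operator_P_def, THEN conjunct2, THEN conjunct2, THEN conjunct1, rule_format]
lemmas P_Fourier = operator_P[unfolded operator_P_def, THEN conjunct2, THEN conjunct2, THEN conjunct2, rule_format]
lemmas Q_multivalued = D_space[unfolded D_space_def, THEN conjunct1, rule_format]
lemmas Q_weight = D_space[unfolded D_space_def, THEN conjunct2, THEN conjunct2, THEN conjunct1, rule_format]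
lemmas Q_generic = D_space[unfolded D_space_def, THEN conjunct2, THEN conjunct2, THEN conjunct2, THEN conjunct1, rule_format]
lemmas Q_Fourier = D_space[unfolded D_space_def, THEN conjunct2, THEN conjunct2, THEN conjunct2, THEN conjunct2, rule_format]

lemma meromorphic_a: "\<Omega> \<in> siegel_prod \<Longrightarrow> l \<in> {2..N} \<Longrightarrow> a l \<Omega> meromorphic_on UNIV"
  and analytic_a: "\<Omega> \<in> siegel_prod \<Longrightarrow> l \<in> {2..N} \<Longrightarrow> a l \<Omega> analytic_on {z. \<not> is_pole (a l \<Omega>) z}"
  using P_meromorphic by simp_all

lemma multivalued_b: "\<Omega> \<in> siegel_prod \<Longrightarrow> j \<le> M \<Longrightarrow> multivalued_analytic (- pole_set N a \<Omega>) (b j \<Omega>)"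
  by (rule Q_multivalued)

text \<open>A choice independent of any point or path. As soon as some path avoids the poles, the
  polynomial exists and is unique, so each such path computes the same value.\<close>

definition F :: "complex^'n^'n^'g \<Rightarrow> complex poly poly" where
  "F \<Omega> = (SOME G. eval_X N G = spectral_product N (A \<Omega>))"

lemma
  assumes \<Omega>: "\<Omega> \<in> siegel_prod" and \<gamma>: "path \<gamma>" "path_image \<gamma> \<subseteq> - pole_set N a \<Omega>"
  shows eval_X_F: "eval_X N (F \<Omega>) = spectral_product N (A \<Omega>)"
    and F_eq_spec_poly: "F \<Omega> = spec_poly N M (\<lambda>l. fps_expansion (P_coeff a \<Omega> l) (pathfinish \<gamma>))
      (\<lambda>j. fps_expansion (germ (b j \<Omega>) \<gamma>) (pathfinish \<gamma>))"
proof -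
  have eq: "eval_X N (spec_poly N M (\<lambda>l. fps_expansion (P_coeff a \<Omega> l) (pathfinish \<gamma>))
      (\<lambda>j. fps_expansion (germ (b j \<Omega>) \<gamma>) (pathfinish \<gamma>))) = spectral_product N (A \<Omega>)"
    by (rule spec_poly_eq_at[OF N _ _ BA eigen \<Omega> \<gamma>]) (use analytic_a multivalued_b \<Omega> in auto)
  then show *: "eval_X N (F \<Omega>) = spectral_product N (A \<Omega>)"
    unfolding F_def by (rule someI)
  show "F \<Omega> = spec_poly N M (\<lambda>l. fps_expansion (P_coeff a \<Omega> l) (pathfinish \<gamma>))
      (\<lambda>j. fps_expansion (germ (b j \<Omega>) \<gamma>) (pathfinish \<gamma>))"
    by (rule eval_X_inj[OF N]) (simp add: * eq)
qed

text \<open>The coefficients at the image point with the automorphy factor divided out. For \<alpha>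
  in \<Gamma> they reproduce \<open>a\<close> off its poles; for \<alpha> in \<open>SL_Z\<close>
  they are the functions whose Fourier expansions are assumed.\<close>

definition pull_a :: "'f^('n + 'n)^('n + 'n) \<Rightarrow> nat \<Rightarrow> complex^'n^'n^'g \<Rightarrow> complex \<Rightarrow> complex" where
  "pull_a \<alpha> l \<Omega> z = jfac \<phi> \<alpha> \<Omega> powi (- int l) * a l (act \<phi> \<alpha> \<Omega>) (z / jfac \<phi> \<alpha> \<Omega>)"

definition pull_b :: "'f^('n + 'n)^('n + 'n) \<Rightarrow> nat \<Rightarrow> complex^'n^'n^'g \<Rightarrow> (real \<Rightarrow> complex) \<Rightarrow> complex" where
  "pull_b \<alpha> j \<Omega> \<gamma> = jfac \<phi> \<alpha> \<Omega> powi (- K - int j + int M) * b j (act \<phi> \<alpha> \<Omega>) (\<lambda>t. \<gamma> t / jfac \<phi> \<alpha> \<Omega>)"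

section \<open>Pulled-back coefficients for a symplectic matrix\<close>

context
  fixes \<alpha> :: "'f^('n + 'n)^('n + 'n)" and \<Omega> :: "complex^'n^'n^'g"
  assumes \<alpha>: "\<alpha> \<in> Sp UNIV" and \<Omega>: "\<Omega> \<in> siegel_prod"
begin

lemma act_in: "act \<phi> \<alpha> \<Omega> \<in> siegel_prod" and J: "jfac \<phi> \<alpha> \<Omega> \<noteq> 0"
  using act_siegel_prod[OF embeddings \<alpha> \<Omega>] jfac_nonzero[OF embeddings \<alpha> \<Omega>] by auto

lemma pull_a_is_pole_iff: "is_pole (pull_a \<alpha> l \<Omega>) z \<longleftrightarrow> is_pole (a l (act \<phi> \<alpha> \<Omega>)) (z / jfac \<phi> \<alpha> \<Omega>)"
  unfolding pull_a_def[abs_def] using J by (intro is_pole_rescale_iff) auto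

lemma pull_a_pole_set: "- pole_set N (pull_a \<alpha>) \<Omega> = (*) (jfac \<phi> \<alpha> \<Omega>) ` (- pole_set N a (act \<phi> \<alpha> \<Omega>))"
proof (rule Set.set_eqI)
  fix z
  show "z \<in> - pole_set N (pull_a \<alpha>) \<Omega> \<longleftrightarrow> z \<in> (*) (jfac \<phi> \<alpha> \<Omega>) ` (- pole_set N a (act \<phi> \<alpha> \<Omega>))"
    unfolding image_times_subset_iff[OF J] poly_pole_set_iff pull_a_is_pole_iff ..
qed

lemma pull_a_meromorphic:
  assumes l: "l \<in> {2..N}"
  shows "pull_a \<alpha> l \<Omega> meromorphic_on UNIV"
proof -
  have "(\<lambda>z. a l (act \<phi> \<alpha> \<Omega>) (z / jfac \<phi> \<alpha> \<Omega>)) meromorphic_on UNIV"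
    by (rule meromorphic_on_compose[OF meromorphic_a[OF act_in l]]) (use J in \<open>auto intro!: analytic_intros\<close>)
  then show ?thesis
    unfolding pull_a_def[abs_def] by (intro meromorphic_intros)
qed

lemma pull_a_analytic:
  assumes l: "l \<in> {2..N}"
  shows "pull_a \<alpha> l \<Omega> analytic_on {z. \<not> is_pole (pull_a \<alpha> l \<Omega>) z}"
proof -
  have "(a l (act \<phi> \<alpha> \<Omega>)) \<circ> (\<lambda>z. z / jfac \<phi> \<alpha> \<Omega>) analytic_on {z. \<not> is_pole (pull_a \<alpha> l \<Omega>) z}"
    by (rule analytic_on_compose_gen[OF _ analytic_a[OF act_in l]])
       (use J in \<open>auto simp: pull_a_is_pole_iff intro!: analytic_intros\<close>)
  then show ?thesis
    unfolding pull_a_def[abs_def] comp_def by (intro analytic_intros)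
qed

lemma pull_b_multivalued:
  assumes j: "j \<le> M"
  shows "multivalued_analytic (- pole_set N (pull_a \<alpha>) \<Omega>) (pull_b \<alpha> j \<Omega>)"
  unfolding pull_a_pole_set pull_b_def[abs_def]
  by (rule multivalued_analytic_divide[OF multivalued_b[OF act_in j] J])

text \<open>The Taylor coefficients of the pulled-back data at \<open>z\<close> and of the original
  data at \<open>z / J\<close> differ by powers of \<open>J\<close> exactly as in the scaling lemma,
  where \<open>J\<close> is the automorphy factor.\<close>

lemma coeff_F_act:
  assumes \<gamma>: "path \<gamma>" "path_image \<gamma> \<subseteq> - pole_set N (pull_a \<alpha>) \<Omega>"
  defines "z \<equiv> pathfinish \<gamma>"
  shows "coeff (coeff (spec_poly N M (\<lambda>l. fps_expansion (P_coeff (pull_a \<alpha>) \<Omega> l) z)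
      (\<lambda>j. fps_expansion (germ (pull_b \<alpha> j \<Omega>) \<gamma>) z)) k) p =
    jfac \<phi> \<alpha> \<Omega> powi (- wt p k) * coeff (coeff (F (act \<phi> \<alpha> \<Omega>)) k) p"
proof -
  define J where "J = jfac \<phi> \<alpha> \<Omega>"
  have J0: "J \<noteq> 0" using J by (simp add: J_def)
  define \<delta> where "\<delta> = (\<lambda>t. \<gamma> t / J)"
  have \<delta>: "path \<delta>" "path_image \<delta> \<subseteq> - pole_set N a (act \<phi> \<alpha> \<Omega>)" "pathfinish \<delta> = z / J"
    using path_divide[OF \<gamma>(1) J0 \<gamma>(2)[unfolded pull_a_pole_set, folded J_def]] by (auto simp: \<delta>_def z_def)
  have zJ: "z / J \<in> - pole_set N a (act \<phi> \<alpha> \<Omega>)"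
    using \<delta>(2,3) pathfinish_in_path_image[of \<delta>] by auto
  have J1: "J powi (- 1) = inverse J" by (simp add: power_int_minus)
  show ?thesis
    unfolding F_eq_spec_poly[OF act_in \<delta>(1,2)] \<delta>(3) J_def[symmetric]
  proof (rule spec_poly_scale[OF N J0])
    fix l n assume l: "l \<le> N"
    have "P_coeff (pull_a \<alpha>) \<Omega> l = (\<lambda>x. J powi (- int l) * P_coeff a (act \<phi> \<alpha> \<Omega>) l (x / J))"
      by (auto simp: P_coeff_def pull_a_def J_def fun_eq_iff)
    moreover have "P_coeff a (act \<phi> \<alpha> \<Omega>) l analytic_on {z / J}"
    proof -
      have op: "open (- pole_set N a (act \<phi> \<alpha> \<Omega>))"
        by (rule open_Compl_pole_set) (rule analytic_a[OF act_in])
      have "P_coeff a (act \<phi> \<alpha> \<Omega>) l holomorphic_on - pole_set N a (act \<phi> \<alpha> \<Omega>)"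
        by (rule P_coeff_holomorphic[of N a]) (use analytic_a[OF act_in] l in auto)
      then show ?thesis using op zJ analytic_at by blast
    qed
    ultimately show "fps_nth (fps_expansion (P_coeff (pull_a \<alpha>) \<Omega> l) z) n =
        J powi (- int l - int n) * fps_nth (fps_expansion (P_coeff a (act \<phi> \<alpha> \<Omega>) l) (z / J)) n"
      using J0 by (simp add: fps_expansion_rescale power_int_add[OF disjI1[OF J0], of "- int l" "- int n", simplified])
  next
    fix j n assume j: "j \<le> M"
    have "germ (pull_b \<alpha> j \<Omega>) \<gamma> = (\<lambda>x. J powi (- K - int j + int M) * germ (b j (act \<phi> \<alpha> \<Omega>)) \<delta> (x / J))"
      unfolding pull_b_def[abs_def] J_def[symmetric] germ_divide[abs_def] \<delta>_def ..
    moreover have "germ (b j (act \<phi> \<alpha> \<Omega>)) \<delta> analytic_on {z / J}"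
      using multivalued_b[OF act_in j] \<delta> unfolding multivalued_analytic_def by metis
    ultimately show "fps_nth (fps_expansion (germ (pull_b \<alpha> j \<Omega>) \<gamma>) z) n =
        J powi (- K - int j + int M - int n) * fps_nth (fps_expansion (germ (b j (act \<phi> \<alpha> \<Omega>)) \<delta>) (z / J)) n"
      using J0 by (simp add: fps_expansion_rescale
          power_int_add[OF disjI1[OF J0], of "- K - int j + int M" "- int n", simplified])
  qed
qed

end

text \<open>For \<alpha> in \<Gamma> pulling back changes neither the \<open>a l\<close> nor the
  \<open>b j\<close> on a disc free of poles, so the scaling relation becomes one between values of
  \<open>F\<close> itself.\<close>

lemma coeff_F_automorphic:
  assumes \<alpha>: "\<alpha> \<in> \<Gamma>" and \<Omega>: "\<Omega> \<in> siegel_prod" and ne: "- pole_set N a \<Omega> \<noteq> {}"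
  shows "coeff (coeff (F (act \<phi> \<alpha> \<Omega>)) k) p = jfac \<phi> \<alpha> \<Omega> powi wt p k * coeff (coeff (F \<Omega>) k) p"
proof -
  have Sp: "\<alpha> \<in> Sp UNIV" using \<alpha> congruence unfolding congruence_subgroup_def by blast
  define J where "J = jfac \<phi> \<alpha> \<Omega>"
  have J0: "J \<noteq> 0" using J[OF Sp \<Omega>] by (simp add: J_def)
  have op: "open (- pole_set N a \<Omega>)"
    by (rule open_Compl_pole_set) (rule analytic_a[OF \<Omega>])
  obtain z where z: "z \<in> - pole_set N a \<Omega>" using ne by blast
  obtain r where r: "r > 0" "ball z r \<subseteq> - pole_set N a \<Omega>" using openE[OF op z] .
  have pa: "pull_a \<alpha> l \<Omega> x = a l \<Omega> x" if "l \<in> {2..N}" "x \<in> - pole_set N a \<Omega>" for l x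
  proof -
    have "a l (act \<phi> \<alpha> \<Omega>) (x / J) = J ^ l * a l \<Omega> x"
      unfolding J_def by (rule P_weight[OF that(1) \<alpha> \<Omega>]) (use that(2) in simp)
    then show ?thesis using J0 by (simp add: pull_a_def J_def[symmetric] power_int_minus)
  qed
  have pb: "pull_b \<alpha> j \<Omega> \<gamma> = b j \<Omega> \<gamma>" if "j \<le> M" "path \<gamma>" "path_image \<gamma> \<subseteq> - pole_set N a \<Omega>" for j \<gamma>
  proof -
    have "b j (act \<phi> \<alpha> \<Omega>) (\<lambda>t. \<gamma> t / J) * J ^ (M - j) = J powi K * b j \<Omega> \<gamma>"
      unfolding J_def by (rule Q_weight[OF that(1) \<alpha> \<Omega>]) (use that in simp)
    moreover have "J powi (- K - int j + int M) = J powi (- K) * J ^ (M - j)"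
    proof -
      have "- K - int j + int M = - K + int (M - j)" using that(1) by (simp add: of_nat_diff)
      then show ?thesis by (simp only: power_int_add[OF disjI1[OF J0]] power_int_of_nat)
    qed
    moreover have "J powi (- K) * J powi K = 1" using J0 by (simp add: power_int_minus)
    ultimately show ?thesis
      by (simp add: pull_b_def J_def[symmetric] mult_ac)
  qed
  \<comment> \<open>The weight condition gives only equality of values; as the original coefficients
    are holomorphic on the disc, this excludes poles of the pulled-back ones.\<close>
  have sub: "ball z r \<subseteq> - pole_set N (pull_a \<alpha>) \<Omega>"
  proof
    fix x assume x: "x \<in> ball z r"
    have "\<not> is_pole (pull_a \<alpha> l \<Omega>) x" if l: "l \<in> {2..N}" for l
    proof (rule not_is_pole_holomorphic)
      have "a l \<Omega> holomorphic_on ball z r"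
        using r(2) l by (intro analytic_imp_holomorphic analytic_on_subset[OF analytic_a[OF \<Omega> l]])
          (auto simp: pole_set_def)
      then show "pull_a \<alpha> l \<Omega> holomorphic_on ball z r"
        by (rule holomorphic_transform) (use r(2) pa[OF l] in auto)
    qed (use x in auto)
    then show "x \<in> - pole_set N (pull_a \<alpha>) \<Omega>" unfolding poly_pole_set_iff by blast
  qed
  have zz: "path_image (linepath z z) \<subseteq> - pole_set N a \<Omega>" "path_image (linepath z z) \<subseteq> - pole_set N (pull_a \<alpha>) \<Omega>"
    using subsetD[OF sub, of z] subsetD[OF r(2), of z] r(1) by simp_all
  have "fps_expansion (P_coeff (pull_a \<alpha>) \<Omega> l) z = fps_expansion (P_coeff a \<Omega> l) z" if "l \<le> N" for l
    by (rule fps_expansion_cong_on[of "ball z r"]) (use pa r that in \<open>auto simp: P_coeff_def\<close>)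
  moreover have "fps_expansion (germ (pull_b \<alpha> j \<Omega>) (linepath z z)) z = fps_expansion (germ (b j \<Omega>) (linepath z z)) z"
    if j: "j \<le> M" for j
  proof (rule fps_expansion_cong_on[of "ball z r"])
    fix x assume x: "x \<in> ball z r"
    have "closed_segment z x \<subseteq> ball z r" using x r(1) by (simp add: closed_segment_subset)
    then show "germ (pull_b \<alpha> j \<Omega>) (linepath z z) x = germ (b j \<Omega>) (linepath z z) x"
      unfolding germ_def using r z by (intro pb j) (auto simp: path_image_join)
  qed (use r in auto)
  ultimately have "spec_poly N M (\<lambda>l. fps_expansion (P_coeff (pull_a \<alpha>) \<Omega> l) z)
      (\<lambda>j. fps_expansion (germ (pull_b \<alpha> j \<Omega>) (linepath z z)) z) =
    spec_poly N M (\<lambda>l. fps_expansion (P_coeff a \<Omega> l) z) (\<lambda>j. fps_expansion (germ (b j \<Omega>) (linepath z z)) z)"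
    by (intro spec_poly_cong) auto
  then have eq: "coeff (coeff (F \<Omega>) k) p = J powi (- wt p k) * coeff (coeff (F (act \<phi> \<alpha> \<Omega>)) k) p"
    using coeff_F_act[OF Sp \<Omega> path_linepath zz(2), of k p] F_eq_spec_poly[OF \<Omega> path_linepath zz(1)]
    by (simp add: J_def)
  have inv: "J powi wt p k * J powi (- wt p k) = 1"
    using J0 by (simp only: power_int_minus) simp
  show ?thesis
    unfolding J_def[symmetric] eq mult.assoc[symmetric] inv by simp
qed

end

section \<open>Holomorphy of the coefficients near a given parameter\<close>

lemma sparse_family_avoid_ball:
  fixes E :: "'i \<Rightarrow> complex set"
  assumes "finite I" "\<And>i. i \<in> I \<Longrightarrow> E i sparse_in UNIV"
  obtains z r where "r > 0" "\<And>i. i \<in> I \<Longrightarrow> ball z r \<inter> E i = {}"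
proof -
  have "eventually (\<lambda>y. \<forall>i\<in>I. y \<notin> E i) (at 0)"
  proof (intro eventually_ball_finite[OF assms(1)] ballI)
    fix i assume "i \<in> I"
    then have "\<not> 0 islimpt E i" using assms(2) unfolding sparse_in_def by blast
    then show "eventually (\<lambda>y. y \<notin> E i) (at 0)" by (simp add: islimpt_iff_eventually)
  qed
  then obtain e where e: "e > 0" "\<And>y i. y \<noteq> 0 \<Longrightarrow> norm y < e \<Longrightarrow> i \<in> I \<Longrightarrow> y \<notin> E i"
    by (auto simp: eventually_at)
  \<comment> \<open>The exceptional sets do not accumulate at 0, so they miss a punctured disc; this
    ball off the centre lies inside it.\<close>
  have "y \<noteq> 0 \<and> norm y < e" if "y \<in> ball (of_real (e / 2)) (e / 4)" for y :: complex
  proof -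
    have d: "norm (of_real (e / 2) - y) < e / 4" using that by (simp add: dist_norm)
    have n: "norm (of_real (e / 2) :: complex) = e / 2" using e(1) by (simp only: norm_of_real)
    have "norm y \<le> norm (of_real (e / 2) :: complex) + norm (of_real (e / 2) - y)"
      using norm_triangle_ineq4[of "of_real (e / 2)" "of_real (e / 2) - y"] by simp
    moreover have "norm (of_real (e / 2) :: complex) \<le> norm (of_real (e / 2) - y) + norm y"
      using norm_triangle_ineq[of "of_real (e / 2) - y" y] by simp
    ultimately have "norm y < e" "norm y > 0" using d n e(1) by linarith+
    then show ?thesis by auto
  qed
  then have "ball (of_real (e / 2)) (e / 4) \<inter> E i = {}" if "i \<in> I" for i
    using e(2) that by blast
  then show ?thesis using that[of "e / 4" "of_real (e / 2)"] e(1) by simp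
qed

text \<open>Continuity at the centre gives a bound nearby, and an index \<open>k\<close> beyond this
  bound for which the balls have also shrunk into \<open>U\<close> serves both purposes.\<close>

lemma holomorphic_mv_locally_bounded:
  assumes f: "holomorphic_mv f (U \<inter> S)" and U: "open U" "x0 \<in> U" and x0: "x0 \<in> S" and \<delta>: "\<delta> > 0"
  shows "\<exists>k. \<forall>k'\<ge>k. (\<forall>x\<in>ball x0 (\<delta> / real (Suc k')) \<inter> S. x \<in> U \<and> norm (f x) \<le> real k) \<and>
    holomorphic_mv f (ball x0 (\<delta> / real (Suc k')) \<inter> S)"
proof -
  have cont: "continuous (at x0 within U \<inter> S) f"
    using holomorphic_mv_continuous[OF f] U x0 by blast
  obtain d where d: "d > 0" "\<And>x. x \<in> U \<inter> S \<Longrightarrow> dist x x0 < d \<Longrightarrow> dist (f x) (f x0) < 1"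
    using cont[unfolded continuous_within_eps_delta, rule_format, of 1] by auto
  obtain e where e: "e > 0" "ball x0 e \<subseteq> U" using U openE by blast
  define m where "m = min d e"
  have m: "m > 0" "m \<le> d" "m \<le> e" using d e by (auto simp: m_def)
  obtain k1 where k1: "\<delta> / m < real k1" using reals_Archimedean2 by blast
  obtain k2 where k2: "norm (f x0) + 1 < real k2" using reals_Archimedean2 by blast
  define k where "k = max k1 k2"
  have sub: "ball x0 (\<delta> / real (Suc k')) \<subseteq> ball x0 m" if "k' \<ge> k" for k'
  proof (rule subset_ball)
    have "\<delta> / m \<le> real (Suc k')" using k1 that by (simp add: k_def)
    then show "\<delta> / real (Suc k') \<le> m" using m \<delta> by (simp add: divide_le_eq mult.commute del: of_nat_Suc)
  qed
  have "x \<in> U \<and> norm (f x) \<le> real k" if "k' \<ge> k" "x \<in> ball x0 (\<delta> / real (Suc k')) \<inter> S" for k' x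
  proof -
    have x: "x \<in> ball x0 m" "x \<in> S" using sub[OF that(1)] that(2) by blast+
    then have "x \<in> U" using e m by auto
    moreover have "dist (f x) (f x0) < 1" using x m \<open>x \<in> U\<close> by (intro d) (auto simp: dist_commute)
    then have "norm (f x) \<le> norm (f x0) + 1"
      using norm_triangle_ineq2[of "f x" "f x0"] by (simp add: dist_norm)
    ultimately show ?thesis using k2 by (simp add: k_def)
  qed
  moreover have "holomorphic_mv f (ball x0 (\<delta> / real (Suc k')) \<inter> S)" if "k' \<ge> k" for k'
  proof (rule holomorphic_mv_subset[OF f])
    have "ball x0 m \<subseteq> U" using subset_ball[OF m(3), of x0] e(2) by blast
    then show "ball x0 (\<delta> / real (Suc k')) \<inter> S \<subseteq> U \<inter> S" using sub[OF that] by blast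
  qed
  ultimately show ?thesis by blast
qed

context spectral_setup
begin

text \<open>The exceptional sets depend on \<open>\<Omega>0\<close> only, so one disc avoids all of
  them; the neighbourhoods still depend on \<open>z\<close> and on the path, which the family
  argument overcomes on a ball around \<open>\<Omega>0\<close>. The point \<open>z\<close> also
  shows that the poles do not fill the plane.\<close>

lemma F_local:
  assumes \<Omega>0: "\<Omega>0 \<in> siegel_prod"
  shows "\<exists>U z. open U \<and> \<Omega>0 \<in> U \<and> z \<in> - pole_set N a \<Omega>0 \<and>
    (\<forall>p q. holomorphic_mv (\<lambda>\<Omega>. coeff (coeff (F \<Omega>) p) q) (U \<inter> siegel_prod))"
proof -
  obtain V where V: "open V" "siegel_prod = V \<inter> (sym_tuples :: (complex^'n^'n^'g) set)"
    by (rule siegel_prod_open)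
  obtain \<delta> where \<delta>: "\<delta> > 0" "ball \<Omega>0 \<delta> \<subseteq> V" using V \<Omega>0 openE by blast
  define T where "T k = ball \<Omega>0 (\<delta> / real (Suc k)) \<inter> siegel_prod" for k
  define C where "C k f = holomorphic_mv f (T k)" for k f
  have rad: "\<delta> / real (Suc k') \<le> \<delta> / real (Suc k)" if "k \<le> k'" for k k'
    using \<delta>(1) that by (intro divide_left_mono) auto
  have T: "T k' \<subseteq> T k" if "k \<le> k'" for k k'
    unfolding T_def using subset_ball[OF rad[OF that]] by blast
  have TS: "T k = ball \<Omega>0 (\<delta> / real (Suc k)) \<inter> sym_tuples" for k
    using subset_ball[OF rad[of 0 k], of \<Omega>0] \<delta>(2) by (auto simp: T_def V(2))
  have Tsub: "T k \<subseteq> siegel_prod" for k by (auto simp: T_def)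
  have "\<forall>l\<in>{2..N}. \<exists>E. E sparse_in UNIV \<and> (\<forall>z. z \<notin> E \<longrightarrow> (\<exists>U. open U \<and> \<Omega>0 \<in> U \<and>
      (\<forall>\<Omega>\<in>U \<inter> siegel_prod. z \<notin> pole_set N a \<Omega>) \<and> holomorphic_mv (\<lambda>\<Omega>. a l \<Omega> z) (U \<inter> siegel_prod)))"
    using P_generic[OF _ \<Omega>0] by blast
  then obtain E1 where E1: "\<And>l. l \<in> {2..N} \<Longrightarrow> E1 l sparse_in UNIV"
    "\<And>l z. l \<in> {2..N} \<Longrightarrow> z \<notin> E1 l \<Longrightarrow> \<exists>U. open U \<and> \<Omega>0 \<in> U \<and>
      (\<forall>\<Omega>\<in>U \<inter> siegel_prod. z \<notin> pole_set N a \<Omega>) \<and> holomorphic_mv (\<lambda>\<Omega>. a l \<Omega> z) (U \<inter> siegel_prod)"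
    by metis
  have "\<forall>j\<in>{..M}. \<exists>E. E sparse_in UNIV \<and> (\<forall>\<gamma>. path \<gamma> \<and> path_image \<gamma> \<inter> E = {} \<longrightarrow> (\<exists>U. open U \<and> \<Omega>0 \<in> U \<and>
      (\<forall>\<Omega>\<in>U \<inter> siegel_prod. path_image \<gamma> \<subseteq> - pole_set N a \<Omega>) \<and> holomorphic_mv (\<lambda>\<Omega>. b j \<Omega> \<gamma>) (U \<inter> siegel_prod)))"
    using Q_generic[OF _ \<Omega>0] by blast
  then obtain E2 where E2: "\<And>j. j \<in> {..M} \<Longrightarrow> E2 j sparse_in UNIV"
    "\<And>j \<gamma>. j \<in> {..M} \<Longrightarrow> path \<gamma> \<Longrightarrow> path_image \<gamma> \<inter> E2 j = {} \<Longrightarrow> \<exists>U. open U \<and> \<Omega>0 \<in> U \<and>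
      (\<forall>\<Omega>\<in>U \<inter> siegel_prod. path_image \<gamma> \<subseteq> - pole_set N a \<Omega>) \<and> holomorphic_mv (\<lambda>\<Omega>. b j \<Omega> \<gamma>) (U \<inter> siegel_prod)"
    by metis
  define E where "E i = (case i of Inl l \<Rightarrow> E1 l | Inr j \<Rightarrow> E2 j)" for i
  obtain w r where r: "r > 0" and E: "\<And>i. i \<in> Inl ` {2..N} \<union> Inr ` {..M} \<Longrightarrow> ball w r \<inter> E i = {}"
    by (rule sparse_family_avoid_ball[of "Inl ` {2..N} \<union> Inr ` {..M}" E]) (use E1 E2 in \<open>auto simp: E_def\<close>)
  have D1: "z \<notin> E1 l" if "l \<in> {2..N}" "z \<in> ball w r" for l z
    using E[of "Inl l"] that by (auto simp: E_def)
  have D2: "X \<inter> E2 j = {}" if "j \<in> {..M}" "X \<subseteq> ball w r" for j X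
    using E[of "Inr j"] that by (auto simp: E_def)
  have "\<exists>k z1 z2. (\<forall>\<Omega>\<in>T k. closed_segment z1 z2 \<subseteq> - pole_set N a \<Omega>) \<and>
    (\<forall>p q. C k (\<lambda>\<Omega>. coeff (coeff (spec_poly N M (\<lambda>l. fps_expansion (P_coeff a \<Omega> l) z2)
        (\<lambda>j. fps_expansion (germ (b j \<Omega>) (linepath z1 z2)) z2)) p) q))"
  proof (rule spec_poly_family[where T = T and C = C and a = a and b = b and D = "ball w r" and N = N and M = M, OF N T])
    show "fun_subring (C k)" for k
      unfolding C_def by (rule fun_subring_holomorphic_mv)
    show "C k' g" if "C k g" "k \<le> k'" for k k' g
      using holomorphic_mv_subset T that unfolding C_def by blast
    show "C k g" if "\<And>e. e > 0 \<Longrightarrow> \<exists>h. C k h \<and> (\<forall>x\<in>T k. norm (h x - g x) \<le> e)" for k g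
      using holomorphic_mv_uniform_limit[OF open_ball] that unfolding C_def TS by blast
    show "\<exists>k. \<forall>k'\<ge>k. (\<forall>\<Omega>\<in>T k'. z \<in> - pole_set N a \<Omega> \<longrightarrow> norm (a l \<Omega> z) \<le> real k) \<and>
        ((\<forall>\<Omega>\<in>T k'. z \<in> - pole_set N a \<Omega>) \<longrightarrow> C k' (\<lambda>\<Omega>. a l \<Omega> z))"
      if l: "l \<in> {2..N}" "z \<in> ball w r" for l z
    proof -
      obtain U where U: "open U" "\<Omega>0 \<in> U" "holomorphic_mv (\<lambda>\<Omega>. a l \<Omega> z) (U \<inter> siegel_prod)"
        using E1(2)[OF l(1) D1[OF l]] by blast
      show ?thesis
        using holomorphic_mv_locally_bounded[OF U(3,1,2) \<Omega>0 \<delta>(1)] unfolding C_def T_def by metis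
    qed
    show "\<exists>k. \<forall>k'\<ge>k. (\<forall>\<Omega>\<in>T k'. path_image \<gamma> \<subseteq> - pole_set N a \<Omega>) \<longrightarrow>
        (\<forall>\<Omega>\<in>T k'. norm (b j \<Omega> \<gamma>) \<le> real k) \<and> C k' (\<lambda>\<Omega>. b j \<Omega> \<gamma>)"
      if j: "j \<le> M" "path \<gamma>" "path_image \<gamma> \<subseteq> ball w r" for j \<gamma>
    proof -
      have j': "j \<in> {..M}" using j by simp
      obtain U where U: "open U" "\<Omega>0 \<in> U" "holomorphic_mv (\<lambda>\<Omega>. b j \<Omega> \<gamma>) (U \<inter> siegel_prod)"
        using E2(2)[OF j' j(2) D2[OF j' j(3)]] by blast
      show ?thesis
        using holomorphic_mv_locally_bounded[OF U(3,1,2) \<Omega>0 \<delta>(1)] unfolding C_def T_def by metis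
    qed
    show "ball w r \<noteq> {}" using r by simp
    show "a l \<Omega> meromorphic_on UNIV" "a l \<Omega> analytic_on {z. \<not> is_pole (a l \<Omega>) z}"
      if "l \<in> {2..N}" "\<Omega> \<in> T 0" for l \<Omega>
      using that Tsub[of 0] meromorphic_a analytic_a by blast+
    show "multivalued_analytic (- pole_set N a \<Omega>) (b j \<Omega>)" if "j \<le> M" "\<Omega> \<in> T 0" for j \<Omega>
      using that Tsub[of 0] multivalued_b by blast
  qed auto
  then obtain k z1 z2 where k: "\<And>\<Omega>. \<Omega> \<in> T k \<Longrightarrow> closed_segment z1 z2 \<subseteq> - pole_set N a \<Omega>"
    and Ck: "\<And>p q. C k (\<lambda>\<Omega>. coeff (coeff (spec_poly N M (\<lambda>l. fps_expansion (P_coeff a \<Omega> l) z2)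
        (\<lambda>j. fps_expansion (germ (b j \<Omega>) (linepath z1 z2)) z2)) p) q)"
    by blast
  have F: "F \<Omega> = spec_poly N M (\<lambda>l. fps_expansion (P_coeff a \<Omega> l) z2)
        (\<lambda>j. fps_expansion (germ (b j \<Omega>) (linepath z1 z2)) z2)" if "\<Omega> \<in> T k" for \<Omega>
    using F_eq_spec_poly[of \<Omega> "linepath z1 z2"] k[OF that] that Tsub by auto
  have "\<Omega>0 \<in> T k" using \<Omega>0 \<delta>(1) by (simp add: T_def)
  then have "z2 \<in> - pole_set N a \<Omega>0" using k by (auto simp del: ComplD)
  moreover have "holomorphic_mv (\<lambda>\<Omega>. coeff (coeff (F \<Omega>) p) q) (ball \<Omega>0 (\<delta> / real (Suc k)) \<inter> siegel_prod)" for p q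
    unfolding T_def[symmetric] using Ck[of p q, unfolded C_def] by (rule holomorphic_mv_cong[rotated]) (simp add: F)
  ultimately show ?thesis
    using \<delta>(1) by (intro exI[of _ "ball \<Omega>0 (\<delta> / real (Suc k))"] exI[of _ z2]) (auto simp del: of_nat_Suc)
qed

lemma F_holomorphic: "holomorphic_mv (\<lambda>\<Omega>. coeff (coeff (F \<Omega>) p) q) siegel_prod"
  using F_local by (intro holomorphic_mv_local) blast

lemma Compl_pole_set_nonempty: "\<Omega> \<in> siegel_prod \<Longrightarrow> - pole_set N a \<Omega> \<noteq> {}"
  using F_local by blast

end

section \<open>Expansions at the cusps\<close>

lemma periodic_int_multiple:
  fixes h :: "complex \<Rightarrow> complex"
  assumes per: "\<And>t. Im t > 0 \<Longrightarrow> h (t + of_nat m) = h t" and t: "Im t > 0"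
  shows "h (t + of_int n * of_nat m) = h t"
proof -
  have nat: "h (t + of_nat k * of_nat m) = h t" if "Im t > 0" for t k
  proof (induction k)
    case (Suc k)
    have "h (t + of_nat (Suc k) * of_nat m) = h ((t + of_nat k * of_nat m) + of_nat m)"
      by (simp add: algebra_simps)
    also have "\<dots> = h (t + of_nat k * of_nat m)" using that by (intro per) simp
    finally show ?case using Suc by simp
  qed simp
  show ?thesis
  proof (cases "n \<ge> 0")
    case True
    then show ?thesis using nat[OF t, of "nat n"] by simp
  next
    case False
    have "h ((t + of_int n * of_nat m) + of_nat (nat (- n)) * of_nat m) = h (t + of_int n * of_nat m)"
      using t by (intro nat) simp
    moreover have "(t + of_int n * of_nat m) + of_nat (nat (- n)) * of_nat m = t"
      using False by simp
    ultimately show ?thesis by simp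
  qed
qed

text \<open>The function descends to the punctured unit disc and is bounded near its centre, so it
  extends holomorphically. Its Taylor series converges on the whole disc, hence the expansion holds
  on the whole half plane although the bound is known only near the cusp.\<close>

lemma q_expansion:
  fixes h :: "complex \<Rightarrow> complex" and m k :: nat
  assumes m: "m > 0" and hol: "h holomorphic_on {t. Im t > 0}"
    and per: "\<And>t. Im t > real k \<Longrightarrow> h (t + of_nat m) = h t"
    and bd: "\<And>t. Im t > real k \<Longrightarrow> norm (h t) \<le> B"
  shows "\<exists>c. \<forall>t. Im t > 0 \<longrightarrow> (\<lambda>n. c n * exp (2 * of_real pi * \<i> * of_nat n * t / of_nat m)) sums h t"
proof -
  let ?H = "{t. Im t > 0}"
  have opH: "open ?H" by (simp add: open_halfspace_Im_gt)
  have conH: "connected ?H" by (intro convex_connected convex_halfspace_Im_gt)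
  \<comment> \<open>Periodicity high up spreads to the half plane by the identity theorem.\<close>
  have per': "h (t + of_nat m) = h t" if "Im t > 0" for t
  proof (rule analytic_continuation_open[of "{t. Im t > real k}" ?H "\<lambda>t. h (t + of_nat m)" h])
    show "(\<lambda>t. h (t + of_nat m)) holomorphic_on ?H"
    proof -
      have "h \<circ> (\<lambda>t. t + of_nat m) holomorphic_on ?H"
        by (rule holomorphic_on_compose_gen[OF _ hol]) (auto intro!: holomorphic_intros)
      then show ?thesis by (simp add: comp_def)
    qed
    have "\<i> * of_nat (Suc k) \<in> {t. Im t > real k}" by simp
    then show "{t. Im t > real k} \<noteq> {}" by blast
  qed (use opH conH hol per that in \<open>auto simp: open_halfspace_Im_gt\<close>)
  define \<kappa> :: complex where "\<kappa> = 2 * of_real pi * \<i> / of_nat m"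
  have \<kappa>: "\<kappa> \<noteq> 0" using m by (simp add: \<kappa>_def)
  have Re_\<kappa>: "Re (\<kappa> * t) = - (2 * pi / real m) * Im t" for t
    by (simp add: \<kappa>_def field_simps)
  have Im_pos: "Im t > y \<longleftrightarrow> norm (exp (\<kappa> * t)) < exp (- (2 * pi / real m) * y)" for t y
  proof -
    have "norm (exp (\<kappa> * t)) < exp (- (2 * pi / real m) * y) \<longleftrightarrow> (2 * pi / real m) * y < (2 * pi / real m) * Im t"
      by (simp only: norm_exp_eq_Re Re_\<kappa> exp_less_cancel_iff mult_minus_left neg_less_iff_less)
    also have "\<dots> \<longleftrightarrow> y < Im t"
      by (rule mult_less_cancel_left_pos) (use m in simp)
    finally show ?thesis by simp
  qed
  have hexp: "h t = h t'" if ex: "exp (\<kappa> * t) = exp (\<kappa> * t')" and imt: "Im t > 0" for t t'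
  proof -
    have "\<exists>n::int. \<kappa> * t' = \<kappa> * t + of_int (2 * n) * (of_real pi * \<i>)"
      using ex[symmetric] unfolding exp_eq by (simp add: mult.assoc)
    then obtain n :: int where "\<kappa> * t' = \<kappa> * t + of_int (2 * n) * (of_real pi * \<i>)" by blast
    also have "of_int (2 * n) * (of_real pi * \<i>) = \<kappa> * (of_int n * of_nat m)"
      using m by (simp add: \<kappa>_def)
    finally have "\<kappa> * t' = \<kappa> * (t + of_int n * of_nat m)" by (simp add: distrib_left)
    then have "t' = t + of_int n * of_nat m" using \<kappa> by simp
    then show ?thesis using periodic_int_multiple[where h = h and m = m, OF per' imt] by simp
  qed
  define g where "g q = h (Ln q / \<kappa>)" for q
  have Imq: "Im (Ln q / \<kappa>) > y \<longleftrightarrow> norm q < exp (- (2 * pi / real m) * y)" if "q \<noteq> 0" for q y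
    using Im_pos[of y "Ln q / \<kappa>"] that \<kappa> by simp
  have g: "g (exp (\<kappa> * t)) = h t" if "Im t > 0" for t
    unfolding g_def using that \<kappa> by (intro hexp[symmetric]) auto
  have ghol: "g holomorphic_on ball 0 1 - {0}"
  proof -
    have "g analytic_on {q}" if q: "q \<in> ball 0 1 - {0}" for q
    proof -
      \<comment> \<open>A branch of the logarithm near \<open>q\<close>, divided by \<kappa>. The
        quotient \<open>x / q\<close> stays in the right half plane, which avoids the cut of
        \<open>Ln\<close>; periodicity of \<open>h\<close> makes the choice of branch
        irrelevant.\<close>
      define l where "l x = (Ln (x / q) + Ln q) / \<kappa>" for x
      define W where "W = ball q (norm q) \<inter> ball 0 1"
      have Wq: "x \<noteq> 0 \<and> Re (x / q) > 0" if "x \<in> W" for x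
      proof -
        have "norm (1 - x / q) < 1"
        proof -
          have "1 - x / q = (q - x) / q" using q by (simp add: field_simps)
          then show ?thesis using that q by (simp add: W_def dist_norm norm_divide)
        qed
        then have "\<bar>Re (1 - x / q)\<bar> < 1" using abs_Re_le_cmod[of "1 - x / q"] by linarith
        then have "Re (x / q) > 0" by (auto simp del: Re_divide)
        then show ?thesis by auto
      qed
      have exl: "exp (\<kappa> * l x) = x" if "x \<in> W" for x
        using Wq[OF that] q \<kappa> by (simp add: l_def exp_add)
      have "x / q \<notin> \<real>\<^sub>\<le>\<^sub>0" if "x \<in> W" for x
        using Wq[OF that] by (auto simp: complex_nonpos_Reals_iff simp del: Re_divide)
      then have "l holomorphic_on W"
        unfolding l_def using \<kappa> q by (intro holomorphic_intros) auto
      moreover have l_im: "Im (l x) > 0" if "x \<in> W" for x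
        using Im_pos[of 0 "l x"] exl[OF that] that by (simp add: W_def)
      ultimately have "h \<circ> l holomorphic_on W"
        by (intro holomorphic_on_compose_gen[OF _ hol]) auto
      moreover have "(h \<circ> l) x = g x" if "x \<in> W" for x
        using g[OF l_im[OF that]] exl[OF that] by simp
      ultimately have "g holomorphic_on W" by (rule holomorphic_transform)
      moreover have "open W" "q \<in> W" using q by (auto simp: W_def)
      ultimately show ?thesis using analytic_at by blast
    qed
    then show ?thesis using analytic_imp_holomorphic analytic_on_analytic_at by blast
  qed
  have "\<exists>G. G holomorphic_on ball 0 1 \<and> (\<forall>q\<in>ball 0 1 - {0}. G q = g q)"
  proof -
    have "eventually (\<lambda>q. norm (g q) \<le> B) (at 0)"
      unfolding eventually_at
    proof (intro exI[of _ "exp (- (2 * pi / real m) * real k)"] conjI ballI impI)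
      fix q :: complex assume "q \<noteq> 0 \<and> dist q 0 < exp (- (2 * pi / real m) * real k)"
      then show "norm (g q) \<le> B" unfolding g_def using Imq[of q "real k"] by (intro bd) auto
    qed simp
    then show ?thesis
      using holomorphic_on_extend_bounded[OF ghol] by auto
  qed
  then obtain G where G: "G holomorphic_on ball 0 1" "\<And>q. q \<in> ball 0 1 - {0} \<Longrightarrow> G q = g q" by blast
  have "(\<lambda>n. (deriv ^^ n) G 0 / fact n * exp (2 * of_real pi * \<i> * of_nat n * t / of_nat m)) sums h t" if t: "Im t > 0" for t
  proof -
    have q: "exp (\<kappa> * t) \<in> ball 0 1" using Im_pos[of 0 t] t by simp
    have "(\<lambda>n. (deriv ^^ n) G 0 / fact n * (exp (\<kappa> * t) - 0) ^ n) sums G (exp (\<kappa> * t))"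
      by (rule holomorphic_power_series[OF G(1) q])
    moreover have "G (exp (\<kappa> * t)) = h t" using G(2) q g[OF t] by simp
    moreover have "exp (\<kappa> * t) ^ n = exp (2 * of_real pi * \<i> * of_nat n * t / of_nat m)" for n
      by (simp add: exp_of_nat_mult[symmetric] \<kappa>_def mult_ac)
    ultimately show ?thesis by simp
  qed
  then show ?thesis by (intro exI[of _ "\<lambda>n. (deriv ^^ n) G 0 / fact n"]) blast
qed

lemma has_derivative_vec:
  fixes f :: "'a::euclidean_space \<Rightarrow> 'b::euclidean_space^'n"
  assumes "\<And>i. ((\<lambda>x. f x $ i) has_derivative (\<lambda>x. f' x $ i)) (at a within S)"
  shows "(f has_derivative f') (at a within S)"
  unfolding has_derivative_componentwise_within[of f]
proof
  fix v :: "'b^'n" assume "v \<in> Basis"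
  then obtain i u where v: "v = axis i u" by (auto simp: Basis_vec_def)
  show "((\<lambda>x. f x \<bullet> v) has_derivative (\<lambda>x. f' x \<bullet> v)) (at a within S)"
    unfolding v inner_axis by (rule has_derivative_inner_left[OF assms])
qed

lemma holomorphic_mv_compose:
  fixes f :: "complex^'n::finite^'n^'g::finite \<Rightarrow> complex"
  assumes f: "holomorphic_mv f S" and U: "open U" and P: "\<And>t. t \<in> U \<Longrightarrow> P t \<in> S"
    and hol: "\<And>\<nu> i k. (\<lambda>t. P t $ \<nu> $ i $ k) holomorphic_on U"
  shows "(\<lambda>t. f (P t)) holomorphic_on U"
  unfolding holomorphic_on_open[OF U]
proof
  fix t assume t: "t \<in> U"
  define P' where "P' = (\<chi> \<nu> i k. deriv (\<lambda>t. P t $ \<nu> $ i $ k) t)"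
  have "((\<lambda>t. P t $ \<nu> $ i $ k) has_derivative (\<lambda>s. cscale s P' $ \<nu> $ i $ k)) (at t within U)" for \<nu> i k
  proof -
    have "((\<lambda>t. P t $ \<nu> $ i $ k) has_field_derivative deriv (\<lambda>t. P t $ \<nu> $ i $ k) t) (at t within U)"
      using holomorphic_derivI[OF hol U t] has_field_derivative_at_within by blast
    moreover have "(\<lambda>s. cscale s P' $ \<nu> $ i $ k) = (*) (deriv (\<lambda>t. P t $ \<nu> $ i $ k) t)"
      by (rule ext) (simp only: cscale_def P'_def vec_lambda_beta mult.commute)
    ultimately show ?thesis by (simp only: has_field_derivative_def)
  qed
  note entry = this
  have row: "((\<lambda>t. P t $ \<nu> $ i) has_derivative (\<lambda>s. cscale s P' $ \<nu> $ i)) (at t within U)" for \<nu> i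
    by (rule has_derivative_vec[of "\<lambda>t. P t $ \<nu> $ i", OF entry])
  have mat: "((\<lambda>t. P t $ \<nu>) has_derivative (\<lambda>s. cscale s P' $ \<nu>)) (at t within U)" for \<nu>
    by (rule has_derivative_vec[of "\<lambda>t. P t $ \<nu>", OF row])
  have "(P has_derivative (\<lambda>s. cscale s P')) (at t within U)"
    by (rule has_derivative_vec[of P, OF mat])
  moreover obtain D where D: "(f has_derivative D) (at (P t) within S)" "\<And>c X. D (cscale c X) = c * D X"
    using f P[OF t] unfolding holomorphic_mv_iff by blast
  have "(f has_derivative D) (at (P t) within P ` U)"
    by (rule has_derivative_subset[OF D(1)]) (use P in auto)
  ultimately have "((\<lambda>t. f (P t)) has_derivative (\<lambda>s. D (cscale s P'))) (at t within U)"
    by (rule has_derivative_in_compose)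
  moreover have "(\<lambda>s. D (cscale s P')) = (*) (D P')"
    by (simp add: fun_eq_iff D(2) mult.commute)
  ultimately have "((\<lambda>t. f (P t)) has_field_derivative D P') (at t within U)"
    by (simp add: has_field_derivative_def)
  then show "\<exists>f'. ((\<lambda>t. f (P t)) has_field_derivative f') (at t)"
    using at_within_open[OF t U] by auto
qed

section \<open>The case of one embedding and matrices of size one\<close>

definition const_tuple :: "complex \<Rightarrow> complex^'n^'n^'g" where
  "const_tuple t = (\<chi> \<nu> i k. t)"

locale singleton_indices =
  fixes n :: "'n::finite" and g :: "'g::finite"
  assumes n: "\<And>i::'n. i = n" and g: "\<And>\<nu>::'g. \<nu> = g"
begin

lemma UNIV_n: "(UNIV :: 'n set) = {n}" and UNIV_g: "(UNIV :: 'g set) = {g}"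
  using n g by blast+

lemma sum_n: "(\<Sum>i\<in>(UNIV :: 'n set). f i) = f n" and prod_g: "(\<Prod>\<nu>\<in>(UNIV :: 'g set). h \<nu>) = h g"
  by (simp_all add: UNIV_n UNIV_g)

lemma all_n: "(\<forall>i::'n. P i) \<longleftrightarrow> P n" and all_g: "(\<forall>\<nu>::'g. R \<nu>) \<longleftrightarrow> R g"
proof -
  have "P i" if "P n" for i using that n[of i] by simp
  then show "(\<forall>i::'n. P i) \<longleftrightarrow> P n" by blast
  have "R \<nu>" if "R g" for \<nu> using that g[of \<nu>] by simp
  then show "(\<forall>\<nu>::'g. R \<nu>) \<longleftrightarrow> R g" by blast
qed

lemma tau_eq: "tau (\<Omega> :: complex^'n^'n^'g) = \<Omega> $ g $ n $ n"
  unfolding tau_def all_n all_g by (rule the_equality) auto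

lemma const_tuple_tau: "const_tuple (tau \<Omega>) = (\<Omega> :: complex^'n^'n^'g)"
  by (simp add: vec_eq_iff const_tuple_def tau_eq all_n all_g)

lemma tau_const_tuple: "tau (const_tuple t :: complex^'n^'n^'g) = t"
  by (simp add: tau_eq const_tuple_def)

lemma const_tuple_siegel: "(const_tuple t :: complex^'n^'n^'g) \<in> siegel_prod \<longleftrightarrow> Im t > 0"
proof -
  have "(\<forall>x::real^'n. x \<noteq> 0 \<longrightarrow> 0 < x $ n * (Im t * x $ n)) \<longleftrightarrow> Im t > 0"
  proof
    assume *: "\<forall>x::real^'n. x \<noteq> 0 \<longrightarrow> 0 < x $ n * (Im t * x $ n)"
    have "((\<chi> i. 1) :: real^'n) \<noteq> 0" by (simp add: vec_eq_iff)
    then have "0 < ((\<chi> i. 1) :: real^'n) $ n * (Im t * ((\<chi> i. 1) :: real^'n) $ n)" using * by blast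
    then show "Im t > 0" by simp
  next
    assume "Im t > 0"
    have "0 < x $ n * (Im t * x $ n)" if "x \<noteq> 0" for x :: "real^'n"
    proof -
      have "x $ n \<noteq> 0" using that by (simp add: vec_eq_iff all_n)
      then have "0 < Im t * (x $ n)\<^sup>2" using \<open>Im t > 0\<close> by simp
      then show ?thesis by (simp add: power2_eq_square mult_ac)
    qed
    then show "\<forall>x::real^'n. x \<noteq> 0 \<longrightarrow> 0 < x $ n * (Im t * x $ n)" by blast
  qed
  then show ?thesis
    by (simp add: siegel_prod_def siegel_def all_g const_tuple_def vec_eq_iff Finite_Cartesian_Product.transpose_def
        inner_vec_def matrix_vector_mult_def sum_n)
qed

lemma det_n: "Determinants.det (A :: complex^'n^'n) = A $ n $ n"
proof -
  have "{p. p permutes {n}} = {id}" by (auto simp: permutes_sing)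
  then show ?thesis by (simp add: Determinants.det_def UNIV_n sign_id)
qed

lemma matrix_mult_n: "((A :: complex^'n^'n) ** B) $ i $ k = A $ n $ n * B $ n $ n"
  using n[of i] n[of k] by (simp add: matrix_matrix_mult_def sum_n)

lemma matrix_inv_n:
  assumes "invertible (A :: complex^'n^'n)"
  shows "matrix_inv A $ n $ n = 1 / A $ n $ n"
proof -
  have "A ** matrix_inv A = mat 1"
    using someI_ex[OF assms[unfolded invertible_def]] by (simp add: matrix_inv_def)
  then have "(A ** matrix_inv A) $ n $ n = 1" by (simp add: Finite_Cartesian_Product.mat_def)
  then have eq: "A $ n $ n * matrix_inv A $ n $ n = 1" by (simp add: matrix_mult_n)
  then have "A $ n $ n \<noteq> 0" by auto
  with eq show ?thesis by (simp add: eq_divide_eq mult.commute)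
qed

text \<open>In size two, conjugating \<open>J_mat\<close> in this way multiplies it by the
  determinant.\<close>

lemma SL_Z_subset_Sp: "SL_Z \<subseteq> (Sp UNIV :: ('f::field_char_0^('n + 'n)^('n + 'n)) set)"
proof
  fix \<alpha> :: "'f^('n + 'n)^('n + 'n)"
  assume "\<alpha> \<in> SL_Z"
  then have det1: "Determinants.det \<alpha> = 1" by (simp add: SL_Z_def)
  have U: "(UNIV :: ('n + 'n) set) = {Inl n, Inr n}"
  proof (rule UNIV_eq_I)
    fix x :: "'n + 'n"
    show "x \<in> {Inl n, Inr n}"
    proof (cases x)
      case (Inl i)
      then show ?thesis using n[of i] by simp
    next
      case (Inr i)
      then show ?thesis using n[of i] by simp
    qed
  qed
  have all: "(\<forall>p::'n + 'n. P p) \<longleftrightarrow> P (Inl n) \<and> P (Inr n)" for P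
  proof -
    have "p = Inl n \<or> p = Inr n" for p :: "'n + 'n" using U by blast
    then show ?thesis by metis
  qed
  have det: "Determinants.det \<alpha> = \<alpha> $ Inl n $ Inl n * \<alpha> $ Inr n $ Inr n - \<alpha> $ Inl n $ Inr n * \<alpha> $ Inr n $ Inl n"
  proof -
    have f12: "finite {Inr n :: 'n + 'n}" "(Inl n :: 'n + 'n) \<notin> {Inr n}" by auto
    show ?thesis
      unfolding Determinants.det_def U
      unfolding sum_over_permutations_insert[OF f12]
      unfolding permutes_sing
      by (simp add: sign_swap_id sign_id swap_id_eq)
  qed
  have "invertible \<alpha>" using det1 by (simp add: invertible_det_nz)
  moreover have "Finite_Cartesian_Product.transpose \<alpha> ** J_mat ** \<alpha> = J_mat"
    using det1 unfolding det
    by (simp add: vec_eq_iff all matrix_matrix_mult_def Finite_Cartesian_Product.transpose_def J_mat_def sum_UNIV_Plus sum_n algebra_simps)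
  ultimately show "\<alpha> \<in> Sp UNIV"
    by (auto simp: Sp_def entries_in_def invertible_def)
qed

end

text \<open>A ring homomorphism from the rationals is unique, so the injective family \<phi> of
  embeddings has only one index.\<close>

lemma elliptic_singleton:
  fixes \<phi> :: "'g::finite \<Rightarrow> 'f::field_char_0 \<Rightarrow> real"
  assumes \<phi>: "totally_real_embeddings \<phi>" and ell: "elliptic_case TYPE('f^('n::finite + 'n)^('n + 'n))"
  shows "\<exists>(n :: 'n) (g :: 'g). singleton_indices n g"
proof -
  note hom = totally_real_embeddingsD[OF \<phi>]
  have rats: "(UNIV :: 'f set) = \<rat>" and card: "CARD('n) = 1" using ell by (auto simp: elliptic_case_def)
  obtain n :: 'n where n: "UNIV = {n}" using card by (auto simp: card_1_singleton_iff)
  have nat: "\<phi> \<nu> (of_nat k) = of_nat k" for \<nu> k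
    by (induction k) (simp_all add: hom)
  have int: "\<phi> \<nu> (of_int k) = of_int k" for \<nu> k
    by (cases k) (simp_all add: nat hom add: of_nat_Suc[symmetric] del: of_nat_Suc)
  have "\<phi> \<nu> x = \<phi> \<mu> x" for \<nu> \<mu> x
  proof -
    have "x \<in> \<rat>" using rats by blast
    then obtain p q where "q > 0" and x: "x = of_int p / of_int q" by (rule Rats_cases')
    then have pq: "q \<noteq> 0" "x = of_int p / of_int q" by simp_all
    have "\<phi> \<nu> x * of_int q = of_int p" for \<nu>
    proof -
      have "\<phi> \<nu> x * of_int q = \<phi> \<nu> (x * of_int q)" by (simp add: hom int)
      also have "x * of_int q = of_int p" using pq by simp
      finally show ?thesis by (simp add: int)
    qed
    then have "\<phi> \<nu> x * of_int q = \<phi> \<mu> x * of_int q" by simp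
    then show ?thesis using pq(1) by simp
  qed
  then have "\<phi> \<nu> = \<phi> \<mu>" for \<nu> \<mu> by (simp add: fun_eq_iff)
  moreover have "inj \<phi>" using \<phi> by (simp add: totally_real_embeddings_def)
  ultimately have "\<nu> = \<mu>" for \<nu> \<mu> :: 'g by (simp add: inj_eq)
  moreover have "i = n" for i :: 'n using n by auto
  ultimately have "singleton_indices n (undefined :: 'g)" by unfold_locales
  then show ?thesis by blast
qed

text \<open>Convergence at one point bounds the terms there. Raising the imaginary part by 1
  multiplies the \<open>k\<close>-th term by at most \<open>\<rho> ^ k\<close> with
  \<open>\<rho> < 1\<close>, so a geometric series dominates uniformly.\<close>

lemma qpow_summable_bounded:
  fixes \<Omega>1 :: "complex^'n^'n^'g"
  assumes m: "m > 0" and s: "summable (\<lambda>k. c k * qpow m k \<Omega>1)"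
  shows "\<exists>B. \<forall>\<Omega> :: complex^'n^'n^'g. Im (tau \<Omega>) \<ge> Im (tau \<Omega>1) + 1 \<longrightarrow> norm (\<Sum>k. c k * qpow m k \<Omega>) \<le> B"
proof -
  define \<rho> where "\<rho> = exp (- (2 * pi / real m))"
  have \<rho>: "0 < \<rho>" "\<rho> < 1" using m by (simp_all add: \<rho>_def)
  have nq: "norm (qpow m k \<Omega>) = exp (- (2 * pi * real k / real m) * Im (tau \<Omega>))" for k and \<Omega> :: "complex^'n^'n^'g"
    by (simp add: qpow_def norm_exp_eq_Re)
  obtain B0 where B0: "\<And>k. norm (c k * qpow m k \<Omega>1) \<le> B0"
    using summable_imp_Bseq[OF s] by (auto simp: Bseq_def)
  have B0_nonneg: "B0 \<ge> 0" using B0[of 0] norm_ge_zero order_trans by blast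
  have le: "norm (c k * qpow m k \<Omega>) \<le> B0 * \<rho> ^ k" if "Im (tau \<Omega>) \<ge> Im (tau \<Omega>1) + 1" for k and \<Omega> :: "complex^'n^'n^'g"
  proof -
    have "norm (qpow m k \<Omega>) \<le> norm (qpow m k \<Omega>1) * \<rho> ^ k"
    proof -
      have "\<rho> ^ k = exp (- (2 * pi * real k / real m))"
        by (simp add: \<rho>_def exp_of_nat_mult[symmetric] mult_ac)
      moreover have "- (2 * pi * real k / real m) * Im (tau \<Omega>) \<le>
          - (2 * pi * real k / real m) * Im (tau \<Omega>1) + - (2 * pi * real k / real m)"
      proof -
        have "(2 * pi * real k / real m) * (Im (tau \<Omega>1) + 1) \<le> (2 * pi * real k / real m) * Im (tau \<Omega>)"
          using that by (intro mult_left_mono) auto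
        then show ?thesis unfolding distrib_left mult_1_right mult_minus_left by linarith
      qed
      ultimately show ?thesis unfolding nq by (simp only: exp_add[symmetric] exp_le_cancel_iff)
    qed
    then have "norm (c k * qpow m k \<Omega>) \<le> norm (c k) * (norm (qpow m k \<Omega>1) * \<rho> ^ k)"
      unfolding norm_mult by (intro mult_left_mono) auto
    also have "\<dots> = norm (c k * qpow m k \<Omega>1) * \<rho> ^ k" by (simp add: norm_mult)
    also have "\<dots> \<le> B0 * \<rho> ^ k" using B0 \<rho> by (intro mult_right_mono) auto
    finally show ?thesis .
  qed
  have sm: "summable (\<lambda>k. B0 * \<rho> ^ k)" using \<rho> by (intro summable_mult summable_geometric) simp
  show ?thesis
    by (intro exI[of _ "\<Sum>k. B0 * \<rho> ^ k"] allI impI norm_suminf_le le sm)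
qed

section \<open>Bounded periodic functions near the cusp\<close>

context singleton_indices
begin

definition cusp_nbhd :: "nat \<Rightarrow> (complex^'n^'n^'g) set" where
  "cusp_nbhd k = {\<Omega> \<in> siegel_prod. Im (tau \<Omega>) > real k}"

text \<open>Stands in for the existence of a \<open>q\<close>-expansion. It is visibly stable under
  ring operations and uniform limits, with no series to multiply; the expansion is recovered at the
  end for a function that is also holomorphic.\<close>

definition cusp_regular :: "nat \<Rightarrow> nat \<Rightarrow> (complex^'n^'n^'g \<Rightarrow> complex) \<Rightarrow> bool" where
  "cusp_regular m k f \<longleftrightarrow> (\<exists>B. \<forall>\<Omega>\<in>cusp_nbhd k. norm (f \<Omega>) \<le> B) \<and>
     (\<forall>\<Omega>\<in>cusp_nbhd k. f (const_tuple (tau \<Omega> + of_nat m)) = f \<Omega>)"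

lemma siegel_iff: "(\<Omega> :: complex^'n^'n^'g) \<in> siegel_prod \<longleftrightarrow> Im (tau \<Omega>) > 0"
  using const_tuple_siegel[of "tau \<Omega>"] by (simp add: const_tuple_tau)

lemma cusp_nbhd_shift: "\<Omega> \<in> cusp_nbhd k \<Longrightarrow> const_tuple (tau \<Omega> + of_nat m) \<in> cusp_nbhd k"
  by (simp add: cusp_nbhd_def siegel_iff tau_const_tuple)

lemma cusp_nbhd_nonempty: "cusp_nbhd k \<noteq> {}"
proof -
  have "const_tuple (\<i> * of_nat (Suc k)) \<in> cusp_nbhd k"
    by (simp add: cusp_nbhd_def siegel_iff tau_const_tuple)
  then show ?thesis by blast
qed

lemma cusp_nbhd_antimono: "k \<le> k' \<Longrightarrow> cusp_nbhd k' \<subseteq> cusp_nbhd k"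
  by (auto simp: cusp_nbhd_def)

lemma cusp_regular_mono: "cusp_regular m k f \<Longrightarrow> k \<le> k' \<Longrightarrow> cusp_regular m k' f"
  using cusp_nbhd_antimono[of k k'] unfolding cusp_regular_def by blast

lemma fun_subring_cusp_regular: "fun_subring (cusp_regular m k)"
  unfolding fun_subring_def
proof (intro conjI allI impI)
  show "cusp_regular m k (\<lambda>_. c)" for c by (auto simp: cusp_regular_def)
  fix f g assume f: "cusp_regular m k f" and g: "cusp_regular m k g"
  obtain A B where A: "\<And>\<Omega>. \<Omega> \<in> cusp_nbhd k \<Longrightarrow> norm (f \<Omega>) \<le> A" and B: "\<And>\<Omega>. \<Omega> \<in> cusp_nbhd k \<Longrightarrow> norm (g \<Omega>) \<le> B"
    using f g unfolding cusp_regular_def by blast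
  have "\<forall>\<Omega>\<in>cusp_nbhd k. norm (f \<Omega> + g \<Omega>) \<le> A + B"
    using A B by (auto intro: norm_triangle_mono)
  then show "cusp_regular m k (\<lambda>x. f x + g x)"
    using f g unfolding cusp_regular_def by auto
  have "\<forall>\<Omega>\<in>cusp_nbhd k. norm (f \<Omega> * g \<Omega>) \<le> A * B"
    using A B by (auto simp: norm_mult intro!: mult_mono intro: order_trans[OF norm_ge_zero])
  then show "cusp_regular m k (\<lambda>x. f x * g x)"
    using f g unfolding cusp_regular_def by auto
qed

lemma cusp_regular_limit:
  assumes "\<And>e. e > 0 \<Longrightarrow> \<exists>f. cusp_regular m k f \<and> (\<forall>\<Omega>\<in>cusp_nbhd k. norm (f \<Omega> - h \<Omega>) \<le> e)"
  shows "cusp_regular m k h"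
  unfolding cusp_regular_def
proof (intro conjI ballI)
  obtain f B where f: "\<forall>\<Omega>\<in>cusp_nbhd k. norm (f \<Omega> - h \<Omega>) \<le> 1" "\<forall>\<Omega>\<in>cusp_nbhd k. norm (f \<Omega>) \<le> B"
    using assms[of 1] unfolding cusp_regular_def by auto
  have "norm (h \<Omega>) \<le> B + 1" if "\<Omega> \<in> cusp_nbhd k" for \<Omega>
    using norm_triangle_ineq4[of "f \<Omega>" "f \<Omega> - h \<Omega>"] f that by force
  then show "\<exists>B. \<forall>\<Omega>\<in>cusp_nbhd k. norm (h \<Omega>) \<le> B" by blast
next
  fix \<Omega> assume \<Omega>: "\<Omega> \<in> cusp_nbhd k"
  let ?\<Omega>' = "const_tuple (tau \<Omega> + of_nat m)"
  have "norm (h ?\<Omega>' - h \<Omega>) \<le> e" if e: "e > 0" for e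
  proof -
    obtain f where f: "cusp_regular m k f" "\<forall>\<Omega>\<in>cusp_nbhd k. norm (f \<Omega> - h \<Omega>) \<le> e / 2"
      using assms[of "e / 2"] e by auto
    have "h ?\<Omega>' - h \<Omega> = (f \<Omega> - h \<Omega>) - (f ?\<Omega>' - h ?\<Omega>')"
      using f(1) \<Omega> unfolding cusp_regular_def by simp
    also have "norm \<dots> \<le> norm (f \<Omega> - h \<Omega>) + norm (f ?\<Omega>' - h ?\<Omega>')" by (rule norm_triangle_ineq4)
    also have "\<dots> \<le> e / 2 + e / 2"
      by (intro add_mono) (use f(2) \<Omega> cusp_nbhd_shift in auto)
    finally show ?thesis by simp
  qed
  then have "norm (h ?\<Omega>' - h \<Omega>) \<le> 0" by (rule field_le_epsilon[of _ 0, simplified])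
  then show "h ?\<Omega>' = h \<Omega>" by simp
qed

text \<open>\<open>R\<close> stands for avoiding the poles, the only situation in which the series
  is known to represent \<open>f\<close>. One point where it converges gives the bound further up.
  Passing to a multiple \<open>m'\<close> of \<open>m\<close> gives functions with different
  denominators a common period.\<close>

lemma cusp_regular_of_q_series:
  assumes m: "m > 0" "m dvd m'"
    and s: "\<And>\<Omega>. \<Omega> \<in> siegel_prod \<Longrightarrow> Im (tau \<Omega>) > r \<Longrightarrow> R \<Omega> \<Longrightarrow> (\<lambda>k. c k * qpow m k \<Omega>) sums f \<Omega>"
  shows "\<exists>k. \<forall>k'\<ge>k. (\<forall>\<Omega>\<in>cusp_nbhd k'. R \<Omega> \<longrightarrow> norm (f \<Omega>) \<le> real k) \<and>
    ((\<forall>\<Omega>\<in>cusp_nbhd k'. R \<Omega>) \<longrightarrow> cusp_regular m' k' f)"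
proof (cases "\<exists>\<Omega>1\<in>siegel_prod. Im (tau \<Omega>1) > r \<and> R \<Omega>1")
  case True
  then obtain \<Omega>1 where \<Omega>1: "\<Omega>1 \<in> siegel_prod" "Im (tau \<Omega>1) > r" "R \<Omega>1" by blast
  obtain B where B: "\<And>\<Omega>. Im (tau \<Omega>) \<ge> Im (tau \<Omega>1) + 1 \<Longrightarrow> norm (\<Sum>k. c k * qpow m k (\<Omega> :: complex^'n^'n^'g)) \<le> B"
    using qpow_summable_bounded[OF m(1) sums_summable[OF s[OF \<Omega>1]]] by blast
  obtain k where k: "max B (Im (tau \<Omega>1) + 1) < real k" using reals_Archimedean2 by blast
  have sk: "(\<lambda>i. c i * qpow m i \<Omega>) sums f \<Omega>" "norm (f \<Omega>) \<le> real k" if "k' \<ge> k" "\<Omega> \<in> cusp_nbhd k'" "R \<Omega>" for k' \<Omega>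
  proof -
    have im: "\<Omega> \<in> siegel_prod" "Im (tau \<Omega>) > real k'" using that by (auto simp: cusp_nbhd_def)
    have kk: "real k \<le> real k'" using that by simp
    show sm: "(\<lambda>i. c i * qpow m i \<Omega>) sums f \<Omega>"
      using im kk k \<Omega>1 that by (intro s) auto
    have "norm (\<Sum>i. c i * qpow m i \<Omega>) \<le> B" using im kk k by (intro B) auto
    then show "norm (f \<Omega>) \<le> real k" using k sums_unique[OF sm] by simp
  qed
  have qp: "qpow m i (const_tuple (tau \<Omega> + of_nat m') :: complex^'n^'n^'g) = qpow m i \<Omega>" for i and \<Omega> :: "complex^'n^'n^'g"
  proof -
    obtain d where d: "m' = m * d" using m(2) by (auto simp: dvd_def)
    have "2 * of_real pi * \<i> * of_nat i * (tau \<Omega> + of_nat m') / of_nat m =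
        2 * of_real pi * \<i> * of_nat i * tau \<Omega> / of_nat m + of_int (2 * int (i * d)) * (of_real pi * \<i>)"
      using m(1) by (simp add: d field_simps)
    then have "exp (2 * of_real pi * \<i> * of_nat i * (tau \<Omega> + of_nat m') / of_nat m) =
        exp (2 * of_real pi * \<i> * of_nat i * tau \<Omega> / of_nat m)"
      unfolding exp_eq by (intro exI[of _ "int (i * d)"]) (simp add: mult_ac)
    then show ?thesis by (simp add: qpow_def tau_const_tuple)
  qed
  have reg: "cusp_regular m' k' f" if k': "k' \<ge> k" and R: "\<forall>\<Omega>\<in>cusp_nbhd k'. R \<Omega>" for k'
    unfolding cusp_regular_def
  proof (intro conjI ballI)
    show "\<exists>B. \<forall>\<Omega>\<in>cusp_nbhd k'. norm (f \<Omega>) \<le> B" using sk(2)[OF k'] R by blast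
    fix \<Omega> assume \<Omega>: "\<Omega> \<in> cusp_nbhd k'"
    have "R (const_tuple (tau \<Omega> + of_nat m'))" using R cusp_nbhd_shift[OF \<Omega>] by blast
    from sk(1)[OF k' cusp_nbhd_shift[OF \<Omega>] this]
    have "(\<lambda>i. c i * qpow m i \<Omega>) sums f (const_tuple (tau \<Omega> + of_nat m'))" unfolding qp .
    moreover have "(\<lambda>i. c i * qpow m i \<Omega>) sums f \<Omega>" using sk(1)[OF k' \<Omega>] R \<Omega> by blast
    ultimately show "f (const_tuple (tau \<Omega> + of_nat m')) = f \<Omega>" by (rule sums_unique2)
  qed
  show ?thesis
  proof (intro exI[of _ k] allI impI conjI ballI)
    show "norm (f \<Omega>) \<le> real k" if "k' \<ge> k" "\<Omega> \<in> cusp_nbhd k'" "R \<Omega>" for k' \<Omega>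
      by (rule sk(2)[OF that])
    show "cusp_regular m' k' f" if "k' \<ge> k" "\<forall>\<Omega>\<in>cusp_nbhd k'. R \<Omega>" for k'
      by (rule reg[OF that])
  qed
next
  \<comment> \<open>No point beyond \<open>r\<close> satisfies \<open>R\<close>. Far enough up the
    bound is vacuous, and the premise of the regularity claim fails because the neighbourhoods of
    the cusp are nonempty.\<close>
  case False
  obtain k where k: "r < real k" using reals_Archimedean2 by blast
  have nR: "\<not> R \<Omega>" if "k' \<ge> k" "\<Omega> \<in> cusp_nbhd k'" for k' \<Omega>
  proof -
    have "real k \<le> real k'" using that by simp
    then show ?thesis using that k False by (auto simp: cusp_nbhd_def)
  qed
  show ?thesis
  proof (intro exI[of _ k] allI impI conjI ballI)
    show "norm (f \<Omega>) \<le> real k" if "k' \<ge> k" "\<Omega> \<in> cusp_nbhd k'" "R \<Omega>" for k' \<Omega>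
      using nR[OF that(1,2)] that(3) by blast
    fix k' assume k': "k' \<ge> k" and R: "\<forall>\<Omega>\<in>cusp_nbhd k'. R \<Omega>"
    obtain \<Omega> where "\<Omega> \<in> cusp_nbhd k'" using cusp_nbhd_nonempty by blast
    then show "cusp_regular m' k' f" using nR[OF k'] R by blast
  qed
qed

end

context spectral_setup
begin

text \<open>The family argument, for the pulled-back coefficients on neighbourhoods of the cusp,
  shows the transformed coefficient of \<open>F\<close> to be bounded and periodic near the cusp.
  Holomorphy on the entire half plane is known separately, and together they give the
  expansion.\<close>

lemma F_expansion_at_cusp:
  assumes ell: "elliptic_case TYPE('f^('n + 'n)^('n + 'n))" and SL: "\<alpha> \<in> SL_Z"
  shows "\<exists>m>0. \<exists>c. \<forall>\<Omega>\<in>siegel_prod. (\<lambda>i. c i * qpow m i \<Omega>) sums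
    (jfac \<phi> \<alpha> \<Omega> powi (- wt p k) * coeff (coeff (F (act \<phi> \<alpha> \<Omega>)) k) p)"
proof -
  obtain n :: 'n and g :: 'g where "singleton_indices n g" using elliptic_singleton[OF embeddings ell] by blast
  then interpret singleton_indices n g .
  have \<alpha>: "\<alpha> \<in> Sp UNIV" using SL_Z_subset_Sp SL by blast
  have "\<forall>l\<in>{2..N}. \<exists>m>0. \<exists>c :: nat \<Rightarrow> complex \<Rightarrow> complex. \<forall>z. \<exists>r. \<forall>\<Omega>\<in>siegel_prod. Im (tau \<Omega>) > r \<longrightarrow>
      z \<in> - pole_set N (pull_a \<alpha>) \<Omega> \<longrightarrow> (\<lambda>k. c k z * qpow m k \<Omega>) sums pull_a \<alpha> l \<Omega> z"
  proof
    fix l assume l: "l \<in> {2..N}"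
    obtain m c where "m > 0" and mc: "\<forall>z. \<exists>r. \<forall>\<Omega>\<in>siegel_prod. Im (tau \<Omega>) > r \<longrightarrow>
      z \<in> (*) (jfac \<phi> \<alpha> \<Omega>) ` (- pole_set N a (act \<phi> \<alpha> \<Omega>)) \<longrightarrow>
      (\<lambda>k. c k z * qpow m k \<Omega>) sums (jfac \<phi> \<alpha> \<Omega> powi (- int l) * a l (act \<phi> \<alpha> \<Omega>) (z / jfac \<phi> \<alpha> \<Omega>))"
      using P_Fourier[OF ell l SL] by blast
    show "\<exists>m>0. \<exists>c :: nat \<Rightarrow> complex \<Rightarrow> complex. \<forall>z. \<exists>r. \<forall>\<Omega>\<in>siegel_prod. Im (tau \<Omega>) > r \<longrightarrow>
      z \<in> - pole_set N (pull_a \<alpha>) \<Omega> \<longrightarrow> (\<lambda>k. c k z * qpow m k \<Omega>) sums pull_a \<alpha> l \<Omega> z"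
      using \<open>m > 0\<close> mc pull_a_pole_set[OF \<alpha>] by (intro exI[of _ m] conjI exI[of _ c]) (simp_all add: pull_a_def)
  qed
  from bchoice[OF this] obtain ma where *: "\<forall>l\<in>{2..N}. ma l > 0 \<and> (\<exists>c :: nat \<Rightarrow> complex \<Rightarrow> complex. \<forall>z. \<exists>r. \<forall>\<Omega>\<in>siegel_prod.
      Im (tau \<Omega>) > r \<longrightarrow> z \<in> - pole_set N (pull_a \<alpha>) \<Omega> \<longrightarrow> (\<lambda>k. c k z * qpow (ma l) k \<Omega>) sums pull_a \<alpha> l \<Omega> z)"
    by (rule exE)
  have ma: "ma l > 0" if "l \<in> {2..N}" for l
    using bspec[OF * that] by (rule conjunct1)
  have "\<forall>l\<in>{2..N}. \<exists>c :: nat \<Rightarrow> complex \<Rightarrow> complex. \<forall>z. \<exists>r. \<forall>\<Omega>\<in>siegel_prod.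
      Im (tau \<Omega>) > r \<longrightarrow> z \<in> - pole_set N (pull_a \<alpha>) \<Omega> \<longrightarrow> (\<lambda>k. c k z * qpow (ma l) k \<Omega>) sums pull_a \<alpha> l \<Omega> z"
    by (rule ballI, drule bspec[OF *], erule conjunct2)
  from bchoice[OF this] obtain ca where ca: "\<forall>l\<in>{2..N}. \<forall>z. \<exists>r. \<forall>\<Omega>\<in>siegel_prod.
      Im (tau \<Omega>) > r \<longrightarrow> z \<in> - pole_set N (pull_a \<alpha>) \<Omega> \<longrightarrow> (\<lambda>k. ca l k z * qpow (ma l) k \<Omega>) sums pull_a \<alpha> l \<Omega> z"
    by (rule exE)
  have "\<forall>j\<in>{..M}. \<exists>m>0. \<exists>c :: nat \<Rightarrow> (real \<Rightarrow> complex) \<Rightarrow> complex. \<forall>\<gamma>. path \<gamma> \<longrightarrow> (\<exists>r. \<forall>\<Omega>\<in>siegel_prod. Im (tau \<Omega>) > r \<longrightarrow>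
      path_image \<gamma> \<subseteq> - pole_set N (pull_a \<alpha>) \<Omega> \<longrightarrow> (\<lambda>k. c k \<gamma> * qpow m k \<Omega>) sums pull_b \<alpha> j \<Omega> \<gamma>)"
  proof
    fix j assume "j \<in> {..M}"
    then have j: "j \<le> M" by simp
    obtain m c where "m > 0" and mc: "\<forall>\<gamma>. path \<gamma> \<longrightarrow> (\<exists>r. \<forall>\<Omega>\<in>siegel_prod. Im (tau \<Omega>) > r \<longrightarrow>
      path_image \<gamma> \<subseteq> (*) (jfac \<phi> \<alpha> \<Omega>) ` (- pole_set N a (act \<phi> \<alpha> \<Omega>)) \<longrightarrow>
      (\<lambda>k. c k \<gamma> * qpow m k \<Omega>) sums (jfac \<phi> \<alpha> \<Omega> powi (- K - int j + int M) *
        b j (act \<phi> \<alpha> \<Omega>) (\<lambda>t. \<gamma> t / jfac \<phi> \<alpha> \<Omega>)))"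
      using Q_Fourier[OF ell j SL] by blast
    show "\<exists>m>0. \<exists>c :: nat \<Rightarrow> (real \<Rightarrow> complex) \<Rightarrow> complex. \<forall>\<gamma>. path \<gamma> \<longrightarrow> (\<exists>r. \<forall>\<Omega>\<in>siegel_prod. Im (tau \<Omega>) > r \<longrightarrow>
      path_image \<gamma> \<subseteq> - pole_set N (pull_a \<alpha>) \<Omega> \<longrightarrow> (\<lambda>k. c k \<gamma> * qpow m k \<Omega>) sums pull_b \<alpha> j \<Omega> \<gamma>)"
      using \<open>m > 0\<close> mc pull_a_pole_set[OF \<alpha>] by (intro exI[of _ m] conjI exI[of _ c]) (simp_all add: pull_b_def)
  qed
  from bchoice[OF this] obtain mb where *: "\<forall>j\<in>{..M}. mb j > 0 \<and> (\<exists>c :: nat \<Rightarrow> (real \<Rightarrow> complex) \<Rightarrow> complex. \<forall>\<gamma>. path \<gamma> \<longrightarrow> (\<exists>r. \<forall>\<Omega>\<in>siegel_prod.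
      Im (tau \<Omega>) > r \<longrightarrow> path_image \<gamma> \<subseteq> - pole_set N (pull_a \<alpha>) \<Omega> \<longrightarrow> (\<lambda>k. c k \<gamma> * qpow (mb j) k \<Omega>) sums pull_b \<alpha> j \<Omega> \<gamma>))"
    by (rule exE)
  have mb: "mb j > 0" if "j \<in> {..M}" for j
    using bspec[OF * that] by (rule conjunct1)
  have "\<forall>j\<in>{..M}. \<exists>c :: nat \<Rightarrow> (real \<Rightarrow> complex) \<Rightarrow> complex. \<forall>\<gamma>. path \<gamma> \<longrightarrow> (\<exists>r. \<forall>\<Omega>\<in>siegel_prod.
      Im (tau \<Omega>) > r \<longrightarrow> path_image \<gamma> \<subseteq> - pole_set N (pull_a \<alpha>) \<Omega> \<longrightarrow> (\<lambda>k. c k \<gamma> * qpow (mb j) k \<Omega>) sums pull_b \<alpha> j \<Omega> \<gamma>)"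
    by (rule ballI, drule bspec[OF *], erule conjunct2)
  from bchoice[OF this] obtain cb where cb: "\<forall>j\<in>{..M}. \<forall>\<gamma>. path \<gamma> \<longrightarrow> (\<exists>r. \<forall>\<Omega>\<in>siegel_prod.
      Im (tau \<Omega>) > r \<longrightarrow> path_image \<gamma> \<subseteq> - pole_set N (pull_a \<alpha>) \<Omega> \<longrightarrow> (\<lambda>k. cb j k \<gamma> * qpow (mb j) k \<Omega>) sums pull_b \<alpha> j \<Omega> \<gamma>)"
    by (rule exE)
  \<comment> \<open>A common multiple of the finitely many denominators.\<close>
  define m where "m = (\<Prod>l\<in>{2..N}. ma l) * (\<Prod>j\<in>{..M}. mb j)"
  have m: "m > 0" using ma mb by (simp add: m_def prod_pos)
  have dvd_a: "ma l dvd m" if "l \<in> {2..N}" for l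
    unfolding m_def using that by (intro dvd_mult2 dvd_prodI) auto
  have dvd_b: "mb j dvd m" if "j \<in> {..M}" for j
    unfolding m_def using that by (intro dvd_mult dvd_prodI) auto
  have nb: "cusp_nbhd k \<subseteq> siegel_prod" for k by (auto simp: cusp_nbhd_def)
  have "\<exists>k z1 z2. (\<forall>\<Omega>\<in>cusp_nbhd k. closed_segment z1 z2 \<subseteq> - pole_set N (pull_a \<alpha>) \<Omega>) \<and>
    (\<forall>p q. cusp_regular m k (\<lambda>\<Omega>. coeff (coeff (spec_poly N M (\<lambda>l. fps_expansion (P_coeff (pull_a \<alpha>) \<Omega> l) z2)
        (\<lambda>j. fps_expansion (germ (pull_b \<alpha> j \<Omega>) (linepath z1 z2)) z2)) p) q))"
  \<comment> \<open>The whole plane is allowed: the expansions are assumed for every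
    \<open>z\<close> and every path, only with a height \<open>r\<close> depending on them.\<close>
  proof (rule spec_poly_family[where D = UNIV, OF N cusp_nbhd_antimono])
    show "fun_subring (cusp_regular m k)" for k by (rule fun_subring_cusp_regular)
    show "cusp_regular m k' f" if "cusp_regular m k f" "k \<le> k'" for k k' f by (rule cusp_regular_mono[OF that])
    show "cusp_regular m k f"
      if "\<And>e. e > 0 \<Longrightarrow> \<exists>h. cusp_regular m k h \<and> (\<forall>x\<in>cusp_nbhd k. norm (h x - f x) \<le> e)" for k f
      using that by (rule cusp_regular_limit)
    show "pull_a \<alpha> l \<Omega> meromorphic_on UNIV" "pull_a \<alpha> l \<Omega> analytic_on {z. \<not> is_pole (pull_a \<alpha> l \<Omega>) z}"
      if "l \<in> {2..N}" "\<Omega> \<in> cusp_nbhd 0" for l \<Omega>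
      using that nb[of 0] pull_a_meromorphic[OF \<alpha>] pull_a_analytic[OF \<alpha>] by blast+
    show "multivalued_analytic (- pole_set N (pull_a \<alpha>) \<Omega>) (pull_b \<alpha> j \<Omega>)" if "j \<le> M" "\<Omega> \<in> cusp_nbhd 0" for j \<Omega>
      using that nb[of 0] pull_b_multivalued[OF \<alpha>] by blast
    show "\<exists>k. \<forall>k'\<ge>k. (\<forall>\<Omega>\<in>cusp_nbhd k'. z \<in> - pole_set N (pull_a \<alpha>) \<Omega> \<longrightarrow> norm (pull_a \<alpha> l \<Omega> z) \<le> real k) \<and>
        ((\<forall>\<Omega>\<in>cusp_nbhd k'. z \<in> - pole_set N (pull_a \<alpha>) \<Omega>) \<longrightarrow> cusp_regular m k' (\<lambda>\<Omega>. pull_a \<alpha> l \<Omega> z))"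
      if l: "l \<in> {2..N}" for l z
    proof -
      obtain r where r: "\<And>\<Omega>. \<Omega> \<in> siegel_prod \<Longrightarrow> Im (tau \<Omega>) > r \<Longrightarrow> z \<in> - pole_set N (pull_a \<alpha>) \<Omega> \<Longrightarrow>
          (\<lambda>k. ca l k z * qpow (ma l) k \<Omega>) sums pull_a \<alpha> l \<Omega> z"
        using spec[OF bspec[OF ca l], of z] by blast
      show ?thesis by (rule cusp_regular_of_q_series[OF ma[OF l] dvd_a[OF l]]) (rule r)
    qed
    show "\<exists>k. \<forall>k'\<ge>k. (\<forall>\<Omega>\<in>cusp_nbhd k'. path_image \<gamma> \<subseteq> - pole_set N (pull_a \<alpha>) \<Omega>) \<longrightarrow>
        (\<forall>\<Omega>\<in>cusp_nbhd k'. norm (pull_b \<alpha> j \<Omega> \<gamma>) \<le> real k) \<and> cusp_regular m k' (\<lambda>\<Omega>. pull_b \<alpha> j \<Omega> \<gamma>)"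
      if j: "j \<le> M" "path \<gamma>" for j \<gamma>
    proof -
      have j': "j \<in> {..M}" using j by simp
      obtain r where r: "\<And>\<Omega>. \<Omega> \<in> siegel_prod \<Longrightarrow> Im (tau \<Omega>) > r \<Longrightarrow> path_image \<gamma> \<subseteq> - pole_set N (pull_a \<alpha>) \<Omega> \<Longrightarrow>
          (\<lambda>k. cb j k \<gamma> * qpow (mb j) k \<Omega>) sums pull_b \<alpha> j \<Omega> \<gamma>"
        using mp[OF spec[OF bspec[OF cb j']] j(2)] by blast
      have "\<exists>k. \<forall>k'\<ge>k. (\<forall>\<Omega>\<in>cusp_nbhd k'. path_image \<gamma> \<subseteq> - pole_set N (pull_a \<alpha>) \<Omega> \<longrightarrow> norm (pull_b \<alpha> j \<Omega> \<gamma>) \<le> real k) \<and>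
        ((\<forall>\<Omega>\<in>cusp_nbhd k'. path_image \<gamma> \<subseteq> - pole_set N (pull_a \<alpha>) \<Omega>) \<longrightarrow> cusp_regular m k' (\<lambda>\<Omega>. pull_b \<alpha> j \<Omega> \<gamma>))"
        by (rule cusp_regular_of_q_series[OF mb[OF j'] dvd_b[OF j']]) (rule r)
      then show ?thesis by blast
    qed
  qed auto
  then obtain k0 z1 z2 where seg: "\<And>\<Omega>. \<Omega> \<in> cusp_nbhd k0 \<Longrightarrow> closed_segment z1 z2 \<subseteq> - pole_set N (pull_a \<alpha>) \<Omega>"
    and reg: "\<And>p q. cusp_regular m k0 (\<lambda>\<Omega>. coeff (coeff (spec_poly N M (\<lambda>l. fps_expansion (P_coeff (pull_a \<alpha>) \<Omega> l) z2)
        (\<lambda>j. fps_expansion (germ (pull_b \<alpha> j \<Omega>) (linepath z1 z2)) z2)) p) q)"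
    by blast
  define H where "H \<Omega> = jfac \<phi> \<alpha> \<Omega> powi (- wt p k) * coeff (coeff (F (act \<phi> \<alpha> \<Omega>)) k) p" for \<Omega>
  have H: "H \<Omega> = coeff (coeff (spec_poly N M (\<lambda>l. fps_expansion (P_coeff (pull_a \<alpha>) \<Omega> l) z2)
        (\<lambda>j. fps_expansion (germ (pull_b \<alpha> j \<Omega>) (linepath z1 z2)) z2)) k) p" if "\<Omega> \<in> cusp_nbhd k0" for \<Omega>
    using coeff_F_act[OF \<alpha> subsetD[OF nb that] path_linepath, of z1 z2 k p] seg[OF that] by (simp add: H_def)
  define \<beta> where "\<beta> s t = block \<phi> g s t \<alpha> $ n $ n" for s t
  have ct: "const_tuple t $ \<nu> $ i $ i' = t" for t and \<nu> :: 'g and i i' :: 'n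
    by (simp add: const_tuple_def)
  have denom: "denom \<phi> \<alpha> (const_tuple t) g $ n $ n = \<beta> Inr Inl * t + \<beta> Inr Inr" for t
    by (simp add: denom_def matrix_mult_n \<beta>_def const_tuple_def)
  have jf: "jfac \<phi> \<alpha> (const_tuple t) = \<beta> Inr Inl * t + \<beta> Inr Inr" for t
    by (simp add: jfac_def prod_g det_n denom)
  have up: "const_tuple t \<in> (siegel_prod :: (complex^'n^'n^'g) set)" if "t \<in> {t. Im t > 0}" for t
    using that const_tuple_siegel by blast
  have jf0: "\<beta> Inr Inl * t + \<beta> Inr Inr \<noteq> 0" if "t \<in> {t. Im t > 0}" for t
    using J[OF \<alpha> up[OF that]] by (simp add: jf)
  have act: "act \<phi> \<alpha> (const_tuple t) $ \<nu> $ i $ i' = (\<beta> Inl Inl * t + \<beta> Inl Inr) / (\<beta> Inr Inl * t + \<beta> Inr Inr)"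
    if "t \<in> {t. Im t > 0}" for t \<nu> i i'
    using matrix_inv_n[OF denom_invertible[OF embeddings \<alpha> up[OF that], of g]] n[of i] n[of i'] g[of \<nu>]
    by (simp add: act_def matrix_mult_n denom ct \<beta>_def)
  \<comment> \<open>This comes from holomorphy of \<open>F\<close> at the image point, which is a
    quotient of affine functions of \<open>t\<close>, and so holds on the whole half plane and not
    just above \<open>k0\<close>.\<close>
  have hol: "(\<lambda>t. H (const_tuple t)) holomorphic_on {t. Im t > 0}"
    unfolding H_def
  proof (intro holomorphic_on_mult)
    show "(\<lambda>t. jfac \<phi> \<alpha> (const_tuple t) powi (- wt p k)) holomorphic_on {t. Im t > 0}"
      unfolding jf using jf0 by (intro holomorphic_intros) auto
    show "(\<lambda>t. coeff (coeff (F (act \<phi> \<alpha> (const_tuple t))) k) p) holomorphic_on {t. Im t > 0}"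
    proof (rule holomorphic_mv_compose[OF F_holomorphic])
      show "open {t. Im t > 0}" by (simp add: open_halfspace_Im_gt)
      show "act \<phi> \<alpha> (const_tuple t) \<in> siegel_prod" if "t \<in> {t. Im t > 0}" for t
        by (rule act_in[OF \<alpha> up[OF that]])
      show "(\<lambda>t. act \<phi> \<alpha> (const_tuple t) $ \<nu> $ i $ i') holomorphic_on {t. Im t > 0}" for \<nu> i i'
      proof (rule holomorphic_transform)
        show "(\<lambda>t. (\<beta> Inl Inl * t + \<beta> Inl Inr) / (\<beta> Inr Inl * t + \<beta> Inr Inr)) holomorphic_on {t. Im t > 0}"
          using jf0 by (intro holomorphic_intros) auto
      qed (simp add: act)
    qed
  qed
  have cn: "const_tuple t \<in> cusp_nbhd k0" if "Im t > real k0" for t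
    using that by (simp add: cusp_nbhd_def siegel_iff tau_const_tuple)
  obtain B where B: "\<And>\<Omega>. \<Omega> \<in> cusp_nbhd k0 \<Longrightarrow> norm (H \<Omega>) \<le> B"
    using reg[of k p] unfolding cusp_regular_def by (auto simp: H)
  have per: "H (const_tuple (t + of_nat m)) = H (const_tuple t)" if t: "Im t > real k0" for t
  proof -
    have "const_tuple (t + of_nat m) \<in> cusp_nbhd k0" using t by (intro cn) simp
    then show ?thesis
      using reg[of k p] cn[OF t] unfolding cusp_regular_def by (auto simp: H tau_const_tuple dest!: bspec[OF _ cn[OF t]])
  qed
  obtain c where c: "\<And>t. Im t > 0 \<Longrightarrow> (\<lambda>n. c n * exp (2 * of_real pi * \<i> * of_nat n * t / of_nat m)) sums H (const_tuple t)"
    using q_expansion[OF m hol per] B cn by blast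
  have "(\<lambda>i. c i * qpow m i \<Omega>) sums H \<Omega>" if "\<Omega> \<in> siegel_prod" for \<Omega>
    using c[of "tau \<Omega>"] that by (simp add: siegel_iff const_tuple_tau qpow_def)
  then show ?thesis using m unfolding H_def by blast
qed

end

theorem theorem2p7:
  fixes \<phi> :: "'g::finite \<Rightarrow> 'f::field_char_0 \<Rightarrow> real"
    and \<Gamma> :: "('f^('n::finite + 'n)^('n + 'n)) set"
    and N M :: nat and K :: int
    and a :: "nat \<Rightarrow> complex^'n^'n^'g \<Rightarrow> complex \<Rightarrow> complex"
    and b :: "nat \<Rightarrow> complex^'n^'n^'g \<Rightarrow> (real \<Rightarrow> complex) \<Rightarrow> complex"
    and \<xi> :: "complex^'n^'n^'g \<Rightarrow> (real \<Rightarrow> complex) \<Rightarrow> complex fps"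
    and A :: "complex^'n^'n^'g \<Rightarrow> complex fls"
  assumes "totally_real_embeddings \<phi>"
    and "congruence_subgroup \<Gamma>"
    and "N \<ge> 1"
    and "operator_P \<phi> \<Gamma> N a"
    and "D_space \<phi> \<Gamma> N a K M b"
    and "baker_akhiezer N a \<xi>"
    and "eigen_series N a \<xi> M b A"
  shows "\<exists>F :: complex^'n^'n^'g \<Rightarrow> complex poly poly.
           (\<forall>\<Omega>\<in>siegel_prod. eval_X N (F \<Omega>) = spectral_product N (A \<Omega>)) \<and>
           (\<forall>j k. automorphic_form \<phi> \<Gamma> (int N * K - int N * int j - K * int k)
                    (\<lambda>\<Omega>. coeff (coeff (F \<Omega>) k) j))"
proof -
  interpret spectral_setup \<phi> \<Gamma> N M K a b \<xi> A
    using assms by unfold_locales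
  have "eval_X N (F \<Omega>) = spectral_product N (A \<Omega>)" if \<Omega>: "\<Omega> \<in> siegel_prod" for \<Omega>
  proof -
    obtain z where "z \<in> - pole_set N a \<Omega>" using Compl_pole_set_nonempty[OF \<Omega>] by blast
    then show ?thesis using eval_X_F[OF \<Omega>, of "linepath z z"] by simp
  qed
  moreover have "automorphic_form \<phi> \<Gamma> (wt j k) (\<lambda>\<Omega>. coeff (coeff (F \<Omega>) k) j)" for j k
    unfolding automorphic_form_def
  proof (intro conjI ballI impI)
    show "holomorphic_mv (\<lambda>\<Omega>. coeff (coeff (F \<Omega>) k) j) siegel_prod" by (rule F_holomorphic)
    show "coeff (coeff (F (act \<phi> \<alpha> \<Omega>)) k) j = jfac \<phi> \<alpha> \<Omega> powi wt j k * coeff (coeff (F \<Omega>) k) j"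
      if "\<alpha> \<in> \<Gamma>" "\<Omega> \<in> siegel_prod" for \<alpha> \<Omega>
      by (rule coeff_F_automorphic[OF that Compl_pole_set_nonempty[OF that(2)]])
    show "\<exists>m>0. \<exists>c. \<forall>\<Omega>\<in>siegel_prod. (\<lambda>i. c i * qpow m i \<Omega>) sums
        (jfac \<phi> \<alpha> \<Omega> powi (- wt j k) * coeff (coeff (F (act \<phi> \<alpha> \<Omega>)) k) j)"
      if "elliptic_case TYPE('f^('n + 'n)^('n + 'n))" "\<alpha> \<in> SL_Z" for \<alpha>
      by (rule F_expansion_at_cusp[OF that])
  qed
  ultimately show ?thesis by blast
qed

end
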